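(* Let $\mathcal{H}$ be an infinite-dimensional complex reproducing kernel Hilbert space of analytic functions on the unit disk $\mathbb{D}$, with kernels $k_w$ ($w\in\mathbb{D}$), such that $k_a\ne0$ for all $a\in\mathbb{D}$ and $\{k_a,k_b\}$ is linearly independent whenever $a\neq b$. Assume that the group $\mathcal{M}(\mathbb{D})$ of Moebius transformations of $\mathbb{D}$ acts on $\mathcal{H}$ by composition operators, i.e. $f\circ\varphi^{-1}\in\mathcal{H}$ whenever $f\in\mathcal{H}$ and $\varphi\in\mathcal{M}(\mathbb{D})$. Assume moreover that whenever $(w_n)$ is a sequence in $\mathbb{D}$ converging to a point of the unit circle, $\lim_{n\to\infty}\frac{k_{w_n}(z)}{\|k_{w_n}\|}=0$ for all $z\in\mathbb{D}$. Then the space $\mathrm{Gr}_{\mathbf{p}}(\mathcal{H})=\{\mathcal{Z}_a:a\in\mathbb{D}\}$, where $\mathcal{Z}_a=\{f\in\mathcal{H}:f(a)=0\}$, is a closed submanifold of $\mathrm{Gr}(\mathcal{H})$, and a homogeneous space under the action of $\mathcal{M}(\mathbb{D})$ given by $\varphi\cdot\mathcal{Z}_a=\mathcal{Z}_{\varphi(a)}$.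
   Context: The kernel $k_w\in\mathcal{H}$ satisfies $f(w)=\langle f,k_w\rangle$ for all $f\in\mathcal{H}$. $\mathrm{Gr}(\mathcal{H})$ is the Grassmann manifold of closed subspaces of $\mathcal{H}$, identified with the set of orthogonal projections, a complemented submanifold of $\mathcal{B}(\mathcal{H})$ (operator norm). $\mathcal{M}(\mathbb{D})$ consists of the maps $\varphi_{a,w}(z)=w\frac{a-z}{1-\bar a z}$, $a\in\mathbb{D}$, $|w|=1$, and is regarded as a Lie group. One has $\varphi\cdot\mathcal{Z}_a=C_{\varphi^{-1}}(\mathcal{Z}_a)$, where $C_\psi f=f\circ\psi$. *)

theory Defs
  imports "HOL-Analysis.Analysis" "HOL-Algebra.Group_Action"
begin

section \<open>Complex Hilbert spaces\<close>

text \<open>The inner product is linear in the first argument, so that a reproducing kernel satisfies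
  \<open>f w = cinner f (k w)\<close>.\<close>

class complex_hilbert_space = banach +
  fixes scaleC :: "complex \<Rightarrow> 'a \<Rightarrow> 'a" (infixr "*\<^sub>C" 75)
    and cinner :: "'a \<Rightarrow> 'a \<Rightarrow> complex"
  assumes scaleC_add_right: "c *\<^sub>C (x + y) = c *\<^sub>C x + c *\<^sub>C y"
    and scaleC_add_left: "(c + d) *\<^sub>C x = c *\<^sub>C x + d *\<^sub>C x"
    and scaleC_scaleC: "c *\<^sub>C (d *\<^sub>C x) = (c * d) *\<^sub>C x"
    and scaleC_of_real: "complex_of_real r *\<^sub>C x = r *\<^sub>R x"
    and cinner_commute: "cinner x y = cnj (cinner y x)"
    and cinner_add_left: "cinner (x + y) z = cinner x z + cinner y z"
    and cinner_scaleC_left: "cinner (c *\<^sub>C x) y = c * cinner x y"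
    and cinner_self: "cinner x x = complex_of_real ((norm x)\<^sup>2)"

lemma scaleC_one: "1 *\<^sub>C x = (x :: 'a::complex_hilbert_space)"
  using scaleC_of_real[of 1 x] by simp

global_interpretation complex_hilbert: vector_space "scaleC :: complex \<Rightarrow> 'a \<Rightarrow> 'a::complex_hilbert_space"
  by unfold_locales (simp_all add: scaleC_add_right scaleC_add_left scaleC_scaleC scaleC_one)


section \<open>The Banach space of bounded complex-linear operators\<close>

typedef (overloaded) ('a::complex_hilbert_space) bop =
  "{T :: 'a \<Rightarrow>\<^sub>L 'a. \<forall>c x. blinfun_apply T (c *\<^sub>C x) = c *\<^sub>C blinfun_apply T x}"
  by (rule exI[of _ id_blinfun]) simp

setup_lifting type_definition_bop

lift_definition bop_apply :: "('a::complex_hilbert_space) bop \<Rightarrow> 'a \<Rightarrow> 'a" is blinfun_apply .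

text \<open>All structure, in particular the operator norm, is inherited from \<^typ>\<open>'a \<Rightarrow>\<^sub>L 'a\<close>.\<close>

instantiation bop :: (complex_hilbert_space) real_normed_vector
begin

lift_definition norm_bop :: "'a bop \<Rightarrow> real" is norm .

lift_definition zero_bop :: "'a bop" is 0
  using scaleC_of_real[of 0 "0 :: 'a"] complex_hilbert.scale_zero_right by simp

lift_definition plus_bop :: "'a bop \<Rightarrow> 'a bop \<Rightarrow> 'a bop" is "(+)"
  by (simp add: blinfun.add_left scaleC_add_right)

lift_definition uminus_bop :: "'a bop \<Rightarrow> 'a bop" is uminus
  by (simp add: blinfun.minus_left complex_hilbert.scale_minus_right)

lift_definition minus_bop :: "'a bop \<Rightarrow> 'a bop \<Rightarrow> 'a bop" is "(-)"
  by (simp add: blinfun.diff_left complex_hilbert.scale_right_diff_distrib)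

lift_definition scaleR_bop :: "real \<Rightarrow> 'a bop \<Rightarrow> 'a bop" is scaleR
  by (simp add: blinfun.scaleR_left scaleC_of_real[symmetric] scaleC_scaleC mult.commute)

definition dist_bop :: "'a bop \<Rightarrow> 'a bop \<Rightarrow> real"
  where "dist_bop S T = norm (S - T)"

definition sgn_bop :: "'a bop \<Rightarrow> 'a bop"
  where "sgn_bop T = scaleR (inverse (norm T)) T"

definition uniformity_bop :: "('a bop \<times> 'a bop) filter"
  where "uniformity_bop = (INF e\<in>{0 <..}. principal {(x, y). dist x y < e})"

definition open_bop :: "'a bop set \<Rightarrow> bool"
  where "open_bop S = (\<forall>x\<in>S. \<forall>\<^sub>F (x', y) in uniformity. x' = x \<longrightarrow> y \<in> S)"

instance
proof
  show "dist S T = norm (S - T)" for S T :: "'a bop" by (rule dist_bop_def)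
  show "sgn T = scaleR (inverse (norm T)) T" for T :: "'a bop" by (rule sgn_bop_def)
  show "(uniformity :: ('a bop \<times> 'a bop) filter) = (INF e\<in>{0 <..}. principal {(x, y). dist x y < e})"
    by (rule uniformity_bop_def)
  show "open S = (\<forall>x\<in>S. \<forall>\<^sub>F (x', y) in uniformity. x' = x \<longrightarrow> y \<in> S)" for S :: "'a bop set"
    by (rule open_bop_def)
  show "norm (S + T) \<le> norm S + norm T" for S T :: "'a bop"
    by transfer (rule norm_triangle_ineq)
qed (transfer, simp add: algebra_simps)+

end

instance bop :: (complex_hilbert_space) banach
proof
  fix X :: "nat \<Rightarrow> 'a bop"
  assume "Cauchy X"
  then have "Cauchy (\<lambda>n. Rep_bop (X n))"
    unfolding Cauchy_def dist_norm by (simp add: norm_bop.rep_eq minus_bop.rep_eq)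
  then obtain L where L: "(\<lambda>n. Rep_bop (X n)) \<longlonglongrightarrow> L"
    using Cauchy_convergent_iff convergent_def by blast
  have lim: "(\<lambda>n. blinfun_apply (Rep_bop (X n)) x) \<longlonglongrightarrow> blinfun_apply L x" for x
    using blinfun.tendsto[OF L tendsto_const] .
  have isom: "norm (c *\<^sub>C x) = cmod c * norm x" for c and x :: 'a
  proof -
    have "complex_of_real ((norm (c *\<^sub>C x))\<^sup>2) = c * cnj c * cinner x x"
      by (metis cinner_self cinner_scaleC_left cinner_commute complex_cnj_mult mult.assoc)
    also have "\<dots> = complex_of_real ((cmod c * norm x)\<^sup>2)"
      by (simp add: cinner_self complex_norm_square[symmetric] power_mult_distrib
          del: of_real_power)
    finally have "(norm (c *\<^sub>C x))\<^sup>2 = (cmod c * norm x)\<^sup>2"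
      using of_real_eq_iff by blast
    then show ?thesis by (simp add: power2_eq_iff_nonneg)
  qed
  have "bounded_linear (\<lambda>x :: 'a. c *\<^sub>C x)" for c
    by (rule bounded_linear_intro[where K = "cmod c"])
      (simp_all add: scaleC_add_right isom scaleC_of_real[symmetric] scaleC_scaleC mult.commute)
  then have "(\<lambda>n. c *\<^sub>C blinfun_apply (Rep_bop (X n)) x) \<longlonglongrightarrow> c *\<^sub>C blinfun_apply L x" for c x
    using bounded_linear.tendsto lim by blast
  then have "blinfun_apply L (c *\<^sub>C x) = c *\<^sub>C blinfun_apply L x" for c x
    using lim[of "c *\<^sub>C x"] Rep_bop[of "X _"] by (auto intro: LIMSEQ_unique)
  then have "Rep_bop (Abs_bop L) = L"
    by (simp add: Abs_bop_inverse)
  then have "X \<longlonglongrightarrow> Abs_bop L"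
    using L by (simp add: tendsto_iff dist_norm norm_bop.rep_eq minus_bop.rep_eq)
  then show "convergent X"
    by (rule convergentI)
qed


section \<open>Smooth maps and submanifolds of Banach spaces\<close>

text \<open>Bounded \<open>k\<close>-linear maps, encoded as functions on lists of length \<open>k\<close>.\<close>

definition bounded_multilinear :: "nat \<Rightarrow> ('a::real_normed_vector list \<Rightarrow> 'b::real_normed_vector) \<Rightarrow> bool"
  where "bounded_multilinear k m \<longleftrightarrow>
    (\<forall>vs i. length vs = k \<and> i < k \<longrightarrow> linear (\<lambda>v. m (vs[i := v]))) \<and>
    (\<exists>C. \<forall>vs. length vs = k \<longrightarrow> norm (m vs) \<le> C * prod_list (map norm vs))"

text \<open>\<open>f\<close> is smooth (of class \<open>C\<^sup>\<infinity>\<close> over the reals, in the sense of Frechet) on the open set \<open>U\<close>.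
  For \<open>length vs = k\<close> the value \<open>D x vs\<close> is the \<open>k\<close>-th derivative of \<open>f\<close> at \<open>x\<close> applied to \<open>vs\<close>.
  The last clause says that \<open>D\<close> on lists of length \<open>Suc k\<close> is the Frechet derivative of \<open>D\<close> on lists
  of length \<open>k\<close> with respect to the norm of bounded \<open>k\<close>-linear maps: the estimate is uniform in \<open>vs\<close>.
  Lists are used because the iterated function spaces of derivatives of unbounded order do not fit
  into a single type.\<close>

definition smooth_on :: "'a::real_normed_vector set \<Rightarrow> ('a \<Rightarrow> 'b::real_normed_vector) \<Rightarrow> bool"
  where "smooth_on U f \<longleftrightarrow> open U \<and>
    (\<exists>D :: 'a \<Rightarrow> 'a list \<Rightarrow> 'b.
      (\<forall>x\<in>U. D x [] = f x) \<and>
      (\<forall>k. \<forall>x\<in>U. bounded_multilinear k (D x)) \<and>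
      (\<forall>k. \<forall>x\<in>U. \<forall>e>0. \<exists>d>0. \<forall>y\<in>U. norm (y - x) < d \<longrightarrow>
        (\<forall>vs. length vs = k \<longrightarrow>
          norm (D y vs - D x vs - D x ((y - x) # vs)) \<le> e * norm (y - x) * prod_list (map norm vs))))"

definition smooth_diffeomorphism ::
    "'a::real_normed_vector set \<Rightarrow> 'b::real_normed_vector set \<Rightarrow> ('a \<Rightarrow> 'b) \<Rightarrow> ('b \<Rightarrow> 'a) \<Rightarrow> bool"
  where "smooth_diffeomorphism U V \<Phi> \<Psi> \<longleftrightarrow>
    homeomorphism U V \<Phi> \<Psi> \<and> smooth_on U \<Phi> \<and> smooth_on V \<Psi>"

definition complemented_subspace :: "'a::real_normed_vector set \<Rightarrow> bool"
  where "complemented_subspace F \<longleftrightarrow>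
    (\<exists>Q :: 'a \<Rightarrow> 'a. bounded_linear Q \<and> Q \<circ> Q = Q \<and> range Q = F)"

text \<open>Complemented (split, embedded) submanifolds of a Banach space.\<close>

definition submanifold :: "'a::banach set \<Rightarrow> bool"
  where "submanifold M \<longleftrightarrow>
    (\<forall>p\<in>M. \<exists>U V \<Phi> \<Psi> F. p \<in> U \<and> smooth_diffeomorphism U V \<Phi> \<Psi> \<and>
      complemented_subspace (F :: 'a set) \<and> \<Phi> ` (U \<inter> M) = V \<inter> F)"

text \<open>\<open>N\<close> is a submanifold of the submanifold \<open>M\<close>: the restriction of \<open>\<Phi>\<close> to \<open>U \<inter> M\<close> is a chart of \<open>M\<close>
  with values in \<open>F\<close> that is adapted to \<open>N\<close>.\<close>

definition submanifold_of :: "'a::banach set \<Rightarrow> 'a set \<Rightarrow> bool"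
  where "submanifold_of N M \<longleftrightarrow> submanifold M \<and> N \<subseteq> M \<and>
    (\<forall>p\<in>N. \<exists>U V \<Phi> \<Psi> F G. p \<in> U \<and> smooth_diffeomorphism U V \<Phi> \<Psi> \<and>
      complemented_subspace (F :: 'a set) \<and> \<Phi> ` (U \<inter> M) = V \<inter> F \<and>
      complemented_subspace G \<and> G \<subseteq> F \<and> \<Phi> ` (U \<inter> N) = V \<inter> G)"

definition closed_submanifold_of :: "'a::banach set \<Rightarrow> 'a set \<Rightarrow> bool"
  where "closed_submanifold_of N M \<longleftrightarrow> submanifold_of N M \<and> closedin (top_of_set M) N"

text \<open>Smoothness of a map on a submanifold \<open>M\<close>; a map into a submanifold is smooth iff it is smooth
  as a map into the ambient space.\<close>

definition smooth_map_on :: "'a::real_normed_vector set \<Rightarrow> ('a \<Rightarrow> 'b::real_normed_vector) \<Rightarrow> bool"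
  where "smooth_map_on M f \<longleftrightarrow>
    (\<forall>p\<in>M. \<exists>U g. p \<in> U \<and> smooth_on U g \<and> (\<forall>x\<in>U \<inter> M. g x = f x))"


section \<open>Lie groups and homogeneous spaces\<close>

text \<open>The manifold structure of \<open>G\<close> is transported along the bijection \<open>c\<close> from a submanifold \<open>S\<close>.\<close>

definition lie_group :: "('g, 'm) monoid_scheme \<Rightarrow> 's::banach set \<Rightarrow> ('s \<Rightarrow> 'g) \<Rightarrow> bool"
  where "lie_group G S c \<longleftrightarrow> group G \<and> submanifold S \<and> bij_betw c S (carrier G) \<and>
    smooth_map_on (S \<times> S) (\<lambda>(s, t). inv_into S c (c s \<otimes>\<^bsub>G\<^esub> c t)) \<and>
    smooth_map_on S (\<lambda>s. inv_into S c (inv\<^bsub>G\<^esub> (c s)))"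

definition homogeneous_space ::
    "('g, 'm) monoid_scheme \<Rightarrow> 's::banach set \<Rightarrow> ('s \<Rightarrow> 'g) \<Rightarrow> 'e::banach set \<Rightarrow> ('g \<Rightarrow> 'e \<Rightarrow> 'e) \<Rightarrow> bool"
  where "homogeneous_space G S c M act \<longleftrightarrow> lie_group G S c \<and> submanifold M \<and>
    transitive_action G M act \<and> smooth_map_on (S \<times> M) (\<lambda>(s, x). act (c s) x)"


section \<open>The Moebius group of the unit disk\<close>

abbreviation unit_disk :: "complex set" where "unit_disk \<equiv> ball 0 1"

definition disk_moebius :: "complex \<times> complex \<Rightarrow> complex \<Rightarrow> complex"
  where "disk_moebius = (\<lambda>(a, w). \<lambda>z\<in>unit_disk. w * ((a - z) / (1 - cnj a * z)))"

definition moebius_params :: "(complex \<times> complex) set"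
  where "moebius_params = unit_disk \<times> sphere 0 1"

definition moebius_group :: "(complex \<Rightarrow> complex) monoid"
  where "moebius_group =
    \<lparr>carrier = disk_moebius ` moebius_params, mult = compose unit_disk, one = (\<lambda>z\<in>unit_disk. z)\<rparr>"


section \<open>Reproducing kernel Hilbert spaces on the disk and the Grassmannian\<close>

text \<open>The function \<open>ev f\<close>, restricted to the disk, is the function represented by the vector \<open>f\<close>; distinct
  vectors represent distinct functions. Values of \<open>ev f\<close> and \<open>k\<close> outside the disk are irrelevant.\<close>

definition analytic_rkhs_on_disk ::
    "('h::complex_hilbert_space \<Rightarrow> complex \<Rightarrow> complex) \<Rightarrow> (complex \<Rightarrow> 'h) \<Rightarrow> bool"
  where "analytic_rkhs_on_disk ev k \<longleftrightarrow>
    (\<forall>f g. \<forall>z\<in>unit_disk. ev (f + g) z = ev f z + ev g z) \<and>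
    (\<forall>c f. \<forall>z\<in>unit_disk. ev (c *\<^sub>C f) z = c * ev f z) \<and>
    (\<forall>f g. (\<forall>z\<in>unit_disk. ev f z = ev g z) \<longrightarrow> f = g) \<and>
    (\<forall>f. ev f holomorphic_on unit_disk) \<and>
    (\<forall>f. \<forall>w\<in>unit_disk. ev f w = cinner f (k w))"

definition vanishing_space :: "('h \<Rightarrow> complex \<Rightarrow> complex) \<Rightarrow> complex \<Rightarrow> 'h set"
  where "vanishing_space ev a = {f. ev f a = 0}"

text \<open>A closed subspace is identified with the orthogonal projection onto it.\<close>

definition Grassmannian :: "('h::complex_hilbert_space) bop set"
  where "Grassmannian = {P. (\<forall>x. bop_apply P (bop_apply P x) = bop_apply P x) \<and>
    (\<forall>x y. cinner (bop_apply P x) y = cinner x (bop_apply P y))}"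

definition proj_onto :: "('h::complex_hilbert_space) set \<Rightarrow> 'h bop"
  where "proj_onto S = (THE P. P \<in> Grassmannian \<and> range (bop_apply P) = S)"

definition point_Grassmannian :: "('h::complex_hilbert_space \<Rightarrow> complex \<Rightarrow> complex) \<Rightarrow> 'h bop set"
  where "point_Grassmannian ev = (\<lambda>a. proj_onto (vanishing_space ev a)) ` unit_disk"

end

theory Submission
  imports Defs "HOL-Complex_Analysis.Riemann_Mapping"
begin

text \<open>The projection onto \<open>Z\<^sub>a\<close> is \<open>1 - |k\<^sub>a><k\<^sub>a| / \<parallel>k\<^sub>a\<parallel>\<^sup>2\<close>. It depends smoothly on \<open>a\<close> because \<open>k\<close> is weakly, hence strongly,
  antiholomorphic. This parametrization is an immersion: otherwise Moebius invariance would make \<open>f' (b) = c\<^sub>b f (b)\<close> hold for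
  all \<open>f\<close> and \<open>b\<close>, and the space would be one-dimensional. It is a homeomorphism onto a closed subset of the Grassmannian:
  as \<open>a\<close> tends to the circle the projections converge strongly to \<open>1\<close>, but their distance to \<open>1\<close> is always one.\<close>

section \<open>Smooth maps between normed spaces\<close>

text \<open>\<open>submanifold\<close> asks for diffeomorphisms between open sets of the whole
  operator space. Graph coordinates must therefore be extended to operators that are not
  projections, and one such chart has to straighten the Grassmannian and the curve of point
  subspaces together. The projection onto Z_a is only real smooth in a, but graph coordinates are
  holomorphic: where k_a(b) is nonzero, the hyperplane Z_b is the graph over Z_a of the map x |->
  -(x(b) / k_a(b)) k_a. Testing it on one y in Z_a with y'(a) nonzero gives the scalar function y(b)
  / k_a(b), a local biholomorphism near a. One-variable theory thus does the work of an inverse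
  function theorem in Banach spaces. The same inverse recovers a point smoothly from its projection,
  whence the smoothness of the action. Embeddedness is not a local matter in a: points running to
  the circle might have projections that return to a given one. The behaviour at the boundary
  excludes this, and one sequential statement yields both closedness and embeddedness.\<close>

text \<open>The iterated derivatives of a map \<open>f\<close> live in different types. They are represented as families of functions indexed by
  lists of vectors, with norms measured by a weight on the indices: differentiation conses a direction to the index and
  multiplies the weight by its norm. Uniformity in the index is operator norm differentiability, and since the type of
  families does not change, closure properties can be proved by induction on the order of differentiability.\<close>

definition dweight :: "('a::real_normed_vector list \<Rightarrow> real) \<Rightarrow> 'a list \<Rightarrow> real"
  where "dweight w vs = (case vs of [] \<Rightarrow> 0 | v # us \<Rightarrow> norm v * w us)"

lemma dweight_simps [simp]: "dweight w [] = 0" "dweight w (v # us) = norm v * w us"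
  by (simp_all add: dweight_def)

definition fam_deriv :: "'a::real_normed_vector set \<Rightarrow> ('a list \<Rightarrow> real) \<Rightarrow>
    ('a \<Rightarrow> 'a list \<Rightarrow> 'b::real_normed_vector) \<Rightarrow> ('a \<Rightarrow> 'a list \<Rightarrow> 'b) \<Rightarrow> bool"
  where "fam_deriv U w t t' \<longleftrightarrow> (\<forall>x\<in>U. (\<forall>us. linear (\<lambda>v. t' x (v # us))) \<and>
    (\<forall>e>0. \<exists>d>0. \<forall>y\<in>U. norm (y - x) < d \<longrightarrow>
      (\<forall>us. norm (t y us - t x us - t' x ((y - x) # us)) \<le> e * norm (y - x) * w us)))"

definition fam_bounded :: "'a::real_normed_vector set \<Rightarrow> ('a list \<Rightarrow> real) \<Rightarrow>
    ('a \<Rightarrow> 'a list \<Rightarrow> 'b::real_normed_vector) \<Rightarrow> bool"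
  where "fam_bounded U w t \<longleftrightarrow> (\<forall>us. 0 \<le> w us) \<and> (\<forall>x\<in>U. \<exists>C. \<forall>us. norm (t x us) \<le> C * w us)"

text \<open>Order 0 asks for pointwise bounds only. A smooth map satisfies every finite order, so
  continuity of the top derivative need not be tracked and the base cases of the closure proofs are
  mere estimates.\<close>

primrec fam_smooth :: "nat \<Rightarrow> 'a::real_normed_vector set \<Rightarrow> ('a list \<Rightarrow> real) \<Rightarrow>
    ('a \<Rightarrow> 'a list \<Rightarrow> 'b::real_normed_vector) \<Rightarrow> bool"
  where "fam_smooth 0 U w t \<longleftrightarrow> fam_bounded U w t"
  | "fam_smooth (Suc n) U w t \<longleftrightarrow> fam_bounded U w t \<and>
      (\<exists>t'. fam_deriv U w t t' \<and> fam_smooth n U (dweight w) t')"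

lemma fam_smooth_bounded: "fam_smooth n U w t \<Longrightarrow> fam_bounded U w t"
  by (cases n) auto

lemma fam_boundedD:
  assumes "fam_bounded U w t" "x \<in> U"
  shows "\<exists>C\<ge>0. \<forall>us. norm (t x us) \<le> C * w us"
proof -
  obtain C where "\<And>us. norm (t x us) \<le> C * w us"
    using assms unfolding fam_bounded_def by blast
  moreover have "C * w us \<le> max C 0 * w us" for us
    using assms(1) by (intro mult_right_mono) (auto simp: fam_bounded_def)
  ultimately have "\<And>us. norm (t x us) \<le> max C 0 * w us"
    by (meson order_trans)
  then show ?thesis by (intro exI[of _ "max C 0"]) auto
qed

lemma fam_smooth_SucI:
  "fam_bounded U w t \<Longrightarrow> fam_deriv U w t t' \<Longrightarrow> fam_smooth n U (dweight w) t' \<Longrightarrow> fam_smooth (Suc n) U w t"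
  by auto

lemma fam_smooth_SucE:
  assumes "fam_smooth (Suc n) U w t"
  obtains t' where "fam_bounded U w t" "fam_deriv U w t t'" "fam_smooth n U (dweight w) t'"
  using assms by auto

lemma fam_smooth_mono: "fam_smooth (Suc n) U w t \<Longrightarrow> fam_smooth n U w t"
proof (induction n arbitrary: w t)
  case (Suc n)
  from Suc.prems obtain t' where "fam_deriv U w t t'" "fam_smooth (Suc n) U (dweight w) t'" by auto
  with Suc.IH[of "dweight w" t'] Suc.prems show ?case by auto
qed simp

lemma fam_bounded_cong:
  "(\<And>x us. x \<in> U \<Longrightarrow> t x us = s x us) \<Longrightarrow> fam_bounded U w t = fam_bounded U w s"
  unfolding fam_bounded_def by simp

lemma fam_deriv_cong:
  assumes "\<And>x us. x \<in> U \<Longrightarrow> t x us = s x us" "\<And>x us. x \<in> U \<Longrightarrow> t' x us = s' x us"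
  shows "fam_deriv U w t t' = fam_deriv U w s s'"
  using assms unfolding fam_deriv_def by simp

lemma fam_smooth_cong:
  assumes "\<And>x us. x \<in> U \<Longrightarrow> t x us = s x us"
  shows "fam_smooth n U w t = fam_smooth n U w s"
  by (cases n) (use assms in \<open>simp_all add: fam_bounded_cong[of U t s] fam_deriv_cong[of U t s]\<close>)

text \<open>In a product rule the undifferentiated factor has an index one entry shorter than the
  derivative; reindexing by \<open>tl\<close> repairs this. The induction needs a general
  \<open>r\<close>, since each derivative puts its new direction in front of the reindexed
  tail.\<close>

lemma fam_smooth_reindex:
  "fam_smooth n U w t \<Longrightarrow> fam_smooth n U (\<lambda>us. w (r us)) (\<lambda>x us. t x (r us))"
proof (induction n arbitrary: w t r)
  case 0
  then show ?case by (fastforce simp: fam_bounded_def)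
next
  case (Suc n)
  from Suc.prems obtain t' where t': "fam_deriv U w t t'" "fam_smooth n U (dweight w) t'" "fam_bounded U w t"
    by (blast elim: fam_smooth_SucE)
  define r' where "r' = (\<lambda>us. case us of [] \<Rightarrow> [] | v # vs \<Rightarrow> v # r vs)"
  have w: "dweight (\<lambda>us. w (r us)) = (\<lambda>us. dweight w (r' us))"
    by (auto simp: fun_eq_iff r'_def dweight_def split: list.split)
  have "fam_deriv U (\<lambda>us. w (r us)) (\<lambda>x us. t x (r us)) (\<lambda>x us. t' x (r' us))"
    using t'(1) unfolding fam_deriv_def r'_def by simp meson
  moreover have "fam_bounded U (\<lambda>us. w (r us)) (\<lambda>x us. t x (r us))"
    using t'(3) by (fastforce simp: fam_bounded_def)
  ultimately show ?case using Suc.IH[OF t'(2), of r'] w by auto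
qed

lemma fam_smooth_const:
  assumes "\<And>us. 0 \<le> w us" "\<And>us. norm (c us) \<le> C * w us"
  shows "fam_smooth n U w (\<lambda>_. c)"
  using assms
proof (induction n arbitrary: w c C)
  case 0
  then show ?case by (auto simp: fam_bounded_def)
next
  case (Suc n)
  have "fam_deriv U w (\<lambda>_. c) (\<lambda>_ _. 0)"
    using Suc.prems by (auto simp: fam_deriv_def linear_iff intro!: exI[of _ 1])
  moreover have "fam_smooth n U (dweight w) (\<lambda>_ _. 0 :: 'b)"
    using Suc.prems by (intro Suc.IH[of _ _ 0]) (auto simp: dweight_def split: list.split)
  ultimately show ?case using Suc.prems by (auto simp: fam_bounded_def)
qed

lemma fam_smooth_add:
  "fam_smooth n U w s \<Longrightarrow> fam_smooth n U w t \<Longrightarrow> fam_smooth n U w (\<lambda>x us. s x us + t x us)"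
proof (induction n arbitrary: w s t)
  case 0
  show ?case
    unfolding fam_smooth.simps fam_bounded_def
  proof (intro conjI ballI)
    show "\<forall>us. 0 \<le> w us" using 0 by (simp add: fam_bounded_def)
    fix x assume "x \<in> U"
    obtain C where "\<And>us. norm (s x us) \<le> C * w us"
      using fam_boundedD[OF _ \<open>x \<in> U\<close>, of w s] 0(1) by auto
    moreover obtain D where "\<And>us. norm (t x us) \<le> D * w us"
      using fam_boundedD[OF _ \<open>x \<in> U\<close>, of w t] 0(2) by auto
    ultimately have "norm (s x us + t x us) \<le> (C + D) * w us" for us
      by (simp add: distrib_right norm_triangle_mono)
    then show "\<exists>C. \<forall>us. norm (s x us + t x us) \<le> C * w us" by blast
  qed
next
  case (Suc n)
  from Suc.prems obtain s' t' where s': "fam_deriv U w s s'" "fam_smooth n U (dweight w) s'"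
    and t': "fam_deriv U w t t'" "fam_smooth n U (dweight w) t'"
    by auto
  have "fam_deriv U w (\<lambda>x us. s x us + t x us) (\<lambda>x us. s' x us + t' x us)"
    unfolding fam_deriv_def
  proof (intro ballI conjI allI impI)
    fix x us assume "x \<in> U"
    then show "linear (\<lambda>v. s' x (v # us) + t' x (v # us))"
      using s'(1) t'(1) by (auto simp: fam_deriv_def intro!: linear_compose_add)
  next
    fix x and e :: real assume x: "x \<in> U" and "e > 0"
    then have "e / 2 > 0" by simp
    obtain d1 where d1: "d1 > 0" "\<And>y us. y\<in>U \<Longrightarrow> norm (y - x) < d1 \<Longrightarrow>
      norm (s y us - s x us - s' x ((y - x) # us)) \<le> e / 2 * norm (y - x) * w us"
      using s'(1) x \<open>e/2 > 0\<close> unfolding fam_deriv_def by metis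
    obtain d2 where d2: "d2 > 0" "\<And>y us. y\<in>U \<Longrightarrow> norm (y - x) < d2 \<Longrightarrow>
      norm (t y us - t x us - t' x ((y - x) # us)) \<le> e / 2 * norm (y - x) * w us"
      using t'(1) x \<open>e/2 > 0\<close> unfolding fam_deriv_def by metis
    show "\<exists>d>0. \<forall>y\<in>U. norm (y - x) < d \<longrightarrow> (\<forall>us. norm (s y us + t y us - (s x us + t x us) -
        (s' x ((y - x) # us) + t' x ((y - x) # us))) \<le> e * norm (y - x) * w us)"
    proof (intro exI[of _ "min d1 d2"] conjI ballI impI allI)
      fix y us assume y: "y \<in> U" "norm (y - x) < min d1 d2"
      have "norm (s y us + t y us - (s x us + t x us) - (s' x ((y - x) # us) + t' x ((y - x) # us)))
        = norm ((s y us - s x us - s' x ((y - x) # us)) + (t y us - t x us - t' x ((y - x) # us)))"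
        by (simp add: algebra_simps)
      also have "\<dots> \<le> e / 2 * norm (y - x) * w us + e / 2 * norm (y - x) * w us"
        using d1(2)[of y us] d2(2)[of y us] y by (intro norm_triangle_mono) auto
      finally show "norm (s y us + t y us - (s x us + t x us) -
        (s' x ((y - x) # us) + t' x ((y - x) # us))) \<le> e * norm (y - x) * w us"
        by (simp add: algebra_simps)
    qed (use d1(1) d2(1) in auto)
  qed
  moreover have "fam_bounded U w (\<lambda>x us. s x us + t x us)"
    using fam_smooth_bounded[OF Suc.IH[OF Suc.prems[THEN fam_smooth_mono]]] .
  ultimately show ?case using Suc.IH[OF s'(2) t'(2)] by (intro fam_smooth_SucI)
qed

section \<open>Product rule and linear substitution for families\<close>

lemma fam_bounded_bilinear:
  assumes B: "bounded_bilinear B" and "fam_bounded U w1 s" "fam_bounded U w2 t"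
  shows "fam_bounded U (\<lambda>us. w1 us * w2 us) (\<lambda>x us. B (s x us) (t x us))"
  unfolding fam_bounded_def
proof (intro conjI ballI allI)
  show "0 \<le> w1 us * w2 us" for us using assms by (simp add: fam_bounded_def)
  fix x assume "x \<in> U"
  obtain K where K: "\<And>u v. norm (B u v) \<le> norm u * norm v * K" "K \<ge> 0"
    using bounded_bilinear.nonneg_bounded[OF B] by blast
  obtain C where C: "C \<ge> 0" "\<And>us. norm (s x us) \<le> C * w1 us"
    using fam_boundedD[OF assms(2) \<open>x \<in> U\<close>] by blast
  obtain D where D: "D \<ge> 0" "\<And>us. norm (t x us) \<le> D * w2 us"
    using fam_boundedD[OF assms(3) \<open>x \<in> U\<close>] by blast
  have "norm (B (s x us) (t x us)) \<le> (C * D * K) * (w1 us * w2 us)" for us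
  proof -
    have "norm (s x us) * norm (t x us) * K \<le> (C * w1 us) * (D * w2 us) * K"
      using C D K(2) by (intro mult_right_mono mult_mono) (auto intro: order_trans[OF norm_ge_zero])
    then show ?thesis using K(1)[of "s x us" "t x us"] by (simp add: mult_ac)
  qed
  then show "\<exists>C. \<forall>us. norm (B (s x us) (t x us)) \<le> C * (w1 us * w2 us)" by blast
qed

lemma fam_deriv_bilinear:
  assumes B: "bounded_bilinear B"
    and s: "fam_bounded U w1 s" "fam_bounded U (dweight w1) s'" "fam_deriv U w1 s s'"
    and t: "fam_bounded U w2 t" "fam_bounded U (dweight w2) t'" "fam_deriv U w2 t t'"
  shows "fam_deriv U (\<lambda>us. w1 us * w2 us) (\<lambda>x us. B (s x us) (t x us))
    (\<lambda>x us. B (s' x us) (t x (tl us)) + B (s x (tl us)) (t' x us))"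
  unfolding fam_deriv_def
proof (intro ballI conjI allI impI)
  interpret B: bounded_bilinear B by fact
  fix x us assume "x \<in> U"
  then have 1: "linear (\<lambda>v. s' x (v # us))" "linear (\<lambda>v. t' x (v # us))"
    using s t by (auto simp: fam_deriv_def)
  show "linear (\<lambda>v. B (s' x (v # us)) (t x (tl (v # us))) + B (s x (tl (v # us))) (t' x (v # us)))"
    using linear_compose[OF 1(1) B.bounded_linear_left[THEN bounded_linear.linear], of "t x us"]
      linear_compose[OF 1(2) B.bounded_linear_right[THEN bounded_linear.linear], of "s x us"]
    by (auto simp: o_def intro: linear_compose_add)
next
  interpret B: bounded_bilinear B by fact
  fix x and e :: real assume x: "x \<in> U" and e: "e > 0"
  have w1: "0 \<le> w1 us" and w2: "0 \<le> w2 us" for us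
    using s t by (auto simp: fam_bounded_def)
  obtain K where K: "\<And>u v. norm (B u v) \<le> norm u * norm v * K" "K > 0"
    using B.pos_bounded by blast
  obtain C1 where C1: "C1 \<ge> 0" "\<And>us. norm (s x us) \<le> C1 * w1 us"
    using fam_boundedD[OF s(1) x] by blast
  obtain C2 where C2: "C2 \<ge> 0" "\<And>us. norm (s' x us) \<le> C2 * dweight w1 us"
    using fam_boundedD[OF s(2) x] by blast
  obtain C3 where C3: "C3 \<ge> 0" "\<And>us. norm (t x us) \<le> C3 * w2 us"
    using fam_boundedD[OF t(1) x] by blast
  obtain C4 where C4: "C4 \<ge> 0" "\<And>us. norm (t' x us) \<le> C4 * dweight w2 us"
    using fam_boundedD[OF t(2) x] by blast
  \<comment> \<open>\<open>K\<close> times the sum of the coefficients of the three error terms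
    estimated below, plus one for positivity.\<close>
  define M where "M = K * (C1 + C3 + C4 + 1 + C2 * (C4 + 1)) + 1"
  have "C2 * (C4 + 1) \<ge> 0" using C2(1) C4(1) by simp
  then have M: "M > 0" unfolding M_def using K C1(1) C3(1) C4(1)
    by (intro add_nonneg_pos mult_nonneg_nonneg) auto
  \<comment> \<open>The cap at 1 bounds the increment of \<open>t\<close> by
    \<open>(C4 + 1) * h\<close>. The radius \<open>d\<close> is at most \<open>e'\<close>, so the
    product of two increments is at most a multiple of \<open>e' * h\<close>.\<close>
  define e' where "e' = min 1 (e / M)"
  have e': "e' > 0" "e' \<le> 1" "e' * M \<le> e" using e M by (auto simp: e'_def min_def field_simps)
  obtain d1 where d1: "d1 > 0" "\<And>y us. y\<in>U \<Longrightarrow> norm (y - x) < d1 \<Longrightarrow>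
    norm (s y us - s x us - s' x ((y - x) # us)) \<le> e' * norm (y - x) * w1 us"
    using s(3) x e'(1) unfolding fam_deriv_def by metis
  obtain d2 where d2: "d2 > 0" "\<And>y us. y\<in>U \<Longrightarrow> norm (y - x) < d2 \<Longrightarrow>
    norm (t y us - t x us - t' x ((y - x) # us)) \<le> e' * norm (y - x) * w2 us"
    using t(3) x e'(1) unfolding fam_deriv_def by metis
  define d where "d = Min {d1, d2, e'}"
  show "\<exists>d>0. \<forall>y\<in>U. norm (y - x) < d \<longrightarrow> (\<forall>us. norm (B (s y us) (t y us) - B (s x us) (t x us) -
      (B (s' x ((y - x) # us)) (t x (tl ((y - x) # us))) + B (s x (tl ((y - x) # us))) (t' x ((y - x) # us))))
      \<le> e * norm (y - x) * (w1 us * w2 us))"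
  proof (intro exI[of _ d] conjI ballI impI allI)
    show "d > 0" using d1 d2 e' by (simp add: d_def)
    fix y us assume y: "y \<in> U" "norm (y - x) < d"
    define h where "h = norm (y - x)"
    have h: "0 \<le> h" "h \<le> e'" "h < d1" "h < d2" using y by (auto simp: h_def d_def)
    have "h \<le> 1" using h e' by simp
    define \<rho> where "\<rho> = s y us - s x us - s' x ((y - x) # us)"
    define \<sigma> where "\<sigma> = t y us - t x us - t' x ((y - x) # us)"
    have \<rho>: "norm \<rho> \<le> e' * h * w1 us" using d1(2)[OF y(1), of us] h by (simp add: \<rho>_def h_def)
    have \<sigma>: "norm \<sigma> \<le> e' * h * w2 us" using d2(2)[OF y(1), of us] h by (simp add: \<sigma>_def h_def)
    have t'b: "norm (t' x ((y - x) # us)) \<le> C4 * h * w2 us"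
      using C4(2)[of "(y-x)#us"] by (simp add: h_def mult_ac)
    have s'b: "norm (s' x ((y - x) # us)) \<le> C2 * h * w1 us"
      using C2(2)[of "(y-x)#us"] by (simp add: h_def mult_ac)
    have td: "norm (t y us - t x us) \<le> (C4 + 1) * h * w2 us"
    proof -
      have "norm (t y us - t x us) = norm (\<sigma> + t' x ((y - x) # us))" by (simp add: \<sigma>_def)
      also have "\<dots> \<le> e' * h * w2 us + C4 * h * w2 us" using \<sigma> t'b by (rule norm_triangle_mono)
      also have "\<dots> \<le> 1 * h * w2 us + C4 * h * w2 us"
        using e' h w2[of us] by (intro add_mono mult_right_mono) auto
      finally show ?thesis by (simp add: algebra_simps)
    qed
    have tb: "norm (t y us) \<le> (C3 + C4 + 1) * w2 us"
    proof -
      have "norm (t y us) = norm (t x us + (t y us - t x us))" by simp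
      also have "\<dots> \<le> C3 * w2 us + (C4 + 1) * h * w2 us" using C3(2) td by (rule norm_triangle_mono)
      also have "\<dots> \<le> C3 * w2 us + (C4 + 1) * 1 * w2 us"
        using C4(1) h \<open>h \<le> 1\<close> w2[of us] by (intro add_mono mult_right_mono mult_left_mono) auto
      finally show ?thesis by (simp add: algebra_simps)
    qed
    \<comment> \<open>The two remainders are separated from the mixed increment, which is quadratic
      in \<open>h\<close>.\<close>
    have "norm (B (s y us) (t y us) - B (s x us) (t x us) -
      (B (s' x ((y - x) # us)) (t x us) + B (s x us) (t' x ((y - x) # us))))
      = norm (B \<rho> (t y us) + B (s x us) \<sigma> + B (s' x ((y - x) # us)) (t y us - t x us))"
      by (simp add: \<rho>_def \<sigma>_def B.diff_left B.diff_right B.add_left B.add_right algebra_simps)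
    also have "\<dots> \<le> norm \<rho> * norm (t y us) * K + norm (s x us) * norm \<sigma> * K
        + norm (s' x ((y - x) # us)) * norm (t y us - t x us) * K"
      by (intro norm_triangle_mono K(1))
    also have "\<dots> \<le> (e' * h * w1 us) * ((C3 + C4 + 1) * w2 us) * K + (C1 * w1 us) * (e' * h * w2 us) * K
        + (C2 * h * w1 us) * ((C4 + 1) * e' * w2 us) * K"
    proof -
      have "(C4 + 1) * h * w2 us \<le> (C4 + 1) * e' * w2 us"
        using h C4(1) w2[of us] by (intro mult_right_mono mult_left_mono) auto
      then have td': "norm (t y us - t x us) \<le> (C4 + 1) * e' * w2 us" using td by linarith
      show ?thesis
        using \<rho> \<sigma> tb td' s'b C1(2)[of us] K(2) C3(1) C4(1) C2(1) C1(1) w1[of us] w2[of us] e' h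
        by (intro add_mono mult_right_mono mult_mono) auto
    qed
    also have "\<dots> = e' * (M - 1) * (h * (w1 us * w2 us))"
      by (simp add: M_def algebra_simps)
    also have "\<dots> \<le> e * (h * (w1 us * w2 us))"
    proof (rule mult_right_mono)
      show "e' * (M - 1) \<le> e" using e' by (simp add: algebra_simps)
    qed (use h w1 w2 in auto)
    finally show "norm (B (s y us) (t y us) - B (s x us) (t x us) -
      (B (s' x ((y - x) # us)) (t x (tl ((y - x) # us))) + B (s x (tl ((y - x) # us))) (t' x ((y - x) # us))))
      \<le> e * norm (y - x) * (w1 us * w2 us)"
      by (simp add: h_def mult_ac)
  qed
qed

text \<open>Both summands of the Leibniz rule are again images under the same \<open>B\<close> of
  families that are smooth to one order less, and both product weights equal the
  \<open>dweight\<close> of the product weight, so the induction hypothesis applies to each.\<close>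

lemma fam_smooth_bilinear:
  assumes B: "bounded_bilinear B"
  shows "fam_smooth n U w1 s \<Longrightarrow> fam_smooth n U w2 t \<Longrightarrow>
    fam_smooth n U (\<lambda>us. w1 us * w2 us) (\<lambda>x us. B (s x us) (t x us))"
proof (induction n arbitrary: w1 s w2 t)
  case 0
  then show ?case using fam_bounded_bilinear[OF B] by simp
next
  case (Suc n)
  from Suc.prems obtain s' t' where s': "fam_bounded U w1 s" "fam_deriv U w1 s s'" "fam_smooth n U (dweight w1) s'"
    and t': "fam_bounded U w2 t" "fam_deriv U w2 t t'" "fam_smooth n U (dweight w2) t'"
    by (blast elim: fam_smooth_SucE)
  have eq: "(\<lambda>us. dweight w1 us * w2 (tl us)) = dweight (\<lambda>us. w1 us * w2 us)"
    "(\<lambda>us. w1 (tl us) * dweight w2 us) = dweight (\<lambda>us. w1 us * w2 us)"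
    by (auto simp: fun_eq_iff dweight_def split: list.split)
  have "fam_smooth n U (\<lambda>us. dweight w1 us * w2 (tl us)) (\<lambda>x us. B (s' x us) (t x (tl us)))"
    by (rule Suc.IH[OF s'(3) fam_smooth_reindex[OF fam_smooth_mono[OF Suc.prems(2)]]])
  moreover have "fam_smooth n U (\<lambda>us. w1 (tl us) * dweight w2 us) (\<lambda>x us. B (s x (tl us)) (t' x us))"
    by (rule Suc.IH[OF fam_smooth_reindex[OF fam_smooth_mono[OF Suc.prems(1)]] t'(3)])
  ultimately have "fam_smooth n U (dweight (\<lambda>us. w1 us * w2 us))
      (\<lambda>x us. B (s' x us) (t x (tl us)) + B (s x (tl us)) (t' x us))"
    unfolding eq by (rule fam_smooth_add)
  moreover have "fam_deriv U (\<lambda>us. w1 us * w2 us) (\<lambda>x us. B (s x us) (t x us))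
    (\<lambda>x us. B (s' x us) (t x (tl us)) + B (s x (tl us)) (t' x us))"
    by (rule fam_deriv_bilinear[OF B s'(1) fam_smooth_bounded[OF s'(3)] s'(2) t'(1) fam_smooth_bounded[OF t'(3)] t'(2)])
  ultimately show ?case by (intro fam_smooth_SucI[OF fam_bounded_bilinear[OF B s'(1) t'(1)]])
qed

lemma fam_smooth_eq:
  "fam_smooth n U w s \<Longrightarrow> (\<And>x us. x \<in> U \<Longrightarrow> s x us = t x us) \<Longrightarrow> fam_smooth n U w t"
  using fam_smooth_cong[of U s t n w] by blast

text \<open>The product rule for the bilinear map \<open>r *\<^sub>R L v\<close>, with the constant
  1 as first factor.\<close>

lemma fam_smooth_bounded_linear:
  assumes "bounded_linear L" "fam_smooth n U w t"
  shows "fam_smooth n U w (\<lambda>x us. L (t x us))"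
proof -
  have "fam_smooth n U (\<lambda>_. 1) (\<lambda>_ _. 1 :: real)" by (rule fam_smooth_const[where C = 1]) auto
  from fam_smooth_bilinear[OF bounded_bilinear.comp[OF bounded_bilinear_scaleR bounded_linear_ident assms(1)] this assms(2)]
  show ?thesis by simp
qed

text \<open>The directions in the index have to be mapped by \<open>L\<close> as well. Each
  differentiation costs one more factor \<open>K\<close> in the comparison of weights, so the
  induction runs over all \<open>w'\<close> and \<open>C\<close>.\<close>

lemma fam_smooth_compose_linear:
  assumes L: "bounded_linear L" and A: "\<And>x. x \<in> A \<Longrightarrow> L x \<in> U"
  shows "fam_smooth n U w t \<Longrightarrow> (\<And>us. 0 \<le> w' us) \<Longrightarrow> 0 \<le> C \<Longrightarrow> (\<And>us. w (map L us) \<le> C * w' us) \<Longrightarrow>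
    fam_smooth n A w' (\<lambda>x us. t (L x) (map L us))"
proof (induction n arbitrary: w t w' C)
  case (0 w t w' C)
  have "\<exists>B. \<forall>us. norm (t (L x) (map L us)) \<le> B * w' us" if x: "x \<in> A" for x
  proof -
    obtain B where B: "B \<ge> 0" "\<And>us. norm (t (L x) us) \<le> B * w us"
      using fam_boundedD[of U w t "L x"] 0(1) A[OF x] by auto
    have "norm (t (L x) (map L us)) \<le> (B * C) * w' us" for us
      using order_trans[OF B(2) mult_left_mono[OF 0(4) B(1)]] by (simp add: mult_ac)
    then show ?thesis by blast
  qed
  then show ?case using 0 by (simp add: fam_bounded_def)
next
  case (Suc n w t w' C)
  obtain t' where t': "fam_bounded U w t" "fam_deriv U w t t'" "fam_smooth n U (dweight w) t'"
    using Suc.prems(1) by (blast elim: fam_smooth_SucE)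
  obtain K where K: "K > 0" "\<And>x. norm (L x) \<le> norm x * K"
    using bounded_linear.pos_bounded[OF L] by blast
  interpret L: bounded_linear L by fact
  have w0: "0 \<le> w us" for us using t'(1) by (simp add: fam_bounded_def)
  have CK: "C * K \<ge> 0" using Suc.prems(3) K by simp
  have dw: "dweight w (map L us) \<le> (C * K) * dweight w' us" for us
  proof (cases us)
    case (Cons v vs)
    have "norm (L v) * w (map L vs) \<le> (norm v * K) * (C * w' vs)"
      using K Suc.prems(4)[of vs] w0 by (intro mult_mono) (auto intro: mult_nonneg_nonneg less_imp_le)
    then show ?thesis by (simp add: Cons mult_ac)
  qed simp
  have IH: "fam_smooth n A (dweight w') (\<lambda>x us. t' (L x) (map L us))"
    by (rule Suc.IH[OF t'(3) _ CK dw]) (use Suc.prems(2) in \<open>auto simp: dweight_def split: list.split\<close>)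
  have fd: "fam_deriv A w' (\<lambda>x us. t (L x) (map L us)) (\<lambda>x us. t' (L x) (map L us))"
    unfolding fam_deriv_def
  proof (intro ballI conjI allI impI)
    fix x us assume x: "x \<in> A"
    have "linear (\<lambda>v. t' (L x) (v # map L us))"
      using t'(2) A[OF x] by (simp add: fam_deriv_def)
    from linear_compose[OF L.linear this] show "linear (\<lambda>v. t' (L x) (map L (v # us)))"
      by (simp add: o_def)
  next
    fix x and e :: real assume x: "x \<in> A" and e: "e > 0"
    define e' where "e' = e / (K * (C + 1))"
    have e': "e' > 0" using e K Suc.prems(3) by (simp add: e'_def)
    obtain d where d: "d > 0" "\<And>y us. y \<in> U \<Longrightarrow> norm (y - L x) < d \<Longrightarrow>
      norm (t y us - t (L x) us - t' (L x) ((y - L x) # us)) \<le> e' * norm (y - L x) * w us"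
      using t'(2) A[OF x] e' unfolding fam_deriv_def by metis
    show "\<exists>d>0. \<forall>y\<in>A. norm (y - x) < d \<longrightarrow> (\<forall>us. norm (t (L y) (map L us) - t (L x) (map L us) -
      t' (L x) (map L ((y - x) # us))) \<le> e * norm (y - x) * w' us)"
    proof (intro exI[of _ "d / K"] conjI ballI impI allI)
      fix y us assume y: "y \<in> A" "norm (y - x) < d / K"
      have Ld: "norm (L y - L x) \<le> norm (y - x) * K" using K(2)[of "y - x"] by (simp add: L.diff)
      also have "\<dots> < d" using y(2) K(1) by (simp add: field_simps)
      finally have "norm (t (L y) (map L us) - t (L x) (map L us) - t' (L x) ((L y - L x) # map L us))
          \<le> e' * norm (L y - L x) * w (map L us)"
        by (rule d(2)[OF A[OF y(1)]])
      also have "\<dots> \<le> e' * (norm (y - x) * K) * ((C + 1) * w' us)"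
        using e' Ld w0 Suc.prems(2)[of us] order_trans[OF Suc.prems(4)[of us]]
        by (intro mult_mono mult_left_mono) (auto simp: distrib_right intro!: mult_nonneg_nonneg K(1)[THEN less_imp_le])
      also have "\<dots> = e * norm (y - x) * w' us" using K(1) Suc.prems(3) by (simp add: e'_def)
      finally show "norm (t (L y) (map L us) - t (L x) (map L us) - t' (L x) (map L ((y - x) # us)))
          \<le> e * norm (y - x) * w' us" by (simp add: L.diff)
    qed (use d K in simp)
  qed
  have "fam_smooth n A w' (\<lambda>x us. t (L x) (map L us))"
    by (rule Suc.IH[OF fam_smooth_mono[OF Suc.prems(1)] Suc.prems(2,3,4)])
  then show ?case using fam_smooth_SucI[OF fam_smooth_bounded fd IH] by blast
qed

section \<open>Uniqueness of the derivative of a family\<close>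

lemma fam_deriv_has_derivative:
  assumes "open U" "fam_bounded U w t" "fam_deriv U w t t'" "fam_bounded U (dweight w) t'" "x \<in> U"
  shows "((\<lambda>y. t y us) has_derivative (\<lambda>v. t' x (v # us))) (at x)"
proof -
  have w: "0 \<le> w us" using assms(2) by (simp add: fam_bounded_def)
  obtain C where C: "C \<ge> 0" "\<And>us. norm (t' x us) \<le> C * dweight w us"
    using fam_boundedD[OF assms(4,5)] by blast
  have lin: "linear (\<lambda>v. t' x (v # us))" using assms(3,5) by (simp add: fam_deriv_def)
  have bl: "bounded_linear (\<lambda>v. t' x (v # us))"
    using lin C(2)[of "_ # us"]
    by (intro bounded_linear_intro[where K = "C * w us"]) (auto simp: linear_iff mult_ac)
  show ?thesis
    unfolding has_derivative_at_alt
  proof (intro conjI bl allI impI)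
    fix e :: real assume e: "e > 0"
    define e' where "e' = e / (w us + 1)"
    have e': "e' > 0" "e' * w us \<le> e" using e w by (auto simp: e'_def field_simps)
    obtain d where d: "d > 0" "\<And>y us. y\<in>U \<Longrightarrow> norm (y - x) < d \<Longrightarrow>
      norm (t y us - t x us - t' x ((y - x) # us)) \<le> e' * norm (y - x) * w us"
      using assms(3,5) e'(1) unfolding fam_deriv_def by metis
    obtain d2 where d2: "d2 > 0" "ball x d2 \<subseteq> U"
      using assms(1,5) open_contains_ball by blast
    show "\<exists>d>0. \<forall>y. norm (y - x) < d \<longrightarrow> norm (t y us - t x us - t' x ((y - x) # us)) \<le> e * norm (y - x)"
    proof (intro exI[of _ "min d d2"] conjI allI impI)
      fix y assume y: "norm (y - x) < min d d2"
      then have "y \<in> U" using d2(2) by (auto simp: dist_norm norm_minus_commute)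
      then have "norm (t y us - t x us - t' x ((y - x) # us)) \<le> (e' * w us) * norm (y - x)"
        using d(2)[of y us] y by (simp add: mult_ac)
      also have "\<dots> \<le> e * norm (y - x)" using e' by (intro mult_right_mono) auto
      finally show "norm (t y us - t x us - t' x ((y - x) # us)) \<le> e * norm (y - x)" .
    qed (use d d2 in auto)
  qed
qed

text \<open>\<open>fam_deriv\<close> says nothing about the derivative at the empty index, but the
  weight 0 there forces it to vanish. At all other indices uniqueness of the Frechet derivative
  decides.\<close>

lemma fam_deriv_unique:
  assumes "open U" "fam_bounded U w t" "fam_deriv U w t s1" "fam_bounded U (dweight w) s1"
    "fam_deriv U w t s2" "fam_bounded U (dweight w) s2" "x \<in> U"
  shows "s1 x us = s2 x us"
proof (cases us)
  case Nil
  then show ?thesis using fam_boundedD[OF assms(4,7)] fam_boundedD[OF assms(6,7)]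
    by (metis dweight_simps(1) mult_zero_right norm_le_zero_iff)
next
  case (Cons v vs)
  have "(\<lambda>v. s1 x (v # vs)) = (\<lambda>v. s2 x (v # vs))"
    using fam_deriv_has_derivative[OF assms(1-4,7)] fam_deriv_has_derivative[OF assms(1,2,5,6,7)]
    by (rule has_derivative_unique)
  then show ?thesis using Cons by metis
qed

text \<open>Each order provides its own derivative family. By uniqueness they agree on
  \<open>U\<close>, so a single one is smooth to every order.\<close>

lemma fam_smooth_deriv:
  assumes "open U" "\<And>n. fam_smooth n U w t"
  shows "\<exists>t'. fam_deriv U w t t' \<and> (\<forall>n. fam_smooth n U (dweight w) t')"
proof -
  have "\<exists>t'. fam_deriv U w t t' \<and> fam_smooth n U (dweight w) t'" for n
    using assms(2)[of "Suc n"] by auto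
  then obtain T where T: "\<And>n. fam_deriv U w t (T n)" "\<And>n. fam_smooth n U (dweight w) (T n)"
    by metis
  have "T n x us = T 0 x us" if "x \<in> U" for n x us
    using fam_deriv_unique[OF assms(1) fam_smooth_bounded[OF assms(2)] T(1) fam_smooth_bounded[OF T(2)]
        T(1) fam_smooth_bounded[OF T(2)] that] by blast
  then have "fam_smooth n U (dweight w) (T 0)" for n
    using T(2)[of n] fam_smooth_cong[of U "T n" "T 0"] by blast
  then show ?thesis using T(1) by blast
qed

section \<open>Smooth functions as families that ignore their index\<close>

definition fsmooth :: "'a::real_normed_vector set \<Rightarrow> ('a \<Rightarrow> 'b::real_normed_vector) \<Rightarrow> bool"
  where "fsmooth U f \<longleftrightarrow> open U \<and> (\<forall>n. fam_smooth n U (\<lambda>_. 1) (\<lambda>x _. f x))"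

lemma fsmooth_open: "fsmooth U f \<Longrightarrow> open U"
  by (simp add: fsmooth_def)

lemma dweight_funpow:
  "length vs = k \<Longrightarrow> (dweight ^^ k) (\<lambda>_. 1) vs = prod_list (map norm vs)"
proof (induction k arbitrary: vs)
  case (Suc k)
  then show ?case by (cases vs) auto
qed auto

text \<open>Derivatives of all orders come from dependent choice. \<open>fam_deriv\<close> gives
  linearity only in the newest direction; linearity in an older slot is inherited by differentiating
  the linearity identity of the previous order, using uniqueness of derivatives.\<close>

lemma fsmooth_imp_smooth_on:
  fixes f :: "'a::real_normed_vector \<Rightarrow> 'b::real_normed_vector"
  assumes "fsmooth U f"
  shows "smooth_on U f"
proof -
  have U: "open U" using assms by (rule fsmooth_open)
  define P where "P = (\<lambda>k (t :: 'a \<Rightarrow> 'a list \<Rightarrow> 'b). (k = 0 \<longrightarrow> t = (\<lambda>x _. f x)) \<and>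
    (\<forall>n. fam_smooth n U ((dweight ^^ k) (\<lambda>_. 1)) t))"
  have "\<exists>T. \<forall>k. P k (T k) \<and> fam_deriv U ((dweight ^^ k) (\<lambda>_. 1)) (T k) (T (Suc k))"
  proof (rule dependent_nat_choice)
    show "\<exists>t. P 0 t" using assms by (auto simp: P_def fsmooth_def)
    fix t k assume "P k t"
    then show "\<exists>t'. P (Suc k) t' \<and> fam_deriv U ((dweight ^^ k) (\<lambda>_. 1)) t t'"
      using fam_smooth_deriv[OF U, of "(dweight ^^ k) (\<lambda>_. 1)" t] by (auto simp: P_def)
  qed
  then obtain T where T: "\<And>k. P k (T k)"
    and D: "\<And>k. fam_deriv U ((dweight ^^ k) (\<lambda>_. 1)) (T k) (T (Suc k))" by blast
  have B: "fam_bounded U ((dweight ^^ k) (\<lambda>_. 1)) (T k)" for k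
    using T[of k] fam_smooth_bounded[of 0] unfolding P_def by blast
  have hd: "((\<lambda>y. T k y us) has_derivative (\<lambda>v. T (Suc k) x (v # us))) (at x)" if "x \<in> U" for k x us
    using fam_deriv_has_derivative[OF U B D _ that] B[of "Suc k"] by simp
  have lin: "linear (\<lambda>v. T k x (vs[i := v]))" if "x \<in> U" "length vs = k" "i < k" for k x vs i
    using that
  proof (induction k arbitrary: x vs i)
    case (Suc k)
    then obtain h us where vs: "vs = h # us" "length us = k" by (cases vs) auto
    show ?case
    proof (cases i)
      case 0
      then show ?thesis using D[of k] vs Suc.prems(1) by (simp add: fam_deriv_def)
    next
      case (Suc j)
      then have j: "j < k" using Suc.prems by simp
      have 1: "((\<lambda>y. T k y (us[j := v])) has_derivative (\<lambda>h. T (Suc k) x (h # us[j := v]))) (at x)" for v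
        using hd Suc.prems by blast
      have add: "T (Suc k) x (h # us[j := u + v]) = T (Suc k) x (h # us[j := u]) + T (Suc k) x (h # us[j := v])" for u v
      proof -
        have "((\<lambda>y. T k y (us[j := u + v])) has_derivative
          (\<lambda>h. T (Suc k) x (h # us[j := u]) + T (Suc k) x (h # us[j := v]))) (at x)"
        proof (rule has_derivative_transform_within_open[OF has_derivative_add[OF 1 1] U Suc.prems(1)])
          fix y assume "y \<in> U"
          then show "T k y (us[j := u]) + T k y (us[j := v]) = T k y (us[j := u + v])"
            using Suc.IH[OF _ vs(2) j, of y] by (simp add: linear_iff)
        qed
        then show ?thesis using has_derivative_unique[OF _ 1[of "u + v"]] by metis
      qed
      have scale: "T (Suc k) x (h # us[j := c *\<^sub>R v]) = c *\<^sub>R T (Suc k) x (h # us[j := v])" for c v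
      proof -
        have "((\<lambda>y. T k y (us[j := c *\<^sub>R v])) has_derivative (\<lambda>h. c *\<^sub>R T (Suc k) x (h # us[j := v]))) (at x)"
        proof (rule has_derivative_transform_within_open[OF has_derivative_scaleR_right[OF 1] U Suc.prems(1)])
          fix y assume "y \<in> U"
          then show "c *\<^sub>R T k y (us[j := v]) = T k y (us[j := c *\<^sub>R v])"
            using Suc.IH[OF _ vs(2) j, of y] by (simp add: linear_iff)
        qed
        then show ?thesis using has_derivative_unique[OF _ 1[of "c *\<^sub>R v"]] by metis
      qed
      show ?thesis using add scale vs Suc by (simp add: linear_iff)
    qed
  qed simp
  \<comment> \<open>The length of the list tells which order of derivative is meant.\<close>
  define E where "E = (\<lambda>x vs. T (length vs) x vs)"
  show ?thesis
    unfolding smooth_on_def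
  proof (intro conjI U exI[of _ E] ballI allI impI)
    show "E x [] = f x" for x using T[of 0] by (simp add: E_def P_def)
    show "bounded_multilinear k (E x)" if x: "x \<in> U" for k x
      unfolding bounded_multilinear_def
    proof (intro conjI allI impI)
      show "linear (\<lambda>v. E x (vs[i := v]))" if "length vs = k \<and> i < k" for vs i
        using lin[of x vs k i] that x by (simp add: E_def)
      obtain C where "\<And>us. norm (T k x us) \<le> C * (dweight ^^ k) (\<lambda>_. 1) us"
        using fam_boundedD[OF B x] by blast
      then show "\<exists>C. \<forall>vs. length vs = k \<longrightarrow> norm (E x vs) \<le> C * prod_list (map norm vs)"
        by (metis E_def dweight_funpow)
    qed
    fix k x and e :: real assume "x \<in> U" "e > 0"
    then obtain d where d: "d > 0" "\<And>y us. y\<in>U \<Longrightarrow> norm (y - x) < d \<Longrightarrow>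
      norm (T k y us - T k x us - T (Suc k) x ((y - x) # us)) \<le> e * norm (y - x) * (dweight ^^ k) (\<lambda>_. 1) us"
      using D[of k] unfolding fam_deriv_def by metis
    show "\<exists>d>0. \<forall>y\<in>U. norm (y - x) < d \<longrightarrow> (\<forall>vs. length vs = k \<longrightarrow>
      norm (E y vs - E x vs - E x ((y - x) # vs)) \<le> e * norm (y - x) * prod_list (map norm vs))"
    proof (intro exI[of _ d] conjI d(1) ballI impI allI)
      fix y and vs :: "'a list" assume "y \<in> U" "norm (y - x) < d" "length vs = k"
      then show "norm (E y vs - E x vs - E x ((y - x) # vs)) \<le> e * norm (y - x) * prod_list (map norm vs)"
        using d(2)[of y vs] dweight_funpow[of vs k] by (simp add: E_def)
    qed
  qed
qed

text \<open>The derivative of an index-free family may be taken independent of the tail of the list, so that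
  the ordinary Frechet derivative rules can be used.\<close>

lemma fam_smooth_fun_SucI:
  assumes "open U" "\<And>x. x \<in> U \<Longrightarrow> (f has_derivative f' x) (at x)"
    "fam_smooth n U (dweight (\<lambda>_. 1)) (\<lambda>x us. case us of [] \<Rightarrow> 0 | v # _ \<Rightarrow> f' x v)"
  shows "fam_smooth (Suc n) U (\<lambda>_. 1) (\<lambda>x _. f x)"
proof (rule fam_smooth_SucI[OF _ _ assms(3)])
  show "fam_bounded U (\<lambda>_. 1) (\<lambda>x _. f x)"
    by (auto simp: fam_bounded_def)
  show "fam_deriv U (\<lambda>_. 1) (\<lambda>x _. f x) (\<lambda>x us. case us of [] \<Rightarrow> 0 | v # _ \<Rightarrow> f' x v)"
    unfolding fam_deriv_def
  proof (intro ballI conjI allI impI)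
    show "linear (\<lambda>v. case v # us of [] \<Rightarrow> 0 | v # _ \<Rightarrow> f' x v)" if "x \<in> U" for x us
      using assms(2)[OF that] by (simp add: has_derivative_bounded_linear bounded_linear.linear)
    show "\<exists>d>0. \<forall>y\<in>U. norm (y - x) < d \<longrightarrow> (\<forall>us. norm (f y - f x -
        (case (y - x) # us of [] \<Rightarrow> 0 | v # _ \<Rightarrow> f' x v)) \<le> e * norm (y - x) * 1)"
      if "x \<in> U" "e > 0" for x and e :: real
      using assms(2)[OF that(1)] that(2) unfolding has_derivative_at_alt list.case mult_1_right by blast
  qed
qed

lemma fam_smooth_fun_SucE:
  assumes "open U" "fam_smooth (Suc n) U (\<lambda>_. 1) (\<lambda>x _. f x)"
  obtains f' where "\<And>x. x \<in> U \<Longrightarrow> (f has_derivative f' x) (at x)"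
    "fam_smooth n U (dweight (\<lambda>_. 1)) (\<lambda>x us. case us of [] \<Rightarrow> 0 | v # _ \<Rightarrow> f' x v)"
proof -
  obtain t' where t': "fam_bounded U (\<lambda>_. 1) (\<lambda>x _. f x)" "fam_deriv U (\<lambda>_. 1) (\<lambda>x _. f x) t'"
    "fam_smooth n U (dweight (\<lambda>_. 1)) t'"
    using assms(2) by (blast elim: fam_smooth_SucE)
  \<comment> \<open>Discarding the tail of the index leaves the weight unchanged, since
    \<open>dweight (\<lambda>_. 1)\<close> sees only the head.\<close>
  define r where "r = (\<lambda>us :: 'a list. case us of [] \<Rightarrow> [] | v # _ \<Rightarrow> [v])"
  have "fam_smooth n U (\<lambda>us. dweight (\<lambda>_. 1) (r us)) (\<lambda>x us. t' x (r us))"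
    by (rule fam_smooth_reindex[OF t'(3)])
  also have "(\<lambda>us. dweight (\<lambda>_. 1) (r us)) = dweight (\<lambda>_. 1)"
    by (auto simp: fun_eq_iff r_def split: list.split)
  finally have 1: "fam_smooth n U (dweight (\<lambda>_. 1)) (\<lambda>x us. t' x (r us))" .
  have 0: "t' x [] = 0" if "x \<in> U" for x
    using fam_boundedD[OF fam_smooth_bounded[OF t'(3)] that]
    by (metis dweight_simps(1) mult_zero_right norm_le_zero_iff)
  have "t' x (r us) = (case us of [] \<Rightarrow> 0 | v # _ \<Rightarrow> t' x [v])" if "x \<in> U" for x us
    using 0[OF that] by (auto simp: r_def split: list.split)
  then have "fam_smooth n U (dweight (\<lambda>_. 1)) (\<lambda>x us. case us of [] \<Rightarrow> 0 | v # _ \<Rightarrow> t' x [v])"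
    using 1 fam_smooth_cong[of U "\<lambda>x us. t' x (r us)" "\<lambda>x us. case us of [] \<Rightarrow> 0 | v # _ \<Rightarrow> t' x [v]"]
    by blast
  moreover have "(f has_derivative (\<lambda>v. t' x [v])) (at x)" if "x \<in> U" for x
    using fam_deriv_has_derivative[OF assms(1) t'(1,2) fam_smooth_bounded[OF t'(3)] that] .
  ultimately show ?thesis using that[of "\<lambda>x v. t' x [v]"] by blast
qed

lemma fsmooth_has_derivative:
  assumes "fsmooth U f" "x \<in> U"
  shows "\<exists>f'. (f has_derivative f') (at x)"
  using assms fam_smooth_fun_SucE[of U 0 f] unfolding fsmooth_def by metis

lemma fsmooth_continuous_on: "fsmooth U f \<Longrightarrow> continuous_on U f"
  by (meson continuous_at_imp_continuous_on has_derivative_continuous fsmooth_has_derivative)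

section \<open>Closure properties of smooth functions\<close>

lemma fsmooth_compose_linear:
  assumes "fsmooth U f" "bounded_linear L" "open A" "\<And>x. x \<in> A \<Longrightarrow> L x \<in> U"
  shows "fsmooth A (\<lambda>x. f (L x))"
proof -
  have "fam_smooth n A (\<lambda>_. 1) (\<lambda>x _. f (L x))" for n
    using fam_smooth_compose_linear[OF assms(2,4), where n = n and w = "\<lambda>_. 1" and t = "\<lambda>x _. f x"
        and w' = "\<lambda>_. 1" and C = 1] assms(1)
    by (simp add: fsmooth_def)
  then show ?thesis using assms(3) by (simp add: fsmooth_def)
qed


lemma fsmooth_subset: "fsmooth U f \<Longrightarrow> open V \<Longrightarrow> V \<subseteq> U \<Longrightarrow> fsmooth V f"
  using fsmooth_compose_linear[OF _ bounded_linear_ident, of U f V] by blast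

lemma fsmooth_const: "open U \<Longrightarrow> fsmooth U (\<lambda>_. c)"
  unfolding fsmooth_def by (auto intro!: fam_smooth_const[of _ _ "norm c"])

lemma fsmooth_linear_comp: "bounded_linear L \<Longrightarrow> fsmooth U f \<Longrightarrow> fsmooth U (\<lambda>x. L (f x))"
  unfolding fsmooth_def using fam_smooth_bounded_linear[of L _ _ "\<lambda>_. 1" "\<lambda>x _. f x"] by blast

lemma fsmooth_add: "fsmooth U f \<Longrightarrow> fsmooth U g \<Longrightarrow> fsmooth U (\<lambda>x. f x + g x)"
  unfolding fsmooth_def using fam_smooth_add[of _ _ "\<lambda>_. 1" "\<lambda>x _. f x" "\<lambda>x _. g x"] by blast

lemma fsmooth_bilinear: "bounded_bilinear B \<Longrightarrow> fsmooth U f \<Longrightarrow> fsmooth U g \<Longrightarrow> fsmooth U (\<lambda>x. B (f x) (g x))"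
  unfolding fsmooth_def
  using fam_smooth_bilinear[of B _ _ "\<lambda>_. 1" "\<lambda>x _. f x" "\<lambda>_. 1" "\<lambda>x _. g x"] by simp

lemma fsmooth_uminus: "fsmooth U f \<Longrightarrow> fsmooth U (\<lambda>x. - f x)"
  by (rule fsmooth_linear_comp[OF bounded_linear_minus[OF bounded_linear_ident]])

lemma fsmooth_diff: "fsmooth U f \<Longrightarrow> fsmooth U g \<Longrightarrow> fsmooth U (\<lambda>x. f x - g x)"
  using fsmooth_add[of U f "\<lambda>x. - g x"] fsmooth_uminus[of U g] by simp

lemma fsmooth_mult:
  fixes f g :: "'a::real_normed_vector \<Rightarrow> 'b::real_normed_algebra"
  shows "fsmooth U f \<Longrightarrow> fsmooth U g \<Longrightarrow> fsmooth U (\<lambda>x. f x * g x)"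
  by (rule fsmooth_bilinear[OF bounded_bilinear_mult])

lemma fsmooth_Pair: "fsmooth U f \<Longrightarrow> fsmooth U g \<Longrightarrow> fsmooth U (\<lambda>x. (f x, g x))"
  using fsmooth_add[OF fsmooth_linear_comp[OF bounded_linear_Pair[OF bounded_linear_ident bounded_linear_zero]]
      fsmooth_linear_comp[OF bounded_linear_Pair[OF bounded_linear_zero bounded_linear_ident]], of U f g] by simp

lemma fsmooth_bounded_linear:
  assumes "open U" "bounded_linear L"
  shows "fsmooth U L"
proof -
  obtain K where K: "\<And>v. norm (L v) \<le> norm v * K"
    using bounded_linear.bounded[OF assms(2)] by blast
  have bound: "norm (case us of [] \<Rightarrow> 0 | v # _ \<Rightarrow> L v) \<le> K * dweight (\<lambda>_. 1) us" for us
    using K by (auto simp: mult_ac split: list.split)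
  have "fam_smooth n U (\<lambda>_. 1) (\<lambda>x _. L x)" for n
  proof (cases n)
    case (Suc m)
    have "fam_smooth m U (dweight (\<lambda>_. 1)) (\<lambda>_ us. case us of [] \<Rightarrow> 0 | v # _ \<Rightarrow> L v)"
      by (rule fam_smooth_const[where C = K]) (use bound in \<open>auto simp: dweight_def split: list.split\<close>)
    then show ?thesis
      using Suc fam_smooth_fun_SucI[OF assms(1), of L "\<lambda>_. L"] bounded_linear_imp_has_derivative[OF assms(2)]
      by auto
  qed (auto simp: fam_bounded_def)
  then show ?thesis using assms by (simp add: fsmooth_def)
qed

lemma fsmooth_ident: "open U \<Longrightarrow> fsmooth U (\<lambda>x. x)"
  by (rule fsmooth_bounded_linear) auto

lemma fsmooth_fst: "fsmooth U f \<Longrightarrow> fsmooth U (\<lambda>x. fst (f x))"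
  by (rule fsmooth_linear_comp[OF bounded_linear_fst])

lemma fsmooth_snd: "fsmooth U f \<Longrightarrow> fsmooth U (\<lambda>x. snd (f x))"
  by (rule fsmooth_linear_comp[OF bounded_linear_snd])

text \<open>Inversion in a normed algebra satisfies the resolvent identity, so its derivative
  \<open>v \<mapsto> - \<iota> y * v * \<iota> y\<close> is a polynomial in \<open>\<iota>\<close> itself.\<close>

lemma resolvent_has_derivative:
  fixes \<iota> :: "'b::real_normed_algebra \<Rightarrow> 'b"
  assumes "open V" and res: "\<And>x y. x \<in> V \<Longrightarrow> y \<in> V \<Longrightarrow> \<iota> y - \<iota> x = - (\<iota> x * (y - x) * \<iota> y)"
    and x: "x \<in> V"
  shows "(\<iota> has_derivative (\<lambda>v. - (\<iota> x * v * \<iota> x))) (at x)"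
  unfolding has_derivative_at_alt
proof (intro conjI allI impI)
  show "bounded_linear (\<lambda>v. - (\<iota> x * v * \<iota> x))"
    by (intro bounded_linear_minus bounded_linear_mult_const bounded_linear_const_mult bounded_linear_ident)
  fix e :: real assume e: "e > 0"
  define N where "N = norm (\<iota> x) + 1"
  have N: "N > 0" "norm (\<iota> x) \<le> N" using norm_ge_zero[of "\<iota> x"] unfolding N_def by linarith+
  obtain d0 where d0: "d0 > 0" "ball x d0 \<subseteq> V" using assms open_contains_ball by blast
  \<comment> \<open>The bound \<open>1 / (2 * N)\<close> yields the a priori estimate
    \<open>norm (\<iota> y) \<le> 2 * N\<close> by absorption; the bound
    \<open>e / (2 * N ^ 3)\<close> then makes the quadratic remainder
    \<open>2 * N ^ 3 * h * h\<close> at most \<open>e * h\<close>.\<close>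
  define d where "d = Min {d0, 1 / (2 * N), e / (2 * N ^ 3)}"
  show "\<exists>d>0. \<forall>y. norm (y - x) < d \<longrightarrow> norm (\<iota> y - \<iota> x - - (\<iota> x * (y - x) * \<iota> x)) \<le> e * norm (y - x)"
  proof (intro exI[of _ d] conjI allI impI)
    show "d > 0" using d0 e N by (simp add: d_def)
    fix y assume y: "norm (y - x) < d"
    define h where "h = norm (y - x)"
    have h: "0 \<le> h" "h < d0" "h \<le> 1 / (2 * N)" "h \<le> e / (2 * N ^ 3)" using y by (auto simp: h_def d_def)
    have yV: "y \<in> V" using d0(2) h(2) by (auto simp: h_def dist_norm norm_minus_commute)
    have "norm (\<iota> x * (y - x) * \<iota> y) \<le> N * h * norm (\<iota> y)"
      unfolding h_def using N
      by (intro order_trans[OF norm_mult_ineq] mult_right_mono) (auto intro: order_trans[OF norm_mult_ineq] mult_right_mono)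
    moreover have "N * h \<le> 1 / 2" using h(3) N(1) by (simp add: field_simps)
    ultimately have 1: "norm (\<iota> x * (y - x) * \<iota> y) \<le> norm (\<iota> y) / 2"
      using mult_right_mono[of "N * h" "1/2" "norm (\<iota> y)"] by simp
    have "\<iota> y = \<iota> x + - (\<iota> x * (y - x) * \<iota> y)" using res[OF x yV] by (metis add_diff_cancel_left' diff_add_cancel add.commute)
    then have "norm (\<iota> y) \<le> norm (\<iota> x) + norm (\<iota> x * (y - x) * \<iota> y)"
      using norm_triangle_ineq[of "\<iota> x" "- (\<iota> x * (y - x) * \<iota> y)"] by simp
    then have 2: "norm (\<iota> y) \<le> 2 * N" using 1 N by simp
    have "\<iota> y - \<iota> x - - (\<iota> x * (y - x) * \<iota> x) = - (\<iota> x * (y - x) * (\<iota> y - \<iota> x))"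
      using res[OF x yV] by (simp add: algebra_simps)
    also have "\<dots> = \<iota> x * (y - x) * (\<iota> x * (y - x) * \<iota> y)"
      by (simp add: res[OF x yV])
    finally have "norm (\<iota> y - \<iota> x - - (\<iota> x * (y - x) * \<iota> x)) \<le> (N * h) * ((N * h) * (2 * N))"
      using 2 N h(1)
      by (auto simp: h_def intro!: order_trans[OF norm_mult_ineq] mult_mono)
    also have "\<dots> = (2 * N ^ 3 * h) * h" by (simp add: power3_eq_cube mult_ac)
    also have "\<dots> \<le> e * h" using h N by (intro mult_right_mono) (auto simp: field_simps)
    finally show "norm (\<iota> y - \<iota> x - - (\<iota> x * (y - x) * \<iota> x)) \<le> e * norm (y - x)" by (simp add: h_def)
  qed
qed

text \<open>Smoothness of \<open>\<iota> \<circ> f\<close> to order \<open>n\<close> feeds the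
  product that is its derivative and so gives order \<open>n + 1\<close>. An abstract
  \<open>\<iota>\<close> serves both inversion in a field and \<open>binv\<close> on
  operators.\<close>

lemma fsmooth_resolvent:
  fixes \<iota> :: "'b::real_normed_algebra \<Rightarrow> 'b"
  assumes "open V" and res: "\<And>x y. x \<in> V \<Longrightarrow> y \<in> V \<Longrightarrow> \<iota> y - \<iota> x = - (\<iota> x * (y - x) * \<iota> y)"
    and f: "fsmooth U f" "\<And>x. x \<in> U \<Longrightarrow> f x \<in> V"
  shows "fsmooth U (\<lambda>x. \<iota> (f x))"
proof -
  have U: "open U" using f by (simp add: fsmooth_def)
  have "fam_smooth n U (\<lambda>_. 1) (\<lambda>x _. \<iota> (f x))" for n
  proof (induction n)
    case (Suc n)
    obtain f' where f': "\<And>x. x \<in> U \<Longrightarrow> (f has_derivative f' x) (at x)"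
      "fam_smooth n U (dweight (\<lambda>_. 1)) (\<lambda>x us. case us of [] \<Rightarrow> 0 | v # _ \<Rightarrow> f' x v)"
      using fam_smooth_fun_SucE[OF U] f(1) unfolding fsmooth_def by metis
    have "((\<lambda>x. \<iota> (f x)) has_derivative (\<lambda>v. - (\<iota> (f x) * f' x v * \<iota> (f x)))) (at x)" if "x \<in> U" for x
      using has_derivative_compose[OF f'(1)[OF that] resolvent_has_derivative[OF assms(1) res f(2)[OF that]]] .
    moreover have "fam_smooth n U (\<lambda>us. 1 * dweight (\<lambda>_. 1) us * 1)
      (\<lambda>x us. \<iota> (f x) * (case us of [] \<Rightarrow> 0 | v # _ \<Rightarrow> f' x v) * \<iota> (f x))"
      by (rule fam_smooth_bilinear[OF bounded_bilinear_mult fam_smooth_bilinear[OF bounded_bilinear_mult Suc f'(2)] Suc])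
    then have "fam_smooth n U (dweight (\<lambda>_. 1))
      (\<lambda>x us. - (\<iota> (f x) * (case us of [] \<Rightarrow> 0 | v # _ \<Rightarrow> f' x v) * \<iota> (f x)))"
      using fam_smooth_bounded_linear[OF bounded_linear_minus[OF bounded_linear_ident]] by simp
    then have "fam_smooth n U (dweight (\<lambda>_. 1))
      (\<lambda>x us. case us of [] \<Rightarrow> 0 | v # _ \<Rightarrow> - (\<iota> (f x) * f' x v * \<iota> (f x)))"
      by (rule fam_smooth_eq) (auto split: list.split)
    ultimately show ?case by (rule fam_smooth_fun_SucI[OF U])
  qed (auto simp: fam_bounded_def)
  then show ?thesis using U by (simp add: fsmooth_def)
qed

lemma fsmooth_inverse:
  fixes f :: "'a::real_normed_vector \<Rightarrow> 'b::real_normed_field"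
  assumes "fsmooth U f" "\<And>x. x \<in> U \<Longrightarrow> f x \<noteq> 0"
  shows "fsmooth U (\<lambda>x. inverse (f x))"
  by (rule fsmooth_resolvent[of "- {0}", OF _ _ assms(1)]) (use assms(2) in \<open>auto simp: field_simps\<close>)

lemma fsmooth_divide:
  fixes f :: "'a::real_normed_vector \<Rightarrow> 'b::real_normed_field"
  assumes "fsmooth U f" "fsmooth U g" "\<And>x. x \<in> U \<Longrightarrow> g x \<noteq> 0"
  shows "fsmooth U (\<lambda>x. f x / g x)"
  unfolding divide_inverse by (intro fsmooth_mult fsmooth_inverse assms)

text \<open>Differentiating \<open>g j (f x)\<close> produces \<open>g (Suc j) (f x)\<close>, hence
  the induction over all \<open>j\<close> at once. The bilinear \<open>B\<close> is multiplication
  for scalar holomorphic functions and \<open>scaleC\<close> for vector-valued ones.\<close>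

lemma fsmooth_vector_tower:
  fixes g :: "nat \<Rightarrow> complex \<Rightarrow> 'b::real_normed_vector"
  assumes B: "bounded_bilinear (B :: complex \<Rightarrow> 'b \<Rightarrow> 'b)"
    and g: "\<And>j z. z \<in> V \<Longrightarrow> (g j has_derivative (\<lambda>h. B h (g (Suc j) z))) (at z)"
    and f: "fsmooth U f" "\<And>x. x \<in> U \<Longrightarrow> f x \<in> V"
  shows "fsmooth U (\<lambda>x. g 0 (f x))"
proof -
  have U: "open U" using f by (simp add: fsmooth_def)
  have "fam_smooth n U (\<lambda>_. 1) (\<lambda>x _. g j (f x))" for n j
  proof (induction n arbitrary: j)
    case (Suc n)
    obtain f' where f': "\<And>x. x \<in> U \<Longrightarrow> (f has_derivative f' x) (at x)"
      "fam_smooth n U (dweight (\<lambda>_. 1)) (\<lambda>x us. case us of [] \<Rightarrow> 0 | v # _ \<Rightarrow> f' x v)"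
      using fam_smooth_fun_SucE[OF U] f(1) unfolding fsmooth_def by metis
    have "((\<lambda>x. g j (f x)) has_derivative (\<lambda>v. B (f' x v) (g (Suc j) (f x)))) (at x)" if "x \<in> U" for x
      using has_derivative_compose[OF f'(1)[OF that] g[OF f(2)[OF that]]] .
    moreover have "fam_smooth n U (\<lambda>us. dweight (\<lambda>_. 1) us * 1)
      (\<lambda>x us. B (case us of [] \<Rightarrow> 0 | v # _ \<Rightarrow> f' x v) (g (Suc j) (f x)))"
      by (rule fam_smooth_bilinear[OF B f'(2) Suc])
    then have "fam_smooth n U (dweight (\<lambda>_. 1))
      (\<lambda>x us. B (case us of [] \<Rightarrow> 0 | v # _ \<Rightarrow> f' x v) (g (Suc j) (f x)))"
      by simp
    then have "fam_smooth n U (dweight (\<lambda>_. 1))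
      (\<lambda>x us. case us of [] \<Rightarrow> 0 | v # _ \<Rightarrow> B (f' x v) (g (Suc j) (f x)))"
      by (rule fam_smooth_eq) (auto split: list.split simp: bounded_bilinear.zero_left[OF B])
    ultimately show ?case by (rule fam_smooth_fun_SucI[OF U])
  qed (auto simp: fam_bounded_def)
  then show ?thesis using U by (simp add: fsmooth_def)
qed

lemma fsmooth_holomorphic:
  assumes "g holomorphic_on V" "open V" "fsmooth U f" "\<And>x. x \<in> U \<Longrightarrow> f x \<in> V"
  shows "fsmooth U (\<lambda>x. g (f x))"
proof -
  have "((deriv ^^ j) g has_derivative (\<lambda>h. h * (deriv ^^ Suc j) g z)) (at z)" if "z \<in> V" for j z
  proof -
    have "((deriv ^^ j) g has_field_derivative deriv ((deriv ^^ j) g) z) (at z)"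
      using holomorphic_derivI[OF holomorphic_higher_deriv[OF assms(1,2)] assms(2) that] .
    then show ?thesis
      unfolding has_field_derivative_def by (rule has_derivative_eq_rhs) (simp add: fun_eq_iff mult.commute)
  qed
  then show ?thesis
    using fsmooth_vector_tower[OF bounded_bilinear_mult, of V "\<lambda>j. (deriv ^^ j) g" U f] assms(3,4) by simp
qed

lemma smooth_map_onI:
  assumes "fsmooth U g" "M \<subseteq> U" "\<And>x. x \<in> M \<Longrightarrow> g x = f x"
  shows "smooth_map_on M f"
  unfolding smooth_map_on_def using assms fsmooth_imp_smooth_on by blast


lemma fsmooth_cnj: "fsmooth U f \<Longrightarrow> fsmooth U (\<lambda>x. cnj (f x))"
  by (rule fsmooth_linear_comp[OF bounded_linear_cnj])

lemma fsmooth_preimage: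
  assumes "fsmooth U f" "open W"
  shows "open {x \<in> U. f x \<in> W}"
proof -
  have "{x \<in> U. f x \<in> W} = U \<inter> f -` W" by auto
  then show ?thesis
    using continuous_open_preimage[OF fsmooth_continuous_on[OF assms(1)] fsmooth_open[OF assms(1)] assms(2)] by simp
qed

section \<open>Operators on a Hilbert space\<close>

lemma cinner_add_right: "cinner x (y + z) = cinner x y + cinner x z"
  by (subst (1 2 3) cinner_commute) (simp add: cinner_add_left)

lemma cinner_scaleC_right: "cinner x (c *\<^sub>C y) = cnj c * cinner x y"
  by (subst (1 2) cinner_commute) (simp add: cinner_scaleC_left)

lemma cinner_zero_left [simp]: "cinner 0 (x :: 'a::complex_hilbert_space) = 0"
  using cinner_add_left[of 0 0 x] by simp

lemma cinner_zero_right [simp]: "cinner (x :: 'a::complex_hilbert_space) 0 = 0"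
  using cinner_add_right[of x 0 0] by simp

lemma cinner_minus_left: "cinner (- x) y = - cinner x (y :: 'a::complex_hilbert_space)"
  using cinner_add_left[of x "- x" y] by (simp add: eq_neg_iff_add_eq_0 add.commute)

lemma cinner_minus_right: "cinner x (- y) = - cinner x (y :: 'a::complex_hilbert_space)"
  by (subst (1 2) cinner_commute) (simp add: cinner_minus_left)

lemma cinner_diff_left: "cinner (x - y) z = cinner x z - cinner y (z :: 'a::complex_hilbert_space)"
  using cinner_add_left[of x "- y" z] by (simp add: cinner_minus_left)

lemma cinner_diff_right: "cinner z (x - y) = cinner z x - cinner z (y :: 'a::complex_hilbert_space)"
  using cinner_add_right[of z x "- y"] by (simp add: cinner_minus_right)

lemmas cinner_simps = cinner_add_left cinner_add_right cinner_diff_left cinner_diff_right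
  cinner_scaleC_left cinner_scaleC_right cinner_minus_left cinner_minus_right

lemma cinner_eq_zero_iff: "cinner x x = 0 \<longleftrightarrow> (x :: 'a::complex_hilbert_space) = 0"
  by (simp add: cinner_self)

lemma norm_eq_Re_cinner: "(norm (x :: 'a::complex_hilbert_space))\<^sup>2 = Re (cinner x x)"
  by (simp add: cinner_self del: of_real_power)

lemma norm_scaleC: "norm (c *\<^sub>C (x :: 'a::complex_hilbert_space)) = cmod c * norm x"
proof -
  have "complex_of_real ((norm (c *\<^sub>C x))\<^sup>2) = complex_of_real ((cmod c * norm x)\<^sup>2)"
    unfolding cinner_self[symmetric] cinner_scaleC_left cinner_scaleC_right
    by (simp add: cinner_self power_mult_distrib mult_ac complex_norm_square[of c, symmetric])
  then have "(norm (c *\<^sub>C x))\<^sup>2 = (cmod c * norm x)\<^sup>2"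
    using of_real_eq_iff by blast
  then show ?thesis by (simp add: power2_eq_iff_nonneg)
qed

text \<open>Pythagoras for the component of \<open>x\<close> orthogonal to \<open>y\<close>. It
  yields the Cauchy-Schwarz inequality and the strict decrease of norm that contradicts minimality
  in the Riesz representation.\<close>

lemma norm_diff_projection:
  fixes x y :: "'a::complex_hilbert_space"
  assumes "y \<noteq> 0"
  shows "(norm (x - (cinner x y / complex_of_real ((norm y)\<^sup>2)) *\<^sub>C y))\<^sup>2
    = (norm x)\<^sup>2 - (cmod (cinner x y) / norm y)\<^sup>2"
proof -
  define c where "c = cinner x y / complex_of_real ((norm y)\<^sup>2)"
  have c: "c * cinner y y = cinner x y" using assms by (simp add: c_def cinner_self)
  have "cinner (x - c *\<^sub>C y) (x - c *\<^sub>C y)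
      = cinner x x - cnj c * cinner x y - c * cinner y x + cnj c * (c * cinner y y)"
    by (simp add: cinner_simps algebra_simps)
  also have "\<dots> = cinner x x - c * cnj (cinner x y)" by (simp add: c cinner_commute[of y x])
  also have "\<dots> = complex_of_real ((norm x)\<^sup>2 - (cmod (cinner x y) / norm y)\<^sup>2)"
    using assms complex_norm_square[of "cinner x y"]
    by (simp add: c_def cinner_self power_divide)
  finally show ?thesis
    unfolding cinner_self c_def using of_real_eq_iff by blast
qed

lemma cinner_norm_le: "cmod (cinner x y) \<le> norm x * norm (y :: 'a::complex_hilbert_space)"
proof (cases "y = 0")
  case False
  have "0 \<le> (norm x)\<^sup>2 - (cmod (cinner x y) / norm y)\<^sup>2"
    unfolding norm_diff_projection[OF False, symmetric] by simp
  then have "cmod (cinner x y) / norm y \<le> norm x" by (simp add: power2_le_iff_abs_le)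
  then show ?thesis using False by (simp add: field_simps)
qed simp

lemma scaleR_eq_scaleC: "r *\<^sub>R x = complex_of_real r *\<^sub>C (x :: 'a::complex_hilbert_space)"
  by (simp add: scaleC_of_real)

lemma bounded_bilinear_cinner: "bounded_bilinear (cinner :: 'a \<Rightarrow> 'a::complex_hilbert_space \<Rightarrow> complex)"
  by standard (auto simp: cinner_simps scaleR_eq_scaleC scaleR_conv_of_real
      intro!: exI[of _ 1] cinner_norm_le)

lemma bounded_bilinear_scaleC: "bounded_bilinear (scaleC :: complex \<Rightarrow> 'a \<Rightarrow> 'a::complex_hilbert_space)"
  by standard (auto simp: scaleC_add_left scaleC_add_right scaleR_eq_scaleC scaleC_scaleC mult_ac norm_scaleC
      scaleR_conv_of_real intro!: exI[of _ 1])

lemma cinner_ext_right: "(\<And>z. cinner z x = cinner z y) \<Longrightarrow> x = (y :: 'a::complex_hilbert_space)"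
  using cinner_eq_zero_iff[of "x - y"] by (simp add: cinner_diff_right)

lemma parallelogram:
  "(norm (x + y))\<^sup>2 + (norm (x - y))\<^sup>2 = 2 * (norm x)\<^sup>2 + 2 * (norm (y :: 'a::complex_hilbert_space))\<^sup>2"
  by (simp add: norm_eq_Re_cinner cinner_simps)

text \<open>The representing vector is a multiple of the vector of minimal norm on \<open>{x. \<phi> x = 1}\<close>.\<close>

lemma riesz_representation:
  fixes \<phi> :: "'a::complex_hilbert_space \<Rightarrow> complex"
  assumes bl: "bounded_linear \<phi>" and sc: "\<And>c x. \<phi> (c *\<^sub>C x) = c * \<phi> x"
  shows "\<exists>y. \<forall>x. \<phi> x = cinner x y"
proof (cases "\<forall>x. \<phi> x = 0")
  case True
  then show ?thesis by (intro exI[of _ 0]) simp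
next
  case False
  interpret bounded_linear \<phi> by fact
  obtain x0 where "\<phi> x0 \<noteq> 0" using False by blast
  then have ne: "\<phi> ((1 / \<phi> x0) *\<^sub>C x0) = 1" by (simp add: sc)
  define S where "S = {x. \<phi> x = 1}"
  define m where "m = (INF x\<in>S. norm x)"
  have S: "S \<noteq> {}" using ne by (auto simp: S_def)
  have bdd: "bdd_below (norm ` S)" by (rule bdd_belowI2[of _ 0]) simp
  have m: "m \<le> norm x" if "x \<in> S" for x unfolding m_def by (rule cINF_lower[OF bdd that])
  have m0: "0 \<le> m" unfolding m_def by (rule cINF_greatest[OF S]) simp
  have "\<exists>x\<in>S. norm x < m + 1 / real (Suc n)" for n
    using cInf_lessD[of "norm ` S" "m + 1 / real (Suc n)"] S by (force simp: m_def)
  then obtain X where X: "\<And>n. X n \<in> S" "\<And>n. norm (X n) < m + 1 / real (Suc n)" by metis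
  \<comment> \<open>The midpoint of \<open>x\<close> and \<open>y\<close> lies in \<open>S\<close>
    and so has norm at least \<open>m\<close>; the parallelogram law then bounds the
    difference.\<close>
  have close: "(norm (x - y))\<^sup>2 \<le> 4 * ((m + e)\<^sup>2 - m\<^sup>2)"
    if "x \<in> S" "y \<in> S" "norm x \<le> m + e" "norm y \<le> m + e" for x y e
  proof -
    have "(1/2) *\<^sub>R (x + y) \<in> S" using that by (simp add: S_def scaleR add scaleR_conv_of_real)
    from m[OF this] have "2 * m \<le> norm (x + y)" by simp
    then have "(2 * m)\<^sup>2 \<le> (norm (x + y))\<^sup>2" using m0 by (intro power_mono) auto
    moreover have "(norm x)\<^sup>2 \<le> (m + e)\<^sup>2" "(norm y)\<^sup>2 \<le> (m + e)\<^sup>2"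
      using that by (auto intro!: power_mono)
    ultimately show ?thesis using parallelogram[of x y] by (simp add: power_mult_distrib)
  qed
  have "Cauchy X"
  proof (rule metric_CauchyI)
    fix e :: real assume e: "e > 0"
    have "(\<lambda>n. 4 * ((m + 1 / real (Suc n))\<^sup>2 - m\<^sup>2)) \<longlonglongrightarrow> 4 * ((m + 0)\<^sup>2 - m\<^sup>2)"
      by (intro tendsto_intros LIMSEQ_inverse_real_of_nat[unfolded inverse_eq_divide])
    then have "(\<lambda>n. 4 * ((m + 1 / real (Suc n))\<^sup>2 - m\<^sup>2)) \<longlonglongrightarrow> 0" by simp
    moreover have "e\<^sup>2 > 0" using e by simp
    ultimately have "\<forall>\<^sub>F n in sequentially. 4 * ((m + 1 / real (Suc n))\<^sup>2 - m\<^sup>2) < e\<^sup>2"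
      by (rule order_tendstoD)
    then obtain N where N: "4 * ((m + 1 / real (Suc N))\<^sup>2 - m\<^sup>2) < e\<^sup>2"
      by (auto simp: eventually_sequentially)
    have le: "norm (X n) \<le> m + 1 / real (Suc N)" if "n \<ge> N" for n
    proof -
      have "1 / real (Suc n) \<le> 1 / real (Suc N)" using that by (intro divide_left_mono) auto
      then show ?thesis using X(2)[of n] by linarith
    qed
    show "\<exists>M. \<forall>i\<ge>M. \<forall>n\<ge>M. dist (X i) (X n) < e"
    proof (intro exI allI impI)
      fix i n assume "N \<le> i" "N \<le> n"
      then have "(norm (X i - X n))\<^sup>2 < e\<^sup>2" using close[OF X(1) X(1) le le] N by fastforce
      then show "dist (X i) (X n) < e" using e by (simp add: dist_norm power_less_imp_less_base)
    qed
  qed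
  then obtain y where y: "X \<longlonglongrightarrow> y" using Cauchy_convergent_iff convergent_def by blast
  have "(\<lambda>n. \<phi> (X n)) \<longlonglongrightarrow> \<phi> y" using y by (rule tendsto)
  moreover have "(\<lambda>n. \<phi> (X n)) = (\<lambda>_. 1)" using X(1) by (simp add: S_def)
  ultimately have "(\<lambda>_ :: nat. 1) \<longlonglongrightarrow> \<phi> y" by simp
  then have \<phi>y: "\<phi> y = 1" using LIMSEQ_unique tendsto_const by blast
  have "norm y \<le> m"
  proof (rule LIMSEQ_le[OF tendsto_norm[OF y]])
    show "(\<lambda>n. m + 1 / real (Suc n)) \<longlonglongrightarrow> m"
      using tendsto_add[OF tendsto_const[of m] LIMSEQ_inverse_real_of_nat[unfolded inverse_eq_divide]] by simp
    show "\<exists>N. \<forall>n\<ge>N. norm (X n) \<le> m + 1 / real (Suc n)" using X(2) less_imp_le by blast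
  qed
  have y0: "y \<noteq> 0" using \<phi>y zero by auto
  \<comment> \<open>Otherwise subtracting from \<open>y\<close> its component along \<open>v\<close>
    would stay in \<open>S\<close> and have smaller norm.\<close>
  have orth: "cinner v y = 0" if v: "\<phi> v = 0" for v
  proof (rule ccontr)
    assume *: "cinner v y \<noteq> 0"
    then have v0: "v \<noteq> 0" by auto
    define c where "c = cinner y v / complex_of_real ((norm v)\<^sup>2)"
    have "\<phi> (y - c *\<^sub>C v) = 1" by (simp add: diff sc v \<phi>y)
    then have "norm y \<le> norm (y - c *\<^sub>C v)" using m \<open>norm y \<le> m\<close> by (fastforce simp: S_def)
    then have 1: "(norm y)\<^sup>2 \<le> (norm (y - c *\<^sub>C v))\<^sup>2" by (simp add: power_mono)
    have "(norm (y - c *\<^sub>C v))\<^sup>2 = (norm y)\<^sup>2 - (cmod (cinner y v) / norm v)\<^sup>2"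
      unfolding c_def by (rule norm_diff_projection[OF v0])
    moreover have "(cmod (cinner y v) / norm v)\<^sup>2 > 0"
      using * v0 cinner_commute[of y v] by simp
    ultimately show False using 1 by simp
  qed
  have "\<phi> x = cinner x ((1 / complex_of_real ((norm y)\<^sup>2)) *\<^sub>C y)" for x
  proof -
    \<comment> \<open>Subtracting \<open>\<phi> x\<close> times \<open>y\<close> moves
      \<open>x\<close> into the kernel of \<open>\<phi>\<close>.\<close>
    have "cinner (x - \<phi> x *\<^sub>C y) y = 0" by (rule orth) (simp add: diff sc \<phi>y)
    then have "cinner x y = \<phi> x * complex_of_real ((norm y)\<^sup>2)"
      by (simp add: cinner_simps cinner_self)
    then show ?thesis using y0 by (simp add: cinner_simps)
  qed
  then show ?thesis by blast
qed

section \<open>The algebra of bounded complex-linear operators\<close>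

lemma bop_eqI: "(\<And>x. bop_apply S x = bop_apply T x) \<Longrightarrow> S = T"
  by transfer (rule blinfun_eqI)

lemma bop_apply_scaleC_right: "bop_apply T (c *\<^sub>C x) = c *\<^sub>C bop_apply T x"
  by transfer simp

lemma bounded_linear_bop_apply: "bounded_linear (bop_apply T)"
  by transfer (rule blinfun.bounded_linear_right)

lemma bop_apply_diff_right: "bop_apply T (x - y) = bop_apply T x - bop_apply T y"
  by transfer (rule blinfun.diff_right)

lemma bop_apply_minus_right: "bop_apply T (- x) = - bop_apply T x"
  by transfer (rule blinfun.minus_right)

lemma bop_apply_zero_right [simp]: "bop_apply T 0 = 0"
  by transfer (rule blinfun.zero_right)

lemma bop_apply_left [simp]:
  "bop_apply 0 x = 0"
  "bop_apply (S + T) x = bop_apply S x + bop_apply T x"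
  "bop_apply (S - T) x = bop_apply S x - bop_apply T x"
  "bop_apply (- T) x = - bop_apply T x"
  "bop_apply (r *\<^sub>R T) x = r *\<^sub>R bop_apply T x"
  by (transfer, simp add: blinfun.add_left blinfun.diff_left blinfun.minus_left blinfun.scaleR_left)+

lemma norm_bop_apply_le: "norm (bop_apply T x) \<le> norm T * norm x"
  by transfer (rule norm_blinfun)

lemma norm_bop_le: "0 \<le> b \<Longrightarrow> (\<And>x. norm (bop_apply T x) \<le> b * norm x) \<Longrightarrow> norm T \<le> b"
  by transfer (rule norm_blinfun_bound)

lemma bop_exists:
  fixes f :: "'a::complex_hilbert_space \<Rightarrow> 'a"
  assumes "\<And>x y. f (x + y) = f x + f y" "\<And>c x. f (c *\<^sub>C x) = c *\<^sub>C f x" "\<And>x. norm (f x) \<le> norm x * K"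
  shows "\<exists>T. bop_apply T = f"
proof -
  have bl: "bounded_linear f"
    by (rule bounded_linear_intro[of f K]) (use assms in \<open>auto simp: scaleR_eq_scaleC\<close>)
  have "bop_apply (Abs_bop (Blinfun f)) = f"
    using assms(2) by (subst bop_apply.rep_eq, subst Abs_bop_inverse)
      (auto simp: bounded_linear_Blinfun_apply[OF bl])
  then show ?thesis by blast
qed

text \<open>There is no unit of norm one on the zero space, so only a subclass of the algebra classes is available.\<close>

instantiation bop :: (complex_hilbert_space) "{real_normed_algebra, monoid_mult}"
begin

lift_definition times_bop :: "'a bop \<Rightarrow> 'a bop \<Rightarrow> 'a bop" is blinfun_compose
  by simp

lift_definition one_bop :: "'a bop" is id_blinfun
  by simp

instance
proof
  fix a b c :: "'a bop" and r :: real
  show "a * b * c = a * (b * c)" by transfer (rule blinfun_eqI, simp)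
  show "(a + b) * c = a * c + b * c" by transfer (rule bounded_bilinear.add_left[OF bounded_bilinear_blinfun_compose])
  show "a * (b + c) = a * b + a * c" by transfer (rule bounded_bilinear.add_right[OF bounded_bilinear_blinfun_compose])
  show "r *\<^sub>R a * b = r *\<^sub>R (a * b)" by transfer (rule bounded_bilinear.scaleR_left[OF bounded_bilinear_blinfun_compose])
  show "a * r *\<^sub>R b = r *\<^sub>R (a * b)" by transfer (rule bounded_bilinear.scaleR_right[OF bounded_bilinear_blinfun_compose])
  show "norm (a * b) \<le> norm a * norm b" by transfer (rule norm_blinfun_compose)
  show "1 * a = a" by transfer (rule blinfun_eqI, simp)
  show "a * 1 = a" by transfer (rule blinfun_eqI, simp)
qed

end

lemma bop_apply_mult [simp]: "bop_apply (S * T) x = bop_apply S (bop_apply T x)"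
  by transfer simp

lemma bop_apply_one [simp]: "bop_apply 1 x = x"
  by transfer simp

section \<open>Adjoints and orthogonal projections\<close>

definition adj :: "'a::complex_hilbert_space bop \<Rightarrow> 'a bop"
  where "adj T = (SOME S. \<forall>x y. cinner (bop_apply T x) y = cinner x (bop_apply S y))"

lemma adj_exists:
  "\<exists>S. \<forall>x y. cinner (bop_apply T x) y = cinner x (bop_apply S y)"
proof -
  have "\<exists>z. \<forall>x. cinner (bop_apply T x) y = cinner x z" for y
  proof (rule riesz_representation)
    show "bounded_linear (\<lambda>x. cinner (bop_apply T x) y)"
      by (rule bounded_linear_compose[OF bounded_bilinear.bounded_linear_left[OF bounded_bilinear_cinner]
            bounded_linear_bop_apply])
  qed (simp add: bop_apply_scaleC_right cinner_simps)
  then obtain f where f: "\<And>x y. cinner (bop_apply T x) y = cinner x (f y)" by metis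
  have "\<exists>S. bop_apply S = f"
  proof (rule bop_exists)
    show "f (x + y) = f x + f y" for x y by (rule cinner_ext_right) (simp add: f[symmetric] cinner_simps)
    show "f (c *\<^sub>C x) = c *\<^sub>C f x" for c x by (rule cinner_ext_right) (simp add: f[symmetric] cinner_simps)
    show "norm (f y) \<le> norm y * norm T" for y
    proof -
      have "(norm (f y))\<^sup>2 = cmod (cinner (f y) (f y))" by (simp add: cinner_self norm_power)
      also have "\<dots> = cmod (cinner (bop_apply T (f y)) y)" by (simp add: f)
      also have "\<dots> \<le> (norm T * norm (f y)) * norm y"
        by (rule order_trans[OF cinner_norm_le]) (intro mult_right_mono norm_bop_apply_le, simp)
      finally have "norm (f y) * norm (f y) \<le> norm (f y) * (norm y * norm T)"
        by (simp add: power2_eq_square mult_ac)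
      then show ?thesis by (cases "f y = 0") auto
    qed
  qed
  then show ?thesis using f by metis
qed

lemma cinner_adj: "cinner (bop_apply T x) y = cinner x (bop_apply (adj T) y)"
  using someI_ex[OF adj_exists[of T]] unfolding adj_def by blast

lemma cinner_adj': "cinner x (bop_apply T y) = cinner (bop_apply (adj T) x) y"
  by (subst (1 2) cinner_commute) (simp add: cinner_adj)

lemma adj_unique:
  assumes "\<And>x y. cinner (bop_apply T x) y = cinner x (bop_apply S y)"
  shows "adj T = S"
proof (rule bop_eqI)
  fix y
  show "bop_apply (adj T) y = bop_apply S y"
    by (rule cinner_ext_right) (simp add: assms[symmetric] cinner_adj)
qed

lemma adj_simps [simp]:
  "adj (adj T) = T" "adj (S + T) = adj S + adj T" "adj (S - T) = adj S - adj T"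
  "adj (S * T) = adj T * adj S" "adj 1 = 1" "adj 0 = 0" "adj (r *\<^sub>R T) = r *\<^sub>R adj T"
  by (rule adj_unique, simp add: cinner_adj' cinner_simps scaleR_eq_scaleC,
      (rule adj_unique, simp add: cinner_adj cinner_simps scaleR_eq_scaleC)+)

lemma norm_adj_le: "norm (adj T) \<le> norm T"
proof (rule norm_bop_le)
  fix x
  let ?y = "bop_apply (adj T) x"
  have "(norm ?y)\<^sup>2 = cmod (cinner ?y ?y)" by (simp add: cinner_self norm_power)
  also have "\<dots> = cmod (cinner (bop_apply T ?y) x)" by (simp add: cinner_adj)
  also have "\<dots> \<le> (norm T * norm ?y) * norm x"
    by (rule order_trans[OF cinner_norm_le]) (intro mult_right_mono norm_bop_apply_le, simp)
  finally have "norm ?y * norm ?y \<le> norm ?y * (norm T * norm x)"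
    by (simp add: power2_eq_square mult_ac)
  then show "norm ?y \<le> norm T * norm x" by (cases "?y = 0") auto
qed simp

text \<open>Over the complex numbers the adjoint is conjugate linear. The real linearity asserted
  here matches the real notion of smoothness.\<close>

lemma bounded_linear_adj: "bounded_linear adj"
  by (rule bounded_linear_intro[of _ 1]) (auto simp: norm_adj_le)

lemma Grassmannian_iff: "P \<in> Grassmannian \<longleftrightarrow> P * P = P \<and> adj P = P"
proof -
  have "(\<forall>x. bop_apply P (bop_apply P x) = bop_apply P x) \<longleftrightarrow> P * P = P"
    by (auto intro!: bop_eqI simp flip: bop_apply_mult)
  moreover have "(\<forall>x y. cinner (bop_apply P x) y = cinner x (bop_apply P y)) \<longleftrightarrow> adj P = P"
    using adj_unique[of P P] cinner_adj[of P] by auto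
  ultimately show ?thesis by (simp add: Grassmannian_def)
qed

section \<open>Invertible operators\<close>

definition binvertible :: "'a::complex_hilbert_space bop \<Rightarrow> bool"
  where "binvertible X \<longleftrightarrow> (\<exists>Y. X * Y = 1 \<and> Y * X = 1)"

definition binv :: "'a::complex_hilbert_space bop \<Rightarrow> 'a bop"
  where "binv X = (SOME Y. X * Y = 1 \<and> Y * X = 1)"

lemma binv: "binvertible X \<Longrightarrow> X * binv X = 1" "binvertible X \<Longrightarrow> binv X * X = 1"
  using someI_ex[of "\<lambda>Y. X * Y = 1 \<and> Y * X = 1"] unfolding binvertible_def binv_def by auto

lemma binv_assoc:
  assumes "binvertible X"
  shows "X * (binv X * Y) = Y" "binv X * (X * Y) = Y"
  using binv[OF assms] by (simp_all flip: mult.assoc)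

lemma binvI: "X * Y = 1 \<Longrightarrow> Y * X = 1 \<Longrightarrow> binvertible X" "X * Y = 1 \<Longrightarrow> Y * X = 1 \<Longrightarrow> binv X = Y"
proof -
  show b: "binvertible X" if "X * Y = 1" "Y * X = 1" using that by (auto simp: binvertible_def)
  show "binv X = Y" if "X * Y = 1" "Y * X = 1"
    using binv_assoc(2)[OF b[OF that], of Y] that by simp
qed

lemma binv_resolvent:
  assumes "binvertible x" "binvertible y"
  shows "binv y - binv x = - (binv x * (y - x) * binv y)"
proof -
  have "binv x * (y - x) * binv y = binv x * (y * binv y) - (binv x * x) * binv y"
    by (simp add: algebra_simps)
  then show ?thesis by (simp add: binv assms)
qed

lemma norm_power_bop_le: "norm ((E :: 'a::complex_hilbert_space bop) ^ Suc n) \<le> norm E ^ Suc n"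
proof (induction n)
  case (Suc n)
  have "norm (E ^ Suc (Suc n)) \<le> norm E * norm (E ^ Suc n)" by (simp add: norm_mult_ineq)
  also have "\<dots> \<le> norm E * norm E ^ Suc n" by (intro mult_left_mono Suc) simp
  finally show ?case by simp
qed simp

lemma binvertible_neumann:
  fixes E :: "'a::complex_hilbert_space bop"
  assumes "norm E < 1"
  shows "binvertible (1 - E)"
proof -
  \<comment> \<open>The comparison with the geometric series starts at the first power, where
    \<open>norm_power_bop_le\<close> applies; the summand \<open>1\<close> is added back
    afterwards.\<close>
  have "summable (\<lambda>n. norm E ^ Suc n)" using assms by (intro summable_Suc_iff[THEN iffD2] summable_geometric) simp
  then have "summable (\<lambda>n. E ^ Suc n)"
    by (rule summable_comparison_test'[of _ 0]) (rule norm_power_bop_le)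
  then have s: "summable (\<lambda>n. E ^ n)" by (simp only: summable_Suc_iff)
  define Y where "Y = (\<Sum>n. E ^ n)"
  have *: "Y = 1 + (\<Sum>n. E ^ Suc n)" unfolding Y_def using suminf_split_initial_segment[OF s, of 1] by simp
  have l: "E * Y = (\<Sum>n. E ^ Suc n)" unfolding Y_def
    using bounded_linear.suminf[OF bounded_linear_mult_right s, of E] by simp
  have r: "Y * E = (\<Sum>n. E ^ Suc n)" unfolding Y_def
    using bounded_linear.suminf[OF bounded_linear_mult_left s, of E] by (simp add: power_commutes)
  have "(1 - E) * Y = 1" "Y * (1 - E) = 1"
    using * l r by (simp_all add: left_diff_distrib right_diff_distrib)
  then show ?thesis by (rule binvI(1))
qed

lemma binvertible_mult: "binvertible X \<Longrightarrow> binvertible Y \<Longrightarrow> binvertible (X * Y)"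
  by (rule binvI(1)[of _ "binv Y * binv X"]) (simp_all add: mult.assoc binv_assoc binv)

text \<open>\<open>Y = X * (1 - binv X * (X - Y))\<close>, and the second factor is covered by the
  Neumann series for \<open>Y\<close> close to \<open>X\<close>.\<close>

lemma open_binvertible: "open {X :: 'a::complex_hilbert_space bop. binvertible X}"
  unfolding open_dist
proof (intro ballI)
  fix X :: "'a bop" assume "X \<in> {X. binvertible X}"
  then have X: "binvertible X" by simp
  define d where "d = 1 / (norm (binv X) + 1)"
  have pos: "norm (binv X) + 1 > 0" using norm_ge_zero[of "binv X"] by linarith
  have "binvertible Y" if "dist Y X < d" for Y
  proof -
    have "norm (binv X * (X - Y)) \<le> norm (binv X) * norm (X - Y)" by (rule norm_mult_ineq)
    also have "\<dots> \<le> (norm (binv X) + 1) * norm (X - Y)" by (intro mult_right_mono) auto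
    also have "\<dots> < (norm (binv X) + 1) * d"
      using that pos by (intro mult_strict_left_mono) (auto simp: dist_norm norm_minus_commute)
    also have "\<dots> = 1" using pos by (simp add: d_def)
    finally have "binvertible (X * (1 - binv X * (X - Y)))"
      by (intro binvertible_mult X binvertible_neumann)
    moreover have "X * (1 - binv X * (X - Y)) = Y"
      by (simp add: right_diff_distrib binv_assoc[OF X])
    ultimately show ?thesis by simp
  qed
  then show "\<exists>e>0. \<forall>y. dist y X < e \<longrightarrow> y \<in> {X. binvertible X}"
    using pos by (intro exI[of _ d]) (auto simp: d_def)
qed

lemma fsmooth_binv:
  assumes "fsmooth U f" "\<And>x. x \<in> U \<Longrightarrow> binvertible (f x)"
  shows "fsmooth U (\<lambda>x. binv (f x))"
  by (rule fsmooth_resolvent[OF open_binvertible _ assms(1)]) (use assms(2) in \<open>auto simp: binv_resolvent\<close>)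

lemma fsmooth_adj: "fsmooth U f \<Longrightarrow> fsmooth U (\<lambda>x. adj (f x))"
  by (rule fsmooth_linear_comp[OF bounded_linear_adj])

section \<open>Charts of the Grassmannian\<close>

lemmas fsmooth_bop_intros = fsmooth_mult fsmooth_add fsmooth_diff fsmooth_adj fsmooth_const

lemma mult_rewrite: "a * b = c \<Longrightarrow> a * (b * x) = c * (x :: 'b::semigroup_mult)"
  by (simp flip: mult.assoc)

lemma binv_commute:
  assumes "binvertible X" "X * Z = Z * X"
  shows "binv X * Z = Z * binv X"
proof -
  have "binv X * Z = binv X * (Z * X) * binv X" by (simp add: mult.assoc binv assms(1))
  also have "\<dots> = Z * binv X" by (simp add: assms(2)[symmetric] mult.assoc[symmetric] binv assms(1))
  finally show ?thesis .
qed

lemma adj_binv: "binvertible X \<Longrightarrow> adj (binv X) = binv (adj X)"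
  using binvI(2)[of "adj X" "adj (binv X)"] binv[of X] by (simp flip: adj_simps(4))

text \<open>A projection near \<open>P\<close> has as range the graph of an operator \<open>K\<close> from \<open>range P\<close> to \<open>range (1 - P)\<close>. In block
  form with respect to \<open>P\<close> it is \<open>(a, a K\<^sup>*; K a, K a K\<^sup>*)\<close> with \<open>a = (1 + K\<^sup>* K)\<^sup>-\<^sup>1\<close>. The chart at \<open>P\<close> records \<open>K\<close> in the
  lower left block and subtracts these values from the other three.\<close>

locale projection =
  fixes P :: "'h::complex_hilbert_space bop"
  assumes PP: "P * P = P" and adjP: "adj P = P"
begin

definition Q where "Q = 1 - P"

lemma Q_simps: "P * Q = 0" "Q * P = 0" "Q * Q = Q" "P + Q = 1" "adj Q = Q"
  by (simp_all add: Q_def algebra_simps PP adjP)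

lemmas PQ = PP Q_simps(1-3)
lemmas PQ' = PQ PQ[THEN mult_rewrite]

text \<open>Adding \<open>Q\<close> extends the block \<open>P * X * P\<close> by the identity, so
  that its invertibility on the range of \<open>P\<close> becomes invertibility of an operator on
  the whole space.\<close>

definition diag where "diag X = P * X * P + Q"

definition slope where "slope X = Q * X * P * binv (diag X)"

text \<open>For self-adjoint \<open>X\<close> this is the Schur complement of the block
  \<open>P * X * P\<close>. For a projection it turns out to be idempotent, and the condition in
  \<open>chart_dom\<close> that \<open>1 - corner X\<close> be invertible then forces it to be
  0.\<close>

definition corner where "corner X = Q * X * Q - slope X * (P * X * P) * adj (slope X)"

definition chart where "chart X = slope X + (P * X * P - P * binv (1 + adj (slope X) * slope X) * P)
  + (X * Q - (P + slope X) * (P * X * P) * adj (slope X))"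

definition lower where "lower Y = Q * Y * P"

definition upper where "upper Y = P * Y * P + P * binv (1 + adj (lower Y) * lower Y) * P"

text \<open>The first summand rebuilds the block matrix from \<open>K = lower Y\<close> and
  \<open>a = upper Y\<close>; the second puts back the offsets of the right column.\<close>

definition unchart where "unchart Y = (P + lower Y) * upper Y * (P + adj (lower Y)) + Y * Q"

definition chart_dom where "chart_dom = {X. binvertible (diag X) \<and>
  binvertible (1 + adj (slope X) * slope X) \<and> binvertible (1 - corner X)}"

text \<open>The counterpart of \<open>chart_dom\<close>: \<open>lower Y\<close>,
  \<open>upper Y + Q\<close> and \<open>Q * Y * Q\<close> are the slope, the \<open>diag\<close> and
  the corner of \<open>unchart Y\<close>.\<close>

definition chart_ran where "chart_ran = {Y. binvertible (1 + adj (lower Y) * lower Y) \<and>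
  binvertible (upper Y + Q) \<and> binvertible (1 - Q * Y * Q)}"

lemma slope_eqI:
  assumes "binvertible (diag X)" "L * Q = 0" "Q * X * P = L * (P * X * P)"
  shows "slope X = L"
proof -
  have "slope X = L * (P * X * P) * binv (diag X)" by (simp add: slope_def assms(3))
  also have "L * (P * X * P) = L * diag X" by (simp add: diag_def distrib_left assms(2))
  finally show ?thesis by (simp add: mult.assoc binv assms(1))
qed

lemma slope_blocks:
  assumes "binvertible (diag X)"
  shows "P * slope X = 0" "Q * slope X = slope X" "slope X * P = slope X" "slope X * Q = 0"
    "slope X * (P * X * P) = Q * X * P"
proof -
  \<comment> \<open>\<open>diag X\<close> is block diagonal, so it commutes with \<open>P\<close>
    and \<open>Q\<close>, and so does its inverse.\<close>
  have c: "binv (diag X) * P = P * binv (diag X)" "binv (diag X) * Q = Q * binv (diag X)"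
    by (rule binv_commute[OF assms]; simp add: diag_def distrib_left distrib_right mult.assoc PQ')+
  show "P * slope X = 0" "Q * slope X = slope X" by (simp_all add: slope_def mult.assoc PQ')
  show 1: "slope X * P = slope X" and 2: "slope X * Q = 0" by (simp_all add: slope_def mult.assoc PQ' c)
  have "slope X * (P * X * P) = slope X * (diag X - Q)" by (simp add: diag_def)
  also have "\<dots> = slope X * diag X" by (simp add: right_diff_distrib 2)
  also have "\<dots> = Q * X * P" by (simp add: slope_def mult.assoc binv assms)
  finally show "slope X * (P * X * P) = Q * X * P" .
qed

lemma adj_slope_blocks:
  assumes "binvertible (diag X)"
  shows "adj (slope X) * P = 0" "adj (slope X) * Q = adj (slope X)" "P * adj (slope X) = adj (slope X)"
    "Q * adj (slope X) = 0"
  using slope_blocks(1-4)[OF assms, THEN arg_cong[of _ _ adj]] by (simp_all add: adjP Q_simps)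

lemma lower_blocks:
  "P * lower Y = 0" "Q * lower Y = lower Y" "lower Y * P = lower Y" "lower Y * Q = 0"
  "adj (lower Y) * P = 0" "adj (lower Y) * Q = adj (lower Y)" "P * adj (lower Y) = adj (lower Y)"
  "Q * adj (lower Y) = 0"
  by (simp_all add: lower_def mult.assoc PQ' adjP Q_simps)

lemma upper_blocks:
  "P * upper Y = upper Y" "upper Y * P = upper Y" "Q * upper Y = 0" "upper Y * Q = 0"
  by (simp_all add: upper_def mult.assoc PQ' distrib_left distrib_right)

lemma unchart_blocks:
  "P * unchart Y * P = upper Y" "Q * unchart Y * P = lower Y * upper Y"
  "Q * unchart Y * Q = lower Y * upper Y * adj (lower Y) + Q * Y * Q"
  "unchart Y * Q = (P + lower Y) * upper Y * adj (lower Y) + Y * Q"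
  by (simp_all add: unchart_def mult.assoc distrib_left distrib_right PQ' lower_blocks upper_blocks
      lower_blocks[THEN mult_rewrite] upper_blocks[THEN mult_rewrite])

lemma diag_unchart: "diag (unchart Y) = upper Y + Q"
  by (simp add: diag_def unchart_blocks)

lemma slope_unchart: "Y \<in> chart_ran \<Longrightarrow> slope (unchart Y) = lower Y"
  by (rule slope_eqI) (auto simp: diag_unchart chart_ran_def unchart_blocks lower_blocks)

lemma corner_unchart: "Y \<in> chart_ran \<Longrightarrow> corner (unchart Y) = Q * Y * Q"
  by (simp add: corner_def slope_unchart unchart_blocks)

lemma unchart_mem: "Y \<in> chart_ran \<Longrightarrow> unchart Y \<in> chart_dom"
  by (auto simp: chart_dom_def diag_unchart slope_unchart corner_unchart) (auto simp: chart_ran_def)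

lemma split_PQ: "Y * P + Y * Q = Y"
  by (metis Q_simps(4) distrib_left mult_1_right)

lemma split_PQ': "Q * Z + P * Z = Z"
  by (metis Q_simps(4) add.commute distrib_right mult_1_left)

lemma chart_unchart:
  assumes "Y \<in> chart_ran"
  shows "chart (unchart Y) = Y"
proof -
  have "chart (unchart Y) = lower Y + P * Y * P + Y * Q"
    unfolding chart_def slope_unchart[OF assms] unchart_blocks by (simp add: upper_def)
  also have "\<dots> = Y"
    using split_PQ[of Y] split_PQ'[of "Y * P"] by (simp add: lower_def mult.assoc)
  finally show ?thesis .
qed

lemma chart_blocks:
  assumes "binvertible (diag X)"
  shows "lower (chart X) = slope X"
    "P * chart X * P = P * X * P - P * binv (1 + adj (slope X) * slope X) * P"
    "chart X * Q = X * Q - (P + slope X) * (P * X * P) * adj (slope X)"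
    "Q * chart X * Q = corner X"
proof -
  note b = slope_blocks[OF assms] adj_slope_blocks[OF assms]
  note b' = b(1-4) b(1-4)[THEN mult_rewrite] b(6-) b(6-)[THEN mult_rewrite]
  show "lower (chart X) = slope X"
    "P * chart X * P = P * X * P - P * binv (1 + adj (slope X) * slope X) * P"
    "chart X * Q = X * Q - (P + slope X) * (P * X * P) * adj (slope X)"
    "Q * chart X * Q = corner X"
    by (simp_all add: lower_def chart_def corner_def mult.assoc distrib_left distrib_right left_diff_distrib
        right_diff_distrib PQ' b')
qed

lemma upper_chart: "binvertible (diag X) \<Longrightarrow> upper (chart X) = P * X * P"
  by (simp add: upper_def chart_blocks)

lemma chart_mem: "X \<in> chart_dom \<Longrightarrow> chart X \<in> chart_ran"
  by (auto simp: chart_dom_def chart_ran_def chart_blocks upper_chart diag_def)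

lemma unchart_chart:
  assumes "X \<in> chart_dom"
  shows "unchart (chart X) = X"
proof -
  have d: "binvertible (diag X)" using assms by (simp add: chart_dom_def)
  note b = slope_blocks[OF d] adj_slope_blocks[OF d]
  have "unchart (chart X) = (P + slope X) * (P * X * P) * P + X * Q"
    unfolding unchart_def chart_blocks[OF d] upper_chart[OF d] by (simp add: distrib_left)
  also have "\<dots> = P * X * P + slope X * (P * X * P) * P + X * Q"
    by (simp add: distrib_right mult.assoc PQ')
  also have "\<dots> = X" unfolding b(5) using split_PQ[of X] split_PQ'[of "X * P"]
    by (simp add: mult.assoc PQ' add_ac)
  finally show ?thesis .
qed

section \<open>Smoothness and open domains of the graph chart\<close>

lemma fsmooth_diag: "fsmooth A u \<Longrightarrow> fsmooth A (\<lambda>x. diag (u x))"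
  unfolding diag_def by (intro fsmooth_bop_intros) (auto simp: fsmooth_open)

lemma fsmooth_slope:
  assumes "fsmooth A u" "\<And>x. x \<in> A \<Longrightarrow> binvertible (diag (u x))"
  shows "fsmooth A (\<lambda>x. slope (u x))"
  unfolding slope_def using assms fsmooth_open[OF assms(1)]
  by (intro fsmooth_bop_intros fsmooth_binv fsmooth_diag) auto

lemma fsmooth_corner:
  assumes "fsmooth A u" "\<And>x. x \<in> A \<Longrightarrow> binvertible (diag (u x))"
  shows "fsmooth A (\<lambda>x. corner (u x))"
  unfolding corner_def by (intro fsmooth_bop_intros fsmooth_slope assms fsmooth_open[OF assms(1)]) auto

lemma fsmooth_chart:
  assumes "fsmooth A u" "\<And>x. x \<in> A \<Longrightarrow> u x \<in> chart_dom"
  shows "fsmooth A (\<lambda>x. chart (u x))"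
proof -
  have "fsmooth A (\<lambda>x. slope (u x))" using assms by (intro fsmooth_slope) (auto simp: chart_dom_def)
  then show ?thesis
    unfolding chart_def using assms fsmooth_open[OF assms(1)]
    by (intro fsmooth_bop_intros fsmooth_binv) (auto simp: chart_dom_def)
qed

lemma fsmooth_lower: "fsmooth A u \<Longrightarrow> fsmooth A (\<lambda>x. lower (u x))"
  unfolding lower_def by (intro fsmooth_bop_intros) (auto simp: fsmooth_open)

lemma fsmooth_upper:
  assumes "fsmooth A u" "\<And>x. x \<in> A \<Longrightarrow> binvertible (1 + adj (lower (u x)) * lower (u x))"
  shows "fsmooth A (\<lambda>x. upper (u x))"
  unfolding upper_def using fsmooth_open[OF assms(1)]
  by (intro fsmooth_bop_intros fsmooth_binv fsmooth_lower assms) auto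

lemma fsmooth_unchart:
  assumes "fsmooth A u" "\<And>x. x \<in> A \<Longrightarrow> u x \<in> chart_ran"
  shows "fsmooth A (\<lambda>x. unchart (u x))"
  unfolding unchart_def using assms fsmooth_open[OF assms(1)]
  by (intro fsmooth_bop_intros fsmooth_lower fsmooth_upper) (auto simp: chart_ran_def)

text \<open>\<open>slope\<close> is smooth only where \<open>diag\<close> is invertible, so the
  domain is cut out in stages, each the preimage of the invertible operators under a map that is
  smooth on the stage before.\<close>

lemma open_chart_dom: "open chart_dom"
proof -
  define U1 where "U1 = {X \<in> UNIV. diag X \<in> {X. binvertible X}}"
  have id: "fsmooth UNIV (\<lambda>X :: 'h bop. X)" by (simp add: fsmooth_ident)
  have "fsmooth UNIV diag" using fsmooth_diag[OF id] by simp
  then have U1: "open U1" unfolding U1_def by (rule fsmooth_preimage[OF _ open_binvertible])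
  define U2 where "U2 = {X \<in> U1. 1 + adj (slope X) * slope X \<in> {X. binvertible X}}"
  have "fsmooth U1 (\<lambda>X. 1 + adj (slope X) * slope X)"
    using U1 by (intro fsmooth_bop_intros fsmooth_slope fsmooth_ident) (auto simp: U1_def)
  then have U2: "open U2" unfolding U2_def by (rule fsmooth_preimage[OF _ open_binvertible])
  have "fsmooth U2 (\<lambda>X. 1 - corner X)"
    using U2 by (intro fsmooth_bop_intros fsmooth_corner fsmooth_ident) (auto simp: U1_def U2_def)
  then have "open {X \<in> U2. 1 - corner X \<in> {X. binvertible X}}" by (rule fsmooth_preimage[OF _ open_binvertible])
  also have "{X \<in> U2. 1 - corner X \<in> {X. binvertible X}} = chart_dom"
    by (auto simp: chart_dom_def U1_def U2_def)
  finally show ?thesis .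
qed

lemma open_chart_ran: "open chart_ran"
proof -
  define U1 where "U1 = {X \<in> UNIV. 1 + adj (lower X) * lower X \<in> {X. binvertible X}}"
  have id: "fsmooth UNIV (\<lambda>X :: 'h bop. X)" by (simp add: fsmooth_ident)
  have "fsmooth UNIV (\<lambda>X. 1 + adj (lower X) * lower X)" by (intro fsmooth_bop_intros fsmooth_lower id) auto
  then have U1: "open U1" unfolding U1_def by (rule fsmooth_preimage[OF _ open_binvertible])
  define U2 where "U2 = {X \<in> U1. upper X + Q \<in> {X. binvertible X}}"
  have "fsmooth U1 (\<lambda>X. upper X + Q)"
    using U1 by (intro fsmooth_bop_intros fsmooth_upper fsmooth_ident) (auto simp: U1_def)
  then have U2: "open U2" unfolding U2_def by (rule fsmooth_preimage[OF _ open_binvertible])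
  have "fsmooth U2 (\<lambda>X. 1 - Q * X * Q)"
    using U2 by (intro fsmooth_bop_intros fsmooth_ident)
  then have "open {X \<in> U2. 1 - Q * X * Q \<in> {X. binvertible X}}" by (rule fsmooth_preimage[OF _ open_binvertible])
  also have "{X \<in> U2. 1 - Q * X * Q \<in> {X. binvertible X}} = chart_ran"
    by (auto simp: chart_ran_def U1_def U2_def)
  finally show ?thesis .
qed

section \<open>The Grassmannian in the graph chart\<close>

lemma P_in_chart_dom: "P \<in> chart_dom"
proof -
  have d: "diag P = 1" by (simp add: diag_def PP Q_simps)
  have b: "binvertible (1 :: 'h bop)" by (rule binvI(1)[of _ 1]) simp_all
  have "slope P = 0" by (rule slope_eqI) (simp_all add: d b PQ')
  then show ?thesis by (simp add: chart_dom_def d b corner_def PQ')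
qed

text \<open>The operators from the range of \<open>P\<close> to the range of \<open>Q\<close>,
  extended by 0.\<close>

definition model where "model = range lower"

lemma model_iff: "Y \<in> model \<longleftrightarrow> lower Y = Y"
proof
  show "lower Y = Y" if "Y \<in> model" using that by (auto simp: model_def lower_def mult.assoc PQ')
  show "Y \<in> model" if "lower Y = Y" unfolding model_def by (metis that rangeI)
qed

lemma complemented_model: "complemented_subspace model"
  unfolding complemented_subspace_def model_def
proof (intro exI[of _ lower] conjI)
  show "bounded_linear lower" unfolding lower_def
    by (intro bounded_linear_mult_const bounded_linear_const_mult bounded_linear_ident)
  show "lower \<circ> lower = lower" by (auto simp: fun_eq_iff lower_def mult.assoc PQ')
qed simp

text \<open>With \<open>c = K * a\<close> and \<open>b = a * K'\<close>, the block equations of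
  \<open>X * X = X\<close> determine \<open>a\<close> and \<open>e\<close> from \<open>K\<close>:
  the first gives \<open>(1 + K' * K) * a = P\<close>, the other two make the Schur complement of
  \<open>a\<close> idempotent and hence 0. The second conclusion says that the range of
  \<open>X\<close> lies in the graph of the slope.\<close>

lemma chart_Grassmannian:
  assumes X: "X \<in> chart_dom" "X \<in> Grassmannian"
  shows "chart X \<in> model"
    and "Q * X = slope X * (P * X)"
proof -
  have d: "binvertible (diag X)" and B: "binvertible (1 + adj (slope X) * slope X)"
    and E: "binvertible (1 - corner X)" using X by (auto simp: chart_dom_def)
  have XX: "X * X = X" and aX: "adj X = X" using X(2) by (auto simp: Grassmannian_iff)
  define K K' a c b e where "K = slope X" and "K' = adj (slope X)" and "a = P * X * P" and "c = Q * X * P"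
    and "b = P * X * Q" and "e = Q * X * Q"
  note defs = K_def K'_def a_def c_def b_def e_def
  have blk: "P * K = 0" "Q * K = K" "K * P = K" "K * Q = 0" "K' * P = 0" "K' * Q = K'" "P * K' = K'" "Q * K' = 0"
    unfolding defs by (rule slope_blocks[OF d] adj_slope_blocks[OF d])+
  have ablk: "P * a = a" "a * P = a" "Q * a = 0" "a * Q = 0"
    by (simp_all add: a_def mult.assoc PQ')
  have c: "c = K * a" unfolding defs using slope_blocks(5)[OF d] by simp
  have aa: "adj a = a" by (simp add: a_def aX adjP mult.assoc)
  have "b = adj c" by (simp add: b_def c_def aX adjP Q_simps mult.assoc)
  then have b: "b = a * K'" by (simp add: c aa K_def K'_def)
  \<comment> \<open>Inserting \<open>P + Q = 1\<close> between the two factors of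
    \<open>X * X\<close> gives all block equations at once.\<close>
  have XX': "S * X * P * (P * X * Z) + S * X * Q * (Q * X * Z) = S * X * Z" for S Z
  proof -
    have "S * X * P * (P * X * Z) + S * X * Q * (Q * X * Z) = S * (X * ((P + Q) * (X * Z)))"
      by (simp only: distrib_left distrib_right mult.assoc PQ')
    also have "\<dots> = S * ((X * X) * Z)" by (simp add: Q_simps mult.assoc)
    finally show ?thesis by (simp add: XX mult.assoc)
  qed
  have a2: "a * a + b * c = a" and c2: "c * a + e * c = c" and e2: "c * b + e * e = e"
    using XX'[of P P] XX'[of Q P] XX'[of Q Q] by (simp_all only: a_def b_def c_def e_def)
  have inv: "binv (diag X) * a = P"
  proof -
    have "binv (diag X) * a = binv (diag X) * (diag X * P)"
      by (simp add: diag_def a_def distrib_right mult.assoc PQ')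
    then show ?thesis by (simp add: binv_assoc d)
  qed
  have inv': "a * binv (diag X) = P"
  proof -
    have "a * binv (diag X) = (P * diag X) * binv (diag X)"
      by (simp add: diag_def a_def distrib_left mult.assoc PQ')
    then show ?thesis by (simp add: binv mult.assoc d)
  qed
  \<comment> \<open>The upper left equation \<open>a * a + b * c = a\<close>, cancelled by the
    inverse of \<open>a\<close> on the range of \<open>P\<close>.\<close>
  have P1: "P = (1 + K' * K) * a"
  proof -
    have "P = binv (diag X) * (a * a + a * K' * (K * a))" using inv a2 unfolding b c by simp
    also have "\<dots> = (binv (diag X) * a) * (a + K' * (K * a))" by (simp add: distrib_left mult.assoc)
    also have "\<dots> = a + K' * (K * a)" by (simp add: inv distrib_left ablk blk mult_rewrite[OF blk(7)])
    finally show ?thesis by (simp add: distrib_right mult.assoc)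
  qed
  have a_eq: "a = binv (1 + K' * K) * P"
    using binv_assoc(2)[of "1 + K' * K" a] B unfolding P1[symmetric] by (simp add: K_def K'_def)
  then have a_eq': "P * binv (1 + K' * K) * P = a" by (simp add: mult.assoc ablk(1) flip: a_eq)
  have KK: "K' * (K * a) = P - a" using P1 by (metis add_diff_cancel_left' distrib_right mult.assoc mult_1_left)
  \<comment> \<open>The lower left equation \<open>c * a + e * c = c\<close>, with
    \<open>c = K * a\<close> and one factor \<open>a\<close> cancelled on the right.\<close>
  have eK: "e * K = K - K * a"
  proof -
    have "K * a * binv (diag X) = (K * a * a + e * (K * a)) * binv (diag X)" using c2 unfolding c by simp
    then have "K * (a * P) + e * (K * P) = K * P" by (simp add: mult.assoc distrib_right inv')
    then have "K * a + e * K = K" by (simp only: blk ablk)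
    then show ?thesis by (metis add_diff_cancel_left')
  qed
  have ea: "adj e = e" by (simp add: e_def aX Q_simps mult.assoc)
  have K'e: "K' * e = K' - a * K'" using arg_cong[OF eK, of adj] by (simp add: ea aa K_def K'_def)
  define f where "f = e - K * a * K'"
  have "f * f = f"
  proof -
    have 1: "e * e = e - K * (a * (a * K'))" using e2 unfolding c b by (simp add: mult.assoc eq_diff_eq add.commute)
    have 2: "e * (K * (a * K')) = K * (a * K') - K * (a * (a * K'))"
      by (simp add: mult_rewrite[OF eK] left_diff_distrib mult.assoc)
    have 3: "K * (a * (K' * e)) = K * (a * K') - K * (a * (a * K'))"
      by (simp add: K'e right_diff_distrib)
    have 4: "K * (a * (K' * (K * (a * K')))) = K * (a * K') - K * (a * (a * K'))"
    proof -
      have "K' * (K * (a * K')) = (P - a) * K'" using KK by (metis mult.assoc)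
      also have "\<dots> = K' - a * K'" by (simp add: left_diff_distrib blk)
      finally show ?thesis by (simp add: right_diff_distrib)
    qed
    have "f * f = e * e - e * (K * (a * K')) - K * (a * (K' * e)) + K * (a * (K' * (K * (a * K'))))"
      by (simp add: f_def left_diff_distrib right_diff_distrib mult.assoc)
    also have "\<dots> = f" unfolding 1 2 3 4 by (simp add: f_def mult.assoc)
    finally show ?thesis .
  qed
  moreover have "corner X = f" by (simp add: corner_def f_def defs mult.assoc)
  \<comment> \<open>An idempotent \<open>f\<close> satisfies \<open>(1 - f) * f = 0\<close>, and
    \<open>1 - f\<close> is invertible by the choice of the domain.\<close>
  ultimately have f0: "f = 0"
    using binv_assoc(2)[OF E, of f] by (simp add: left_diff_distrib)
  then have e: "e = K * a * K'" by (simp add: f_def)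
  have XQ: "X * Q = (P + K) * a * K'"
    using split_PQ'[of "X * Q"] b e by (simp add: b_def e_def mult.assoc distrib_right mult_rewrite[OF ablk(1)] add.commute)
  have "chart X = K" unfolding chart_def
    using a_eq' XQ by (simp add: a_def K_def K'_def)
  then show "chart X \<in> model" using blk by (simp add: model_iff lower_def)
  have "Q * X = c + e" using split_PQ[of "Q * X"] by (simp add: c_def e_def)
  moreover have "P * X = a + b" using split_PQ[of "P * X"] by (simp add: a_def b_def)
  ultimately show "Q * X = slope X * (P * X)"
    using c b e by (simp add: K_def distrib_left mult.assoc)
qed

text \<open>With \<open>V = P + L\<close>, the operator is \<open>V a V*\<close>, where
  \<open>a\<close> inverts \<open>V* V = (1 + L' * L) * P\<close> on the range of \<open>P\<close>.
  This is the usual formula for the orthogonal projection onto the range of \<open>V\<close>, the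
  graph of \<open>L\<close>.\<close>

lemma unchart_Grassmannian:
  assumes Y: "Y \<in> chart_ran" "Y \<in> model"
  shows "unchart Y \<in> Grassmannian"
proof -
  define L L' where "L = lower Y" and "L' = adj (lower Y)"
  note blk = lower_blocks[of Y, folded L_def L'_def]
  have YL: "Y = L" using Y(2) by (simp add: model_iff L_def)
  have PY: "P * Y = 0" and YQ: "Y * Q = 0" using blk(1,4) by (simp_all flip: YL)
  have B: "binvertible (1 + L' * L)" using Y(1) by (simp add: chart_ran_def L_def L'_def)
  have c: "binv (1 + L' * L) * P = P * binv (1 + L' * L)"
    by (rule binv_commute[OF B]) (simp add: distrib_left distrib_right mult.assoc blk blk[THEN mult_rewrite])
  define a where "a = upper Y"
  have a: "a = P * binv (1 + L' * L) * P"
    using PY by (simp add: a_def upper_def L_def L'_def)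
  have aa: "adj a = a"
    using adj_binv[OF B] by (simp add: a adjP mult.assoc) (simp add: L_def L'_def)
  have ablk: "P * a = a" "a * P = a" by (simp_all add: a mult.assoc PQ')
  have X: "unchart Y = (P + L) * a * (P + L')"
    using YQ by (simp add: unchart_def L_def L'_def a_def)
  have PL: "(P + L') * (P + L) = (1 + L' * L) * P"
    by (simp add: distrib_left distrib_right mult.assoc PQ' blk)
  have a1: "a * ((1 + L' * L) * P) = P"
  proof -
    have "a = P * binv (1 + L' * L)" by (simp add: a mult.assoc c PQ')
    then show ?thesis by (simp add: mult.assoc binv_assoc[OF B] PP)
  qed
  have "unchart Y * unchart Y = (P + L) * (a * (((P + L') * (P + L)) * (a * (P + L'))))"
    unfolding X by (simp only: mult.assoc)
  also have "\<dots> = (P + L) * ((a * ((1 + L' * L) * P)) * (a * (P + L')))"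
    unfolding PL by (simp only: mult.assoc)
  also have "\<dots> = unchart Y" unfolding a1 X by (simp add: mult_rewrite[OF ablk(1)] mult.assoc)
  finally have "unchart Y * unchart Y = unchart Y" .
  moreover have "adj (unchart Y) = unchart Y"
    unfolding X by (simp add: adjP aa mult.assoc) (simp add: L_def L'_def)
  ultimately show ?thesis by (simp add: Grassmannian_iff)
qed

lemma chart_image: "chart ` (chart_dom \<inter> Grassmannian) = chart_ran \<inter> model"
proof (intro equalityI subsetI)
  fix Y assume Y: "Y \<in> chart_ran \<inter> model"
  then have "Y = chart (unchart Y)" by (simp add: chart_unchart)
  then show "Y \<in> chart ` (chart_dom \<inter> Grassmannian)"
    using Y unchart_mem unchart_Grassmannian by blast
qed (auto simp: chart_mem chart_Grassmannian)

lemma model_add: "X \<in> model \<Longrightarrow> Y \<in> model \<Longrightarrow> X + Y \<in> model"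
  and model_diff: "X \<in> model \<Longrightarrow> Y \<in> model \<Longrightarrow> X - Y \<in> model"
  by (simp_all add: model_iff lower_def algebra_simps)

lemma chart_eq_slope: "X \<in> chart_dom \<Longrightarrow> X \<in> Grassmannian \<Longrightarrow> chart X = slope X"
  using chart_Grassmannian(1)[of X] chart_blocks(1)[of X] by (simp add: model_iff chart_dom_def)

lemma chart_homeomorphism: "homeomorphism chart_dom chart_ran chart unchart"
  using chart_mem unchart_mem chart_unchart unchart_chart
    fsmooth_continuous_on[OF fsmooth_chart[OF fsmooth_ident[OF open_chart_dom]]]
    fsmooth_continuous_on[OF fsmooth_unchart[OF fsmooth_ident[OF open_chart_ran]]]
  by (intro homeomorphismI) auto

end

lemma projection_Grassmannian: "P \<in> Grassmannian \<Longrightarrow> projection P"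
  by standard (simp_all add: Grassmannian_iff)

lemma submanifold_Grassmannian: "submanifold (Grassmannian :: 'h::complex_hilbert_space bop set)"
  unfolding submanifold_def
proof
  fix P :: "'h bop" assume "P \<in> Grassmannian"
  then interpret projection P by (rule projection_Grassmannian)
  have "smooth_diffeomorphism chart_dom chart_ran chart unchart"
    unfolding smooth_diffeomorphism_def
    by (intro conjI chart_homeomorphism fsmooth_imp_smooth_on fsmooth_chart fsmooth_unchart fsmooth_ident open_chart_dom open_chart_ran)
  then show "\<exists>U V \<Phi> \<Psi> F. P \<in> U \<and> smooth_diffeomorphism U V \<Phi> \<Psi> \<and>
      complemented_subspace (F :: 'h bop set) \<and> \<Phi> ` (U \<inter> Grassmannian) = V \<inter> F"
    using P_in_chart_dom complemented_model chart_image by blast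
qed

section \<open>Weakly holomorphic maps\<close>

text \<open>By Baire one of the closed sets on which all functionals are bounded by \<open>n\<close>
  contains a ball; moving inside it in the direction of \<open>G i\<close> bounds the norm of
  \<open>G i\<close>.\<close>

lemma uniform_boundedness:
  fixes G :: "'i \<Rightarrow> 'a::complex_hilbert_space"
  assumes "\<And>f. \<exists>M. \<forall>i\<in>S. cmod (cinner (G i) f) \<le> M"
  shows "\<exists>M. \<forall>i\<in>S. norm (G i) \<le> M"
proof -
  define T where "T = (\<lambda>n :: nat. {f. \<forall>i\<in>S. cmod (cinner (G i) f) \<le> real n})"
  have cl: "closed (T n)" for n
  proof -
    have "T n = (\<Inter>i\<in>S. {f. cmod (cinner (G i) f) \<le> real n})" by (auto simp: T_def)
    moreover have "closed {f. cmod (cinner (G i) f) \<le> real n}" for i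
      by (intro closed_Collect_le continuous_intros
          bounded_linear.continuous_on[OF bounded_bilinear.bounded_linear_right[OF bounded_bilinear_cinner]])
    ultimately show ?thesis by auto
  qed
  have "\<exists>n. interior (T n) \<noteq> {}"
  proof (rule ccontr)
    assume "\<not> (\<exists>n. interior (T n) \<noteq> {})"
    then have "euclidean interior_of \<Union>(range T) = {}"
      using cl by (intro Baire_category_alt) (auto simp: completely_metrizable_space_euclidean)
    moreover have "\<Union>(range T) = UNIV"
    proof -
      have "f \<in> \<Union>(range T)" for f
      proof -
        obtain M where M: "\<And>i. i \<in> S \<Longrightarrow> cmod (cinner (G i) f) \<le> M" using assms by blast
        obtain n :: nat where "M \<le> real n" using real_arch_simple by blast
        then have "f \<in> T n" using M by (force simp: T_def)
        then show ?thesis by blast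
      qed
      then show ?thesis by blast
    qed
    ultimately show False by simp
  qed
  then obtain n f0 r where r: "r > 0" "ball f0 r \<subseteq> T n"
    by (metis ex_in_conv mem_interior)
  have "norm (G i) \<le> 4 * real n / r" if i: "i \<in> S" for i
  proof (cases "G i = 0")
    case False
    \<comment> \<open>A step of length \<open>r / 2\<close> from the centre, which stays in the
      ball.\<close>
    define c where "c = r / (2 * norm (G i))"
    have c: "c > 0" using False r by (simp add: c_def)
    have "f0 + c *\<^sub>R G i \<in> ball f0 r" using False r c by (simp add: dist_norm) (simp add: c_def)
    then have "f0 + c *\<^sub>R G i \<in> T n" using r by blast
    then have 1: "cmod (cinner (G i) (f0 + c *\<^sub>R G i)) \<le> real n" using i by (simp add: T_def)
    have "f0 \<in> T n" using r centre_in_ball[of f0 r] by blast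
    then have 2: "cmod (cinner (G i) f0) \<le> real n" using i by (simp add: T_def)
    have "c * (norm (G i))\<^sup>2 = cmod (cinner (G i) (f0 + c *\<^sub>R G i) - cinner (G i) f0)"
      using c by (simp add: scaleR_eq_scaleC cinner_simps cinner_self norm_mult norm_power)
    also have "\<dots> \<le> 2 * real n" using norm_triangle_ineq4[of "cinner (G i) (f0 + c *\<^sub>R G i)" "cinner (G i) f0"] 1 2 by simp
    finally have "r * norm (G i) / 2 \<le> 2 * real n" using False by (simp add: c_def power2_eq_square)
    then show ?thesis using r by (simp add: field_simps)
  qed (use r in simp)
  then show ?thesis by blast
qed

text \<open>The difference quotient extends holomorphically across \<open>z\<close>, and the
  derivative of the extension is bounded on the compact disk. The constant may depend on \<phi>;
  uniform boundedness removes this later.\<close>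

lemma holomorphic_quotient_lipschitz:
  assumes "\<phi> holomorphic_on V" "open V" "cball z r \<subseteq> V" "0 < r"
  shows "\<exists>M. \<forall>x\<in>cball z r - {z}. \<forall>y\<in>cball z r - {z}.
    cmod ((\<phi> x - \<phi> z) / (x - z) - (\<phi> y - \<phi> z) / (y - z)) \<le> M * cmod (x - y)"
proof -
  define q where "q = (\<lambda>x. if x = z then deriv \<phi> z else (\<phi> x - \<phi> z) / (x - z))"
  have z: "z \<in> V" using assms by auto
  have q: "q holomorphic_on V"
    unfolding q_def using pole_lemma[OF assms(1)] z assms(2) by (simp add: interior_open)
  then have "continuous_on (cball z r) (deriv q)"
    using assms by (meson holomorphic_deriv holomorphic_on_imp_continuous_on continuous_on_subset)
  then have "compact (deriv q ` cball z r)" by (intro compact_continuous_image) auto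
  then obtain B where B: "\<And>x. x \<in> cball z r \<Longrightarrow> cmod (deriv q x) \<le> B"
    by (meson bounded_iff compact_imp_bounded imageI)
  have lip: "cmod (q x - q y) \<le> B * cmod (x - y)" if "x \<in> cball z r" "y \<in> cball z r" for x y
  proof (rule field_differentiable_bound[OF convex_cball _ B that])
    fix w assume "w \<in> cball z r"
    then show "(q has_field_derivative deriv q w) (at w within cball z r)"
      using q assms by (intro holomorphic_derivI) auto
  qed
  then have "cmod ((\<phi> x - \<phi> z) / (x - z) - (\<phi> y - \<phi> z) / (y - z)) \<le> B * cmod (x - y)"
    if "x \<in> cball z r - {z}" "y \<in> cball z r - {z}" for x y
  proof -
    have "q x = (\<phi> x - \<phi> z) / (x - z)" "q y = (\<phi> y - \<phi> z) / (y - z)" using that by (auto simp: q_def)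
    then show ?thesis using lip[of x y] that by simp
  qed
  then show ?thesis by blast
qed

text \<open>Uniform boundedness turns the Lipschitz estimates for the scalar difference quotients into one in norm,
  so the difference quotients of the vector-valued map converge.\<close>

lemma weakly_holomorphic_derivative:
  fixes g :: "complex \<Rightarrow> 'a::complex_hilbert_space"
  assumes V: "open V" and g: "\<And>f. (\<lambda>z. cinner (g z) f) holomorphic_on V"
  shows "\<exists>g'. (\<forall>f. (\<lambda>z. cinner (g' z) f) holomorphic_on V) \<and>
    (\<forall>z\<in>V. (g has_derivative (\<lambda>h. h *\<^sub>C g' z)) (at z))"
proof -
  interpret sC: bounded_bilinear "scaleC :: complex \<Rightarrow> 'a \<Rightarrow> 'a" by (rule bounded_bilinear_scaleC)
  have "\<exists>l. (g has_derivative (\<lambda>h. h *\<^sub>C l)) (at z)" if z: "z \<in> V" for z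
  proof -
    obtain r where r: "r > 0" "cball z r \<subseteq> V" using V z open_contains_cball by blast
    define q where "q = (\<lambda>x. (1 / (x - z)) *\<^sub>C (g x - g z))"
    define S where "S = {(x, y). x \<in> cball z r - {z} \<and> y \<in> cball z r - {z} \<and> x \<noteq> y}"
    have "\<exists>M. \<forall>p\<in>S. cmod (cinner (case p of (x, y) \<Rightarrow> (1 / (x - y)) *\<^sub>C (q x - q y)) f) \<le> M" for f
    proof -
      obtain M where M: "\<And>x y. x \<in> cball z r - {z} \<Longrightarrow> y \<in> cball z r - {z} \<Longrightarrow>
        cmod ((cinner (g x) f - cinner (g z) f) / (x - z) - (cinner (g y) f - cinner (g z) f) / (y - z)) \<le> M * cmod (x - y)"
        using holomorphic_quotient_lipschitz[OF g V r(2,1)] by blast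
      have "cmod (cinner ((1 / (x - y)) *\<^sub>C (q x - q y)) f) \<le> M" if "(x, y) \<in> S" for x y
        using M[of x y] that by (simp add: S_def q_def cinner_simps norm_divide divide_le_eq)
      then show ?thesis by (intro exI[of _ M]) auto
    qed
    then obtain C where C: "\<forall>p\<in>S. norm (case p of (x, y) \<Rightarrow> (1 / (x - y)) *\<^sub>C (q x - q y)) \<le> C"
      using uniform_boundedness[of S "\<lambda>(x, y). (1 / (x - y)) *\<^sub>C (q x - q y)"] by blast
    have lip: "norm (q x - q y) \<le> C * cmod (x - y)" if "x \<in> cball z r - {z}" "y \<in> cball z r - {z}" for x y
    proof (cases "x = y")
      case False
      then have "norm ((1 / (x - y)) *\<^sub>C (q x - q y)) \<le> C" using C that by (auto simp: S_def)
      then show ?thesis using False by (simp add: norm_scaleC norm_divide divide_le_eq)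
    qed simp
    \<comment> \<open>One concrete sequence in the punctured disk suffices to find the limit; the
      Lipschitz estimate then controls every other approach to \<open>z\<close>.\<close>
    define X where "X = (\<lambda>n. z + complex_of_real (r / real (Suc n)))"
    have X: "X n \<in> cball z r - {z}" for n
    proof -
      have "r / real (Suc n) \<le> r" using r by (simp add: divide_le_eq)
      then show ?thesis using r by (auto simp: X_def dist_norm simp del: of_nat_Suc of_real_divide)
    qed
    have Xz: "X \<longlonglongrightarrow> z"
    proof -
      have "(\<lambda>n. z + complex_of_real (r * (1 / real (Suc n)))) \<longlonglongrightarrow> z + complex_of_real (r * 0)"
        by (intro tendsto_intros LIMSEQ_inverse_real_of_nat[unfolded inverse_eq_divide])
      then show ?thesis by (simp add: X_def)
    qed
    have "Cauchy (\<lambda>n. q (X n))"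
    proof (rule metric_CauchyI)
      fix e :: real assume e: "e > 0"
      define e' where "e' = e / (\<bar>C\<bar> + 1)"
      have e': "e' > 0" using e by (simp add: e'_def)
      obtain M where M: "\<And>m n. m \<ge> M \<Longrightarrow> n \<ge> M \<Longrightarrow> dist (X m) (X n) < e'"
        using LIMSEQ_imp_Cauchy[OF Xz] e' unfolding Cauchy_def by blast
      have "dist (q (X m)) (q (X n)) < e" if "m \<ge> M" "n \<ge> M" for m n
      proof -
        have "norm (q (X m) - q (X n)) \<le> C * cmod (X m - X n)" by (rule lip[OF X X])
        also have "\<dots> \<le> (\<bar>C\<bar> + 1) * cmod (X m - X n)" by (intro mult_right_mono) auto
        also have "\<dots> < (\<bar>C\<bar> + 1) * e'"
          using M[OF that] by (intro mult_strict_left_mono) (auto simp: dist_norm)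
        also have "\<dots> = e" by (simp add: e'_def)
        finally show ?thesis by (simp add: dist_norm)
      qed
      then show "\<exists>M. \<forall>m\<ge>M. \<forall>n\<ge>M. dist (q (X m)) (q (X n)) < e" by blast
    qed
    then obtain l where l: "(\<lambda>n. q (X n)) \<longlonglongrightarrow> l" using Cauchy_convergent_iff convergent_def by blast
    have ql: "norm (q x - l) \<le> C * cmod (x - z)" if "x \<in> cball z r - {z}" for x
    proof (rule LIMSEQ_le)
      show "(\<lambda>n. norm (q x - q (X n))) \<longlonglongrightarrow> norm (q x - l)" by (intro tendsto_intros l)
      show "(\<lambda>n. C * cmod (x - X n)) \<longlonglongrightarrow> C * cmod (x - z)" by (intro tendsto_intros Xz)
      show "\<exists>N. \<forall>n\<ge>N. norm (q x - q (X n)) \<le> C * cmod (x - X n)" using lip[OF that X] by blast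
    qed
    have est: "norm (g x - g z - (x - z) *\<^sub>C l) \<le> C * cmod (x - z) * cmod (x - z)" if "x \<in> cball z r" for x
    proof (cases "x = z")
      case False
      then have "g x - g z - (x - z) *\<^sub>C l = (x - z) *\<^sub>C (q x - l)"
        by (simp add: q_def sC.diff_right scaleC_scaleC scaleC_one)
      then show ?thesis using mult_left_mono[OF ql[of x], of "cmod (x - z)"] that False
        by (simp add: norm_scaleC mult_ac)
    qed simp
    have "(g has_derivative (\<lambda>h. h *\<^sub>C l)) (at z)"
      unfolding has_derivative_at_alt
    proof (intro conjI allI impI)
      show "bounded_linear (\<lambda>h. h *\<^sub>C l)" by (rule sC.bounded_linear_left)
      fix e :: real assume e: "e > 0"
      show "\<exists>d>0. \<forall>y. cmod (y - z) < d \<longrightarrow> norm (g y - g z - (y - z) *\<^sub>C l) \<le> e * cmod (y - z)"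
      proof (intro exI[of _ "min r (e / (\<bar>C\<bar> + 1))"] conjI allI impI)
        fix y assume y: "cmod (y - z) < min r (e / (\<bar>C\<bar> + 1))"
        then have "norm (g y - g z - (y - z) *\<^sub>C l) \<le> C * cmod (y - z) * cmod (y - z)"
          by (intro est) (auto simp: dist_norm norm_minus_commute)
        also have "\<dots> \<le> e * cmod (y - z)"
        proof (rule mult_right_mono)
          have "C * cmod (y - z) \<le> (\<bar>C\<bar> + 1) * cmod (y - z)" by (intro mult_right_mono) auto
          also have "\<dots> \<le> e" using y by (simp add: field_simps)
          finally show "C * cmod (y - z) \<le> e" .
        qed simp
        finally show "norm (g y - g z - (y - z) *\<^sub>C l) \<le> e * cmod (y - z)" .
      qed (use r e in auto)
    qed
    then show ?thesis by blast
  qed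
  then obtain g' where g': "\<And>z. z \<in> V \<Longrightarrow> (g has_derivative (\<lambda>h. h *\<^sub>C g' z)) (at z)" by metis
  have "(\<lambda>z. cinner (g' z) f) holomorphic_on V" for f
  proof (rule holomorphic_transform[OF holomorphic_deriv[OF g V]])
    fix z assume z: "z \<in> V"
    have "((\<lambda>z. cinner (g z) f) has_derivative (\<lambda>h. cinner (h *\<^sub>C g' z) f)) (at z)"
      using bounded_linear.has_derivative[OF bounded_bilinear.bounded_linear_left[OF bounded_bilinear_cinner] g'[OF z]] .
    then have "((\<lambda>z. cinner (g z) f) has_field_derivative cinner (g' z) f) (at z)"
      unfolding has_field_derivative_def by (rule has_derivative_eq_rhs) (simp add: fun_eq_iff cinner_simps mult.commute)
    then show "deriv (\<lambda>z. cinner (g z) f) z = cinner (g' z) f" by (rule DERIV_imp_deriv)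
  qed
  then show ?thesis using g' by blast
qed

text \<open>The derivative of a weakly holomorphic map is weakly holomorphic again, so dependent
  choice builds a tower of derivatives of all orders.\<close>

lemma fsmooth_weakly_holomorphic:
  fixes g :: "complex \<Rightarrow> 'a::complex_hilbert_space"
  assumes V: "open V" and g: "\<And>f. (\<lambda>z. cinner (g z) f) holomorphic_on V"
    and u: "fsmooth U u" "\<And>x. x \<in> U \<Longrightarrow> u x \<in> V"
  shows "fsmooth U (\<lambda>x. g (u x))"
proof -
  define P where "P = (\<lambda>(n :: nat) h. (n = 0 \<longrightarrow> h = g) \<and> (\<forall>f. (\<lambda>z. cinner (h z) f) holomorphic_on V))"
  have "\<exists>G. \<forall>n. P n (G n) \<and> (\<forall>z\<in>V. (G n has_derivative (\<lambda>h. h *\<^sub>C G (Suc n) z)) (at z))"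
  proof (rule dependent_nat_choice)
    show "\<exists>h. P 0 h" using g by (auto simp: P_def)
    fix h n assume "P n h"
    then show "\<exists>h'. P (Suc n) h' \<and> (\<forall>z\<in>V. (h has_derivative (\<lambda>v. v *\<^sub>C h' z)) (at z))"
      using weakly_holomorphic_derivative[OF V, of h] by (auto simp: P_def)
  qed
  then obtain G where G: "\<And>n. P n (G n)" "\<And>n z. z \<in> V \<Longrightarrow> (G n has_derivative (\<lambda>h. h *\<^sub>C G (Suc n) z)) (at z)"
    by blast
  have "G 0 = g" using G(1)[of 0] by (simp add: P_def)
  then show ?thesis using fsmooth_vector_tower[OF bounded_bilinear_scaleC, of V G U u] G(2) u by simp
qed

section \<open>Rank-one operators\<close>

definition rank_one :: "'a::complex_hilbert_space \<Rightarrow> 'a \<Rightarrow> 'a bop"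
  where "rank_one u v = (SOME T. bop_apply T = (\<lambda>x. cinner x v *\<^sub>C u))"

lemma rank_one_apply [simp]: "bop_apply (rank_one u v) x = cinner x v *\<^sub>C u"
proof -
  have "\<exists>T. bop_apply T = (\<lambda>x. cinner x v *\<^sub>C u)"
    by (rule bop_exists[where K = "norm v * norm u"])
      (auto simp: cinner_simps scaleC_add_left scaleC_scaleC norm_scaleC mult_right_mono[OF cinner_norm_le] simp flip: mult.assoc)
  from someI_ex[OF this] show ?thesis by (simp add: rank_one_def fun_eq_iff)
qed

lemma bounded_bilinear_rank_one: "bounded_bilinear (rank_one :: 'a \<Rightarrow> 'a \<Rightarrow> 'a::complex_hilbert_space bop)"
proof
  show "rank_one (a + a') b = rank_one a b + rank_one a' b" for a a' b :: 'a
    by (rule bop_eqI) (simp add: scaleC_add_right)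
  show "rank_one a (b + b') = rank_one a b + rank_one a b'" for a b b' :: 'a
    by (rule bop_eqI) (simp add: cinner_simps scaleC_add_left)
  show "rank_one (r *\<^sub>R a) b = r *\<^sub>R rank_one a b" for a b :: 'a and r
    by (rule bop_eqI) (simp add: scaleR_eq_scaleC scaleC_scaleC mult.commute)
  show "rank_one a (r *\<^sub>R b) = r *\<^sub>R rank_one a b" for a b :: 'a and r
    by (rule bop_eqI) (simp add: scaleR_eq_scaleC scaleC_scaleC cinner_simps)
  have "norm (rank_one a b) \<le> norm a * norm b * 1" for a b :: 'a
    by (rule norm_bop_le) (use mult_right_mono[OF cinner_norm_le[of _ b], of "norm a"] in \<open>auto simp: norm_scaleC mult_ac\<close>)
  then show "\<exists>K. \<forall>a b :: 'a. norm (rank_one a b) \<le> norm a * norm b * K" by blast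
qed

lemma adj_rank_one: "adj (rank_one u v) = rank_one v u"
proof (rule adj_unique)
  show "cinner (bop_apply (rank_one u v) x) y = cinner x (bop_apply (rank_one v u) y)" for x y
    using cinner_commute[of u y] by (simp add: cinner_simps)
qed

section \<open>The Moebius group as a Lie group\<close>

definition mob :: "complex \<Rightarrow> complex \<Rightarrow> complex"
  where "mob a z = (a - z) / (1 - cnj a * z)"

lemma mob_denom_nz: "a \<in> unit_disk \<Longrightarrow> z \<in> unit_disk \<Longrightarrow> 1 - cnj a * z \<noteq> 0"
proof
  assume a: "a \<in> unit_disk" "z \<in> unit_disk" and "1 - cnj a * z = 0"
  then have "1 = cmod (cnj a * z)" by (metis eq_iff_diff_eq_0 norm_one)
  also have "\<dots> < 1 * 1" using a unfolding norm_mult by (intro mult_strict_mono') auto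
  finally show False by simp
qed

lemma mob_disk: "a \<in> unit_disk \<Longrightarrow> z \<in> unit_disk \<Longrightarrow> mob a z \<in> unit_disk"
  using Moebius_function_norm_lt_1[of a z 0]
  by (simp add: Moebius_function_def mob_def norm_divide norm_minus_commute)

lemma mob_mob:
  assumes "a \<in> unit_disk" "z \<in> unit_disk"
  shows "mob a (mob a z) = z"
proof -
  have nz: "1 - cnj a * z \<noteq> 0" "1 - cnj a * a \<noteq> 0" "1 - cnj a * mob a z \<noteq> 0"
    using mob_denom_nz mob_disk assms by blast+
  have 1: "mob a z * (1 - cnj a * z) = a - z" using nz(1) by (simp add: mob_def)
  have "(1 - cnj a * z) * (a - mob a z - z * (1 - cnj a * mob a z)) =
      a * (1 - cnj a * z) - mob a z * (1 - cnj a * z) - z * (1 - cnj a * z - cnj a * (mob a z * (1 - cnj a * z)))"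
    by (simp add: algebra_simps)
  also have "\<dots> = 0" unfolding 1 by (simp add: algebra_simps)
  finally have "a - mob a z = z * (1 - cnj a * mob a z)" using nz(1) by simp
  then show ?thesis using nz(3) by (simp add: mob_def[of a "mob a z"])
qed

lemma mob_simps [simp]: "mob a a = 0" "mob a 0 = a" "mob 0 z = - z"
  by (simp_all add: mob_def)

lemma mob_has_field_derivative:
  assumes "a \<in> unit_disk" "z \<in> unit_disk"
  shows "\<exists>d. d \<noteq> 0 \<and> (mob a has_field_derivative d) (at z)"
proof -
  have nz: "1 - cnj a * z \<noteq> 0" "1 - cnj a * a \<noteq> 0" using mob_denom_nz assms by blast+
  have "(mob a has_field_derivative (- 1 * (1 - cnj a * z) - (a - z) * (- cnj a)) / (1 - cnj a * z)\<^sup>2) (at z)"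
    unfolding mob_def[abs_def] using nz by (auto intro!: derivative_eq_intros simp: power2_eq_square)
  also have "- 1 * (1 - cnj a * z) - (a - z) * (- cnj a) = - (1 - cnj a * a)" by (simp add: algebra_simps)
  finally have "(mob a has_field_derivative - (1 - cnj a * a) / (1 - cnj a * z)\<^sup>2) (at z)" .
  moreover have "- (1 - cnj a * a) / (1 - cnj a * z)\<^sup>2 \<noteq> 0"
    using nz by (metis divide_eq_0_iff neg_equal_0_iff_equal power_not_zero)
  ultimately show ?thesis by blast
qed

section \<open>The group law in the parameters\<close>

lemma moebius_paramsD: "(a, w) \<in> moebius_params \<Longrightarrow> a \<in> unit_disk \<and> cmod w = 1"
  by (simp add: moebius_params_def)

lemma disk_moebius_apply: "z \<in> unit_disk \<Longrightarrow> disk_moebius (a, w) z = w * mob a z"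
  by (simp add: disk_moebius_def mob_def)

lemma disk_moebius_disk: "s \<in> moebius_params \<Longrightarrow> z \<in> unit_disk \<Longrightarrow> disk_moebius s z \<in> unit_disk"
  using mob_disk[of "fst s" z] by (cases s) (auto simp: moebius_params_def disk_moebius_apply norm_mult)

lemma disk_moebius_extensional: "disk_moebius s \<in> extensional unit_disk"
  by (cases s) (simp add: disk_moebius_def)

text \<open>The first component is the zero of the composite: \<open>v * mob b z = a\<close> holds
  for \<open>z = mob b (cnj v * a)\<close>. The second is the remaining unimodular factor; its
  denominator is the conjugate of the bracket in its numerator.\<close>

definition moebius_mult :: "(complex \<times> complex) \<times> (complex \<times> complex) \<Rightarrow> complex \<times> complex"
  where "moebius_mult = (\<lambda>((a, w), (b, v)). (mob b (cnj v * a),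
    - (w * v * (1 - cnj b * (cnj v * a)) / (1 - b * (v * cnj a)))))"

text \<open>\<open>mob a\<close> is an involution, so the inverse sends z to
  \<open>mob a (cnj w * z)\<close>, which equals \<open>cnj w * mob (w * a) z\<close>.\<close>

definition moebius_inv :: "complex \<times> complex \<Rightarrow> complex \<times> complex"
  where "moebius_inv = (\<lambda>(a, w). (w * a, cnj w))"

lemma unit_cnj: "cmod w = 1 \<Longrightarrow> w * cnj w = 1"
  by (simp add: complex_norm_square[symmetric])

lemma unit_mult_disk: "cmod v = 1 \<Longrightarrow> a \<in> unit_disk \<Longrightarrow> v * a \<in> unit_disk"
  by (simp add: norm_mult)

lemma moebius_mult_params:
  assumes "s \<in> moebius_params" "t \<in> moebius_params"
  shows "moebius_mult (s, t) \<in> moebius_params"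
proof (cases s; cases t)
  fix a w b v assume s: "s = (a, w)" "t = (b, v)"
  then have p: "a \<in> unit_disk" "cmod w = 1" "b \<in> unit_disk" "cmod v = 1"
    using assms moebius_paramsD by auto
  have va: "cnj v * a \<in> unit_disk" using p by (intro unit_mult_disk) auto
  then have nz: "1 - cnj b * (cnj v * a) \<noteq> 0" using p mob_denom_nz by blast
  have "1 - b * (v * cnj a) = cnj (1 - cnj b * (cnj v * a))" by simp
  then have "cmod (1 - b * (v * cnj a)) = cmod (1 - cnj b * (cnj v * a))" by (metis complex_mod_cnj)
  then show ?thesis using s p mob_disk[OF p(3) va] nz
    by (simp add: moebius_mult_def moebius_params_def norm_mult norm_divide)
qed

lemma moebius_mult_apply:
  assumes "s \<in> moebius_params" "t \<in> moebius_params" "z \<in> unit_disk"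
  shows "disk_moebius s (disk_moebius t z) = disk_moebius (moebius_mult (s, t)) z"
proof (cases s; cases t)
  fix a w b v assume s: "s = (a, w)" "t = (b, v)"
  then have p: "a \<in> unit_disk" "cmod w = 1" "b \<in> unit_disk" "cmod v = 1"
    using assms moebius_paramsD by auto
  define c where "c = mob b (cnj v * a)"
  have va: "cnj v * a \<in> unit_disk" using p by (intro unit_mult_disk) auto
  have vv: "v * cnj v = 1" using p unit_cnj by blast
  have c: "c \<in> unit_disk" using mob_disk p va by (simp add: c_def)
  define D where "D = 1 - cnj b * (cnj v * a)"
  define E where "E = 1 - b * (v * cnj a)"
  have D: "D \<noteq> 0" using mob_denom_nz[OF p(3) va] by (simp add: D_def)
  have "E = cnj D" by (simp add: D_def E_def)
  then have E: "E \<noteq> 0" using D complex_cnj_zero_iff by metis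
  have cD: "c * D = b - cnj v * a" using D by (simp add: c_def mob_def D_def)
  have cE: "cnj c * E = cnj b - v * cnj a" using arg_cong[OF cD, of cnj] by (simp add: D_def E_def)
  \<comment> \<open>The denominator of \<open>mob b z\<close>; multiplying by it clears the inner
    fraction from both numerator and denominator of the composite.\<close>
  define F where "F = 1 - cnj b * z"
  have F: "F \<noteq> 0" using mob_denom_nz p assms(3) by (simp add: F_def)
  have tz: "disk_moebius t z \<in> unit_disk" by (rule disk_moebius_disk[OF assms(2,3)])
  have tzF: "disk_moebius t z * F = v * (b - z)" using F assms(3) by (simp add: s disk_moebius_apply mob_def F_def)
  have 1: "1 - cnj a * disk_moebius t z \<noteq> 0" "1 - cnj c * z \<noteq> 0"
    using mob_denom_nz p tz c assms(3) by blast+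
  have num: "(a - disk_moebius t z) * F = - v * (c - z) * D"
  proof -
    have "(a - disk_moebius t z) * F = a * F - v * (b - z)" using tzF by (simp add: algebra_simps)
    also have "\<dots> = (v * cnj v) * a - v * b + z * (v - (v * cnj v) * a * cnj b)"
      by (simp add: vv F_def algebra_simps)
    also have "\<dots> = - v * ((b - cnj v * a) - z * D)" by (simp add: D_def algebra_simps)
    also have "\<dots> = - v * (c * D - z * D)" by (simp only: cD)
    finally show ?thesis by (simp add: algebra_simps)
  qed
  have den: "(1 - cnj a * disk_moebius t z) * F = (1 - cnj c * z) * E"
  proof -
    have "(1 - cnj a * disk_moebius t z) * F = F - cnj a * (disk_moebius t z * F)" by (simp add: algebra_simps)
    also have "\<dots> = F - cnj a * (v * (b - z))" by (simp only: tzF)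
    also have "\<dots> = E - (cnj b - v * cnj a) * z" by (simp add: E_def F_def algebra_simps)
    also have "\<dots> = E - (cnj c * E) * z" by (simp only: cE)
    finally show ?thesis by (simp add: algebra_simps)
  qed
  have "disk_moebius s (disk_moebius t z) = w * (((a - disk_moebius t z) * F) / ((1 - cnj a * disk_moebius t z) * F))"
    using tz F by (simp add: s(1) disk_moebius_apply mob_def)
  also have "\<dots> = - (w * v * D / E) * ((c - z) / (1 - cnj c * z))"
    unfolding num den by (simp add: mult_ac)
  also have "\<dots> = disk_moebius (moebius_mult (s, t)) z"
  proof -
    have "moebius_mult (s, t) = (c, - (w * v * D / E))"
      by (simp add: s moebius_mult_def c_def D_def E_def)
    then show ?thesis using disk_moebius_apply[OF assms(3)] by (simp add: mob_def)
  qed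
  finally show ?thesis .
qed

lemma moebius_inv_params: "s \<in> moebius_params \<Longrightarrow> moebius_inv s \<in> moebius_params"
  by (cases s) (auto simp: moebius_params_def moebius_inv_def norm_mult)

lemma moebius_inv_apply:
  assumes "s \<in> moebius_params" "z \<in> unit_disk"
  shows "disk_moebius (moebius_inv s) (disk_moebius s z) = z"
proof (cases s)
  case (Pair a w)
  then have p: "a \<in> unit_disk" "cmod w = 1" using assms moebius_paramsD by auto
  have ww: "cnj w * w = 1" using unit_cnj[OF p(2)] by (simp add: mult.commute)
  have "disk_moebius s z \<in> unit_disk" by (rule disk_moebius_disk[OF assms])
  then have "disk_moebius (moebius_inv s) (disk_moebius s z) = cnj w * mob (w * a) (w * mob a z)"
    using assms by (simp add: Pair moebius_inv_def disk_moebius_apply)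
  also have "mob (w * a) (w * mob a z) = w * mob a (mob a z)"
  proof -
    have "cnj (w * a) * (w * mob a z) = (cnj w * w) * (cnj a * mob a z)" by simp
    then show ?thesis by (simp add: mob_def[of _ "w * _"] mob_def[of a "mob a z"] ww right_diff_distrib)
  qed
  finally show ?thesis using mob_mob[OF p(1) assms(2)] ww by (simp flip: mult.assoc)
qed

lemma moebius_inv_inv:
  assumes "s \<in> moebius_params"
  shows "moebius_inv (moebius_inv s) = s"
proof (cases s)
  case (Pair a w)
  have "cnj w * (w * a) = (w * cnj w) * a" by simp
  also have "\<dots> = a" using unit_cnj assms moebius_paramsD by (simp add: Pair)
  finally show ?thesis by (simp add: moebius_inv_def Pair)
qed

lemma moebius_apply_inv:
  "s \<in> moebius_params \<Longrightarrow> z \<in> unit_disk \<Longrightarrow> disk_moebius s (disk_moebius (moebius_inv s) z) = z"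
  using moebius_inv_apply[OF moebius_inv_params, of s z] moebius_inv_inv[of s] by metis

lemma bij_betw_disk_moebius:
  assumes "s \<in> moebius_params"
  shows "bij_betw (disk_moebius s) unit_disk unit_disk"
proof (rule bij_betw_byWitness)
  show "\<forall>a\<in>unit_disk. disk_moebius (moebius_inv s) (disk_moebius s a) = a"
    using moebius_inv_apply[OF assms] by blast
  show "\<forall>a\<in>unit_disk. disk_moebius s (disk_moebius (moebius_inv s) a) = a"
    using moebius_apply_inv[OF assms] by blast
  show "disk_moebius s ` unit_disk \<subseteq> unit_disk"
    using disk_moebius_disk[OF assms] by blast
  show "disk_moebius (moebius_inv s) ` unit_disk \<subseteq> unit_disk"
    using disk_moebius_disk[OF moebius_inv_params[OF assms]] by blast
qed

lemma inv_into_disk_moebius: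
  assumes "s \<in> moebius_params" "z \<in> unit_disk"
  shows "inv_into unit_disk (disk_moebius s) z = disk_moebius (moebius_inv s) z"
proof (rule inv_into_f_eq)
  show "inj_on (disk_moebius s) unit_disk" using bij_betw_disk_moebius[OF assms(1)] by (simp add: bij_betw_def)
  show "disk_moebius (moebius_inv s) z \<in> unit_disk"
    by (rule disk_moebius_disk[OF moebius_inv_params[OF assms(1)] assms(2)])
  show "disk_moebius s (disk_moebius (moebius_inv s) z) = z" by (rule moebius_apply_inv[OF assms])
qed

lemma carrier_moebius_group: "carrier moebius_group = disk_moebius ` moebius_params"
  by (simp add: moebius_group_def)

lemma compose_disk_moebius:
  assumes "s \<in> moebius_params" "t \<in> moebius_params"
  shows "disk_moebius s \<otimes>\<^bsub>moebius_group\<^esub> disk_moebius t = disk_moebius (moebius_mult (s, t))"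
proof -
  have "compose unit_disk (disk_moebius s) (disk_moebius t) = disk_moebius (moebius_mult (s, t))"
    by (rule extensionalityI[OF compose_extensional disk_moebius_extensional])
      (simp add: compose_eq moebius_mult_apply assms del: mem_ball)
  then show ?thesis by (simp add: moebius_group_def)
qed

text \<open>The factor is -1 because \<open>mob 0\<close> is z |-> -z.\<close>

lemma disk_moebius_one: "disk_moebius (0, -1) = \<one>\<^bsub>moebius_group\<^esub>"
  by (auto simp: moebius_group_def fun_eq_iff disk_moebius_def)

lemma moebius_inv_compose:
  assumes "s \<in> moebius_params"
  shows "disk_moebius (moebius_inv s) \<otimes>\<^bsub>moebius_group\<^esub> disk_moebius s = \<one>\<^bsub>moebius_group\<^esub>"
proof -
  have "compose unit_disk (disk_moebius (moebius_inv s)) (disk_moebius s) = (\<lambda>z\<in>unit_disk. z)"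
    by (rule extensionalityI[OF compose_extensional restrict_extensional])
      (simp add: compose_eq moebius_inv_apply assms del: mem_ball)
  then show ?thesis by (simp add: moebius_group_def)
qed

lemma group_moebius_group: "group moebius_group"
proof (rule groupI)
  fix x y z assume xyz: "x \<in> carrier moebius_group" "y \<in> carrier moebius_group" "z \<in> carrier moebius_group"
  show "x \<otimes>\<^bsub>moebius_group\<^esub> y \<in> carrier moebius_group"
    using xyz by (auto simp: carrier_moebius_group compose_disk_moebius moebius_mult_params)
  have "z \<in> unit_disk \<rightarrow> unit_disk" using xyz disk_moebius_disk by (auto simp: carrier_moebius_group simp del: mem_ball)
  then show "x \<otimes>\<^bsub>moebius_group\<^esub> y \<otimes>\<^bsub>moebius_group\<^esub> z = x \<otimes>\<^bsub>moebius_group\<^esub> (y \<otimes>\<^bsub>moebius_group\<^esub> z)"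
    using compose_assoc[of z unit_disk unit_disk x y] by (simp add: moebius_group_def)
next
  show "\<one>\<^bsub>moebius_group\<^esub> \<in> carrier moebius_group"
    unfolding disk_moebius_one[symmetric] carrier_moebius_group by (rule imageI) (simp add: moebius_params_def)
next
  fix x assume x: "x \<in> carrier moebius_group"
  then obtain s where s: "s \<in> moebius_params" "x = disk_moebius s" by (auto simp: carrier_moebius_group)
  have "x \<in> unit_disk \<rightarrow> unit_disk" using s disk_moebius_disk by (auto simp del: mem_ball)
  then have "compose unit_disk (\<lambda>z\<in>unit_disk. z) x = x"
    using disk_moebius_extensional[of s] s(2) by (intro Id_compose) auto
  then show "\<one>\<^bsub>moebius_group\<^esub> \<otimes>\<^bsub>moebius_group\<^esub> x = x" by (simp add: moebius_group_def)
  show "\<exists>y\<in>carrier moebius_group. y \<otimes>\<^bsub>moebius_group\<^esub> x = \<one>\<^bsub>moebius_group\<^esub>"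
    using moebius_inv_compose[OF s(1)] moebius_inv_params[OF s(1)] by (auto simp: carrier_moebius_group s(2))
qed

lemma inv_disk_moebius:
  "s \<in> moebius_params \<Longrightarrow> inv\<^bsub>moebius_group\<^esub> (disk_moebius s) = disk_moebius (moebius_inv s)"
  by (rule group.inv_equality[OF group_moebius_group moebius_inv_compose])
    (auto simp: carrier_moebius_group moebius_inv_params)

lemma inj_disk_moebius: "inj_on disk_moebius moebius_params"
proof (rule inj_onI)
  fix s t assume s: "s \<in> moebius_params" and t: "t \<in> moebius_params" and eq: "disk_moebius s = disk_moebius t"
  obtain a w b v where st: "s = (a, w)" "t = (b, v)" by (cases s; cases t)
  have p: "a \<in> unit_disk" "cmod w = 1" "b \<in> unit_disk" "cmod v = 1"
    using s t st moebius_paramsD by auto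
  have *: "w * mob a z = v * mob b z" if "z \<in> unit_disk" for z
    using fun_cong[OF eq, of z] that by (simp add: st disk_moebius_apply)
  have "mob b a = 0" using *[OF p(1)] p(4) by auto
  then have ab: "a = b" using mob_mob[OF p(3,1)] by simp
  have "w * mob a z \<noteq> 0 \<Longrightarrow> w = v" if "z \<in> unit_disk" for z using *[OF that] ab by auto
  moreover have "\<exists>z\<in>unit_disk. w * mob a z \<noteq> 0"
  \<comment> \<open>The parameter \<open>a\<close> is already determined as the zero. To compare the
    factors any point with nonzero value will do; here \<open>mob a\<close> takes the value
    1/2.\<close>
  proof (rule bexI[of _ "mob a (1/2)"])
    show "w * mob a (mob a (1/2)) \<noteq> 0" using mob_mob[OF p(1), of "1/2"] p(2) by auto
    show "mob a (1/2) \<in> unit_disk" using p(1) by (intro mob_disk) auto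
  qed
  ultimately show "s = t" using st ab by auto
qed

section \<open>The Lie group structure on the parameters\<close>

lemma bij_betw_moebius_params: "bij_betw disk_moebius moebius_params (carrier moebius_group)"
  by (simp add: bij_betw_def inj_disk_moebius carrier_moebius_group)

text \<open>The disk factor is open and stays as it is. On the circle factor the logarithm,
  normalized at \<open>w0\<close>, maps the rotated slit plane to the strip \<open>V\<close> and the
  circle to the imaginary axis.\<close>

lemma submanifold_moebius_params: "submanifold moebius_params"
  unfolding submanifold_def
proof
  fix p assume p: "p \<in> moebius_params"
  obtain a0 w0 where p0: "p = (a0, w0)" by (cases p)
  then have a0: "a0 \<in> unit_disk" and w0: "cmod w0 = 1" using p moebius_paramsD by auto
  have w0': "w0 \<noteq> 0" using w0 by auto
  define U where "U = unit_disk \<times> {w. w / w0 \<in> - \<real>\<^sub>\<le>\<^sub>0}"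
  define V where "V = unit_disk \<times> {s. \<bar>Im s\<bar> < pi}"
  define \<Phi> where "\<Phi> = (\<lambda>x :: complex \<times> complex. (fst x, Ln (snd x / w0)))"
  define \<Psi> where "\<Psi> = (\<lambda>x :: complex \<times> complex. (fst x, w0 * exp (snd x)))"
  define F where "F = range (\<lambda>x :: complex \<times> complex. (fst x, \<i> * complex_of_real (Im (snd x))))"
  have "open {w. w / w0 \<in> - \<real>\<^sub>\<le>\<^sub>0}"
    using open_Compl[OF closed_nonpos_Reals_complex] w0'
    by (intro continuous_open_vimage[of _ "\<lambda>w. w / w0", unfolded vimage_def]) (auto intro!: continuous_intros)
  then have oU: "open U" unfolding U_def by (intro open_Times) auto
  have "open {s. \<bar>Im s\<bar> < pi}" by (intro open_Collect_less continuous_intros)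
  then have oV: "open V" unfolding V_def by (intro open_Times) auto
  have \<Phi>: "fsmooth U \<Phi>" unfolding \<Phi>_def
  proof (intro fsmooth_Pair)
    show "fsmooth U fst" by (rule fsmooth_bounded_linear[OF oU bounded_linear_fst])
    have "fsmooth U (\<lambda>x. snd x / w0)"
      by (intro fsmooth_divide fsmooth_const oU fsmooth_bounded_linear[OF oU bounded_linear_snd] w0')
    then show "fsmooth U (\<lambda>x. Ln (snd x / w0))"
      by (intro fsmooth_holomorphic[of Ln "- \<real>\<^sub>\<le>\<^sub>0"]) (auto simp: U_def intro!: holomorphic_intros open_Compl)
  qed
  have \<Psi>: "fsmooth V \<Psi>" unfolding \<Psi>_def
  proof (intro fsmooth_Pair fsmooth_mult fsmooth_const oV)
    show "fsmooth V fst" by (rule fsmooth_bounded_linear[OF oV bounded_linear_fst])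
    show "fsmooth V (\<lambda>x. exp (snd x))"
      by (rule fsmooth_holomorphic[of exp UNIV]) (auto intro!: holomorphic_intros fsmooth_bounded_linear[OF oV bounded_linear_snd])
  qed
  have UV: "\<Phi> x \<in> V \<and> \<Psi> (\<Phi> x) = x" if "x \<in> U" for x
  proof -
    have nz: "snd x / w0 \<notin> \<real>\<^sub>\<le>\<^sub>0" and f: "fst x \<in> unit_disk" using that by (auto simp: U_def)
    then have nz0: "snd x / w0 \<noteq> 0" by auto
    have "\<bar>Im (Ln (snd x / w0))\<bar> < pi"
      using nz nz0 mpi_less_Im_Ln[OF nz0] Im_Ln_less_pi[of "snd x / w0"]
      by (smt (verit) Im_Ln_le_pi Im_Ln_eq_pi complex_nonpos_Reals_iff less_imp_le)
    moreover have "w0 * exp (Ln (snd x / w0)) = snd x" using nz0 w0' by (subst exp_Ln) auto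
    ultimately show ?thesis using f by (simp add: V_def \<Phi>_def \<Psi>_def)
  qed
  have VU: "\<Psi> y \<in> U \<and> \<Phi> (\<Psi> y) = y" if "y \<in> V" for y
  proof -
    have im: "\<bar>Im (snd y)\<bar> < pi" and f: "fst y \<in> unit_disk" using that by (auto simp: V_def)
    have L: "Ln (exp (snd y)) = snd y" using im by (intro Ln_exp) auto
    have "exp (snd y) \<notin> \<real>\<^sub>\<le>\<^sub>0"
    proof
      assume "exp (snd y) \<in> \<real>\<^sub>\<le>\<^sub>0"
      then have "Re (exp (snd y)) \<le> 0" "Im (exp (snd y)) = 0" by (simp_all add: complex_nonpos_Reals_iff)
      moreover have "Re (exp (snd y)) \<noteq> 0"
        using calculation(2) exp_not_eq_zero[of "snd y"] complex_eqI[of "exp (snd y)" 0] by (metis zero_complex.simps)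
      ultimately have "Im (Ln (exp (snd y))) = pi" using Im_Ln_eq_pi[OF exp_not_eq_zero] by (metis less_eq_real_def)
      then show False using im L by simp
    qed
    then show ?thesis using f L w0' by (auto simp: U_def \<Phi>_def \<Psi>_def)
  qed
  have "homeomorphism U V \<Phi> \<Psi>"
    using UV VU fsmooth_continuous_on[OF \<Phi>] fsmooth_continuous_on[OF \<Psi>] by (intro homeomorphismI) auto
  then have diffeo: "smooth_diffeomorphism U V \<Phi> \<Psi>"
    using \<Phi> \<Psi> by (simp add: smooth_diffeomorphism_def fsmooth_imp_smooth_on)
  have "p \<in> U" using a0 w0' by (simp add: p0 U_def)
  moreover have "complemented_subspace F"
    unfolding complemented_subspace_def F_def
    by (intro exI[of _ "\<lambda>x. (fst x, \<i> * complex_of_real (Im (snd x)))"] conjI bounded_linear_Pair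
        bounded_linear_fst bounded_linear_const_mult bounded_linear_compose[OF bounded_linear_of_real]
        bounded_linear_compose[OF bounded_linear_Im] bounded_linear_snd) auto
  moreover have "\<Phi> ` (U \<inter> moebius_params) = V \<inter> F"
  proof (intro equalityI subsetI)
    fix y assume "y \<in> \<Phi> ` (U \<inter> moebius_params)"
    then obtain x where x: "x \<in> U" "x \<in> moebius_params" "y = \<Phi> x" by blast
    then have n: "cmod (snd x / w0) = 1" using w0 by (auto simp: moebius_params_def norm_divide)
    then have "Re (Ln (snd x / w0)) = 0" by (subst Re_Ln) auto
    then have "y \<in> F" unfolding F_def x(3) \<Phi>_def
      by (intro range_eqI[of _ _ "(fst x, Ln (snd x / w0))"]) (simp add: prod_eq_iff complex_eq_iff)
    then show "y \<in> V \<inter> F" using UV x by auto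
  next
    fix y assume y: "y \<in> V \<inter> F"
    then have "Re (snd y) = 0" by (auto simp: F_def)
    then have "\<Psi> y \<in> moebius_params" using y w0 by (auto simp: \<Psi>_def moebius_params_def V_def norm_mult)
    then show "y \<in> \<Phi> ` (U \<inter> moebius_params)" using y VU by (metis IntD1 IntI image_eqI)
  qed
  ultimately show "\<exists>U V \<Phi> \<Psi> F. p \<in> U \<and> smooth_diffeomorphism U V \<Phi> \<Psi> \<and>
      complemented_subspace (F :: (complex \<times> complex) set) \<and> \<Phi> ` (U \<inter> moebius_params) = V \<inter> F"
    using diffeo by blast
qed

lemma fsmooth_mob:
  assumes "fsmooth U f" "fsmooth U g" "\<And>x. x \<in> U \<Longrightarrow> 1 - cnj (f x) * g x \<noteq> 0"
  shows "fsmooth U (\<lambda>x. mob (f x) (g x))"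
  unfolding mob_def using assms
  by (intro fsmooth_divide fsmooth_diff fsmooth_mult fsmooth_cnj fsmooth_const fsmooth_open[OF assms(1)]) auto

lemma lie_group_moebius_group: "lie_group moebius_group moebius_params disk_moebius"
  unfolding lie_group_def
proof (intro conjI group_moebius_group submanifold_moebius_params bij_betw_moebius_params)
  have inv: "inv_into moebius_params disk_moebius (disk_moebius s) = s" if "s \<in> moebius_params" for s
    using inj_disk_moebius that by (rule inv_into_f_f)
  define U :: "((complex \<times> complex) \<times> complex \<times> complex) set"
    where "U = {x. 1 - cnj (fst (snd x)) * (cnj (snd (snd x)) * fst (fst x)) \<in> - {0}}"
  have id: "fsmooth UNIV (\<lambda>x :: (complex \<times> complex) \<times> complex \<times> complex. x)" by (simp add: fsmooth_ident)
  have "open {x \<in> UNIV. 1 - cnj (fst (snd x)) * (cnj (snd (snd x)) * fst (fst x :: complex \<times> complex)) \<in> - {0}}"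
    by (rule fsmooth_preimage) (intro fsmooth_diff fsmooth_mult fsmooth_cnj fsmooth_fst fsmooth_snd fsmooth_const id, auto)
  then have U: "open U" by (simp add: U_def)
  have id: "fsmooth U (\<lambda>x. x)" using U by (rule fsmooth_ident)
  have "fsmooth U moebius_mult"
  proof -
    have eq: "moebius_mult = (\<lambda>x. (mob (fst (snd x)) (cnj (snd (snd x)) * fst (fst x)),
      - (snd (fst x) * snd (snd x) * (1 - cnj (fst (snd x)) * (cnj (snd (snd x)) * fst (fst x)))
        / (1 - fst (snd x) * (snd (snd x) * cnj (fst (fst x)))))))"
      by (simp add: moebius_mult_def fun_eq_iff)
    show ?thesis unfolding eq
    proof (intro fsmooth_Pair fsmooth_mob fsmooth_uminus fsmooth_divide fsmooth_diff fsmooth_mult fsmooth_cnj fsmooth_fst fsmooth_snd fsmooth_const id U)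
      fix x assume x: "x \<in> U"
      then show "1 - cnj (fst (snd x)) * (cnj (snd (snd x)) * fst (fst x)) \<noteq> 0" by (simp add: U_def)
      \<comment> \<open>The denominator in the second component is the conjugate of the one in the
        first.\<close>
      then have "cnj (1 - cnj (fst (snd x)) * (cnj (snd (snd x)) * fst (fst x))) \<noteq> 0" by (metis complex_cnj_zero_iff)
      then show "1 - fst (snd x) * (snd (snd x) * cnj (fst (fst x))) \<noteq> 0" by simp
    qed
  qed
  moreover have "moebius_params \<times> moebius_params \<subseteq> U"
  proof
    fix x assume "x \<in> moebius_params \<times> moebius_params"
    then obtain a w b v where x: "x = ((a, w), (b, v))" and p: "(a, w) \<in> moebius_params" "(b, v) \<in> moebius_params"
      by auto
    then have p: "a \<in> unit_disk" "b \<in> unit_disk" "cmod v = 1" using moebius_paramsD by auto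
    have "cnj v * a \<in> unit_disk" using p by (intro unit_mult_disk) auto
    then show "x \<in> U" using mob_denom_nz[OF p(2)] by (simp add: U_def x)
  qed
  ultimately show "smooth_map_on (moebius_params \<times> moebius_params)
    (\<lambda>(s, t). inv_into moebius_params disk_moebius (disk_moebius s \<otimes>\<^bsub>moebius_group\<^esub> disk_moebius t))"
    by (rule smooth_map_onI) (auto simp: compose_disk_moebius inv moebius_mult_params)
  have "fsmooth UNIV (\<lambda>x :: complex \<times> complex. x)" by (simp add: fsmooth_ident)
  then have "fsmooth UNIV moebius_inv"
    unfolding moebius_inv_def case_prod_unfold by (intro fsmooth_Pair fsmooth_mult fsmooth_cnj fsmooth_fst fsmooth_snd)
  then show "smooth_map_on moebius_params (\<lambda>s. inv_into moebius_params disk_moebius (inv\<^bsub>moebius_group\<^esub> disk_moebius s))"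
    by (rule smooth_map_onI) (auto simp: inv_disk_moebius inv moebius_inv_params)
qed

section \<open>Moebius invariant reproducing kernel spaces\<close>

locale moebius_rkhs =
  fixes ev :: "'h::complex_hilbert_space \<Rightarrow> complex \<Rightarrow> complex"
    and k :: "complex \<Rightarrow> 'h"
  assumes rkhs: "analytic_rkhs_on_disk ev k"
    and infinite_dim: "\<not> (\<exists>B :: 'h set. finite B \<and> complex_hilbert.span B = UNIV)"
    and kernel_nonzero: "\<forall>a\<in>unit_disk. k a \<noteq> 0"
    and kernels_independent: "\<forall>a\<in>unit_disk. \<forall>b\<in>unit_disk. a \<noteq> b \<longrightarrow>
      k a \<noteq> k b \<and> complex_hilbert.independent {k a, k b}"
    and composition: "\<forall>\<phi>\<in>carrier moebius_group. \<forall>f :: 'h. \<exists>g :: 'h. \<forall>z\<in>unit_disk.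
      ev g z = ev f (inv_into unit_disk \<phi> z)"
    and boundary: "\<forall>(w :: nat \<Rightarrow> complex) \<zeta>. (\<forall>n. w n \<in> unit_disk) \<and> \<zeta> \<in> sphere 0 1 \<and> w \<longlonglongrightarrow> \<zeta> \<longrightarrow>
      (\<forall>z\<in>unit_disk. (\<lambda>n. ev (k (w n)) z / complex_of_real (norm (k (w n)))) \<longlonglongrightarrow> 0)"
begin

lemma ev_eq: "w \<in> unit_disk \<Longrightarrow> ev f w = cinner f (k w)"
  using rkhs by (simp add: analytic_rkhs_on_disk_def)

lemma ev_holomorphic: "ev f holomorphic_on unit_disk"
  using rkhs by (simp add: analytic_rkhs_on_disk_def)

lemma ev_ext: "(\<And>z. z \<in> unit_disk \<Longrightarrow> cinner f (k z) = cinner g (k z)) \<Longrightarrow> f = g"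
  using rkhs ev_eq unfolding analytic_rkhs_on_disk_def by metis

section \<open>Smooth dependence of the kernels and of the projections\<close>

lemma fsmooth_kernel:
  assumes "fsmooth U u" "\<And>x. x \<in> U \<Longrightarrow> u x \<in> unit_disk"
  shows "fsmooth U (\<lambda>x. k (u x))"
proof -
  have "(\<lambda>z. cinner (k (cnj z)) f) holomorphic_on unit_disk" for f
  proof -
    \<comment> \<open>Conjugating the argument turns the antiholomorphic \<open>k\<close> into a
      weakly holomorphic map, since \<open>cinner (k (cnj z)) f\<close> is the conjugate of
      \<open>ev f (cnj z)\<close>.\<close>
    have "(cnj \<circ> ev f \<circ> cnj) holomorphic_on unit_disk"
      by (rule holomorphic_on_compose_cnj_cnj) (auto intro!: holomorphic_on_subset[OF ev_holomorphic])
    then show ?thesis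
      by (rule holomorphic_transform) (simp add: ev_eq cinner_commute[of "k _" f])
  qed
  moreover have "fsmooth U (\<lambda>x. cnj (u x))" by (rule fsmooth_linear_comp[OF bounded_linear_cnj assms(1)])
  ultimately have "fsmooth U (\<lambda>x. k (cnj (cnj (u x))))"
    by (rule fsmooth_weakly_holomorphic[OF open_ball]) (use assms(2) in auto)
  then show ?thesis by simp
qed

text \<open>The squared norm is written through the inner product, so that its smoothness follows
  from bilinearity.\<close>

definition pt_proj :: "complex \<Rightarrow> 'h bop"
  where "pt_proj a = 1 - inverse (Re (cinner (k a) (k a))) *\<^sub>R rank_one (k a) (k a)"

lemma inverse_norm_kernel: "a \<in> unit_disk \<Longrightarrow>
  complex_of_real (inverse (Re (cinner (k a) (k a)))) * cinner (k a) (k a) = 1"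
  using kernel_nonzero by (simp add: cinner_self del: of_real_power flip: of_real_mult)

lemma pt_proj_apply: "bop_apply (pt_proj a) x =
    x - (complex_of_real (inverse (Re (cinner (k a) (k a)))) * cinner x (k a)) *\<^sub>C k a"
  by (simp add: pt_proj_def scaleR_eq_scaleC scaleC_scaleC)

lemma pt_proj_fix: "cinner x (k a) = 0 \<Longrightarrow> bop_apply (pt_proj a) x = x"
  by (simp add: pt_proj_apply)

lemma cinner_pt_proj: "a \<in> unit_disk \<Longrightarrow> cinner (bop_apply (pt_proj a) x) (k a) = 0"
  using inverse_norm_kernel[of a] by (simp add: pt_proj_apply cinner_simps mult_ac)

lemma pt_proj_kernel: "a \<in> unit_disk \<Longrightarrow> bop_apply (pt_proj a) (k a) = 0"
  by (simp only: pt_proj_apply inverse_norm_kernel scaleC_one) simp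

lemma pt_proj_Grassmannian: "a \<in> unit_disk \<Longrightarrow> pt_proj a \<in> Grassmannian"
  unfolding Grassmannian_iff
  by (auto intro!: bop_eqI simp: pt_proj_fix cinner_pt_proj) (simp add: pt_proj_def adj_rank_one)

lemma fsmooth_pt_proj:
  assumes "fsmooth U u" "\<And>x. x \<in> U \<Longrightarrow> u x \<in> unit_disk"
  shows "fsmooth U (\<lambda>x. pt_proj (u x))"
proof -
  have k: "fsmooth U (\<lambda>x. k (u x))" using assms by (rule fsmooth_kernel)
  have "fsmooth U (\<lambda>x. inverse (Re (cinner (k (u x)) (k (u x)))))"
  proof (rule fsmooth_inverse)
    show "fsmooth U (\<lambda>x. Re (cinner (k (u x)) (k (u x))))"
      by (rule fsmooth_linear_comp[OF bounded_linear_Re fsmooth_bilinear[OF bounded_bilinear_cinner k k]])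
    show "Re (cinner (k (u x)) (k (u x))) \<noteq> 0" if "x \<in> U" for x
      using kernel_nonzero assms(2)[OF that] by (simp flip: norm_eq_Re_cinner)
  qed
  then have "fsmooth U (\<lambda>x. inverse (Re (cinner (k (u x)) (k (u x)))) *\<^sub>R rank_one (k (u x)) (k (u x)))"
    by (rule fsmooth_bilinear[OF bounded_bilinear_scaleR _ fsmooth_bilinear[OF bounded_bilinear_rank_one k k]])
  then show ?thesis unfolding pt_proj_def
    by (rule fsmooth_diff[OF fsmooth_const[OF fsmooth_open[OF assms(1)]]])
qed

lemma proj_onto_vanishing_space:
  assumes a: "a \<in> unit_disk"
  shows "proj_onto (vanishing_space ev a) = pt_proj a"
  unfolding proj_onto_def
proof (rule the_equality)
  have range: "range (bop_apply (pt_proj a)) = vanishing_space ev a"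
  proof (intro equalityI subsetI)
    fix x assume "x \<in> vanishing_space ev a"
    then have "x = bop_apply (pt_proj a) x" by (simp add: vanishing_space_def ev_eq[OF a] pt_proj_fix)
    then show "x \<in> range (bop_apply (pt_proj a))" by (rule range_eqI)
  qed (auto simp: vanishing_space_def ev_eq[OF a] cinner_pt_proj[OF a])
  then show "pt_proj a \<in> Grassmannian \<and> range (bop_apply (pt_proj a)) = vanishing_space ev a"
    using pt_proj_Grassmannian[OF a] by simp
  fix R assume R: "R \<in> Grassmannian \<and> range (bop_apply R) = vanishing_space ev a"
  have *: "S * T = T" if S: "S \<in> Grassmannian" and ST: "range (bop_apply S) = range (bop_apply T)" for S T :: "'h bop"
  proof (rule bop_eqI)
    fix x
    obtain y where "bop_apply T x = bop_apply S y" using ST by (metis rangeE rangeI)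
    moreover have "bop_apply S (bop_apply S y) = bop_apply S y"
      using S by (simp add: Grassmannian_def)
    ultimately show "bop_apply (S * T) x = bop_apply T x" by simp
  qed
  \<comment> \<open>Equal ranges make each projection absorb the other on its right; taking adjoints
    in this identity and comparing with the next one gives equality.\<close>
  have "R * pt_proj a = pt_proj a" using * R range by metis
  moreover have "pt_proj a * R = R" using * pt_proj_Grassmannian[OF a] R range by metis
  ultimately show "R = pt_proj a"
    using R pt_proj_Grassmannian[OF a] adj_simps(4)[of "R" "pt_proj a"] by (simp add: Grassmannian_iff)
qed

lemma point_Grassmannian_eq: "point_Grassmannian ev = pt_proj ` unit_disk"
  unfolding point_Grassmannian_def by (rule image_cong) (simp_all add: proj_onto_vanishing_space)

lemma inj_pt_proj: "inj_on pt_proj unit_disk"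
proof (rule inj_onI)
  fix a b assume a: "a \<in> unit_disk" and b: "b \<in> unit_disk" and eq: "pt_proj a = pt_proj b"
  show "a = b"
  proof (rule ccontr)
    assume "a \<noteq> b"
    then have *: "k a \<noteq> k b" "complex_hilbert.independent {k a, k b}"
      using kernels_independent a b by auto
    have "bop_apply (pt_proj b) (k a) = 0" using pt_proj_kernel[OF a] eq by simp
    then have "k a = (complex_of_real (inverse (Re (cinner (k b) (k b)))) * cinner (k a) (k b)) *\<^sub>C k b"
      by (simp add: pt_proj_apply)
    then have "k a \<in> complex_hilbert.span {k b}"
      by (metis complex_hilbert.span_base complex_hilbert.span_scale singletonI)
    moreover have "{k a, k b} - {k a} = {k b}" using *(1) by auto
    ultimately have "complex_hilbert.dependent {k a, k b}"
      unfolding complex_hilbert.dependent_def by (metis insertI1)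
    then show False using *(2) by simp
  qed
qed

text \<open>Toward the boundary \<open>pt_proj\<close> converges strongly, but never in norm, to the identity.\<close>

lemma pt_proj_limit:
  assumes w: "\<And>n. w n \<in> unit_disk" and lim: "(\<lambda>n. pt_proj (w n)) \<longlonglongrightarrow> P" and P: "P \<in> Grassmannian"
  shows "\<exists>b\<in>unit_disk. \<exists>r. strict_mono r \<and> (w \<circ> r) \<longlonglongrightarrow> b \<and> P = pt_proj b"
proof -
  have "\<forall>n. w n \<in> cball 0 1" using w by (auto intro: less_imp_le)
  then obtain b r where r: "b \<in> cball 0 1" "strict_mono r" "(w \<circ> r) \<longlonglongrightarrow> b"
    using compact_cball[of "0 :: complex" 1] unfolding compact_def by blast
  have lim': "(\<lambda>n. pt_proj (w (r n))) \<longlonglongrightarrow> P"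
    using LIMSEQ_subseq_LIMSEQ[OF lim r(2)] by (simp add: o_def)
  show ?thesis
  proof (cases "b \<in> unit_disk")
    case True
    have "continuous_on unit_disk pt_proj"
      by (rule fsmooth_continuous_on[OF fsmooth_pt_proj[OF fsmooth_ident[OF open_ball]]])
    then have "isCont pt_proj b" using True by (simp add: continuous_on_eq_continuous_at)
    then have "(\<lambda>n. pt_proj (w (r n))) \<longlonglongrightarrow> pt_proj b"
      using r(3) isCont_tendsto_compose[of b pt_proj] by (simp add: o_def)
    then have "P = pt_proj b" using lim' LIMSEQ_unique by blast
    then show ?thesis using True r by blast
  next
    case False
    then have "b \<in> sphere 0 1" using r(1) by auto
    then have bd: "(\<lambda>n. ev (k (w (r n))) z / complex_of_real (norm (k (w (r n))))) \<longlonglongrightarrow> 0" if "z \<in> unit_disk" for z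
      using boundary[rule_format, of "w \<circ> r" b z] w r(3) that by (simp add: o_def)
    have Pk: "bop_apply P (k z) = k z" if z: "z \<in> unit_disk" for z
    proof -
      have "bounded_linear (\<lambda>T. bop_apply T (k z))"
        by (rule bounded_linear_intro[of _ "norm (k z)"]) (auto simp: norm_bop_apply_le)
      then have 1: "(\<lambda>n. bop_apply (pt_proj (w (r n))) (k z)) \<longlonglongrightarrow> bop_apply P (k z)"
        using lim' by (rule bounded_linear.tendsto)
      have "(\<lambda>n. k z - bop_apply (pt_proj (w (r n))) (k z)) \<longlonglongrightarrow> 0"
      proof (rule Lim_null_comparison[OF _ tendsto_norm_zero[OF bd[OF z]]])
        have "norm (k z - bop_apply (pt_proj c) (k z)) \<le> norm (ev (k c) z / complex_of_real (norm (k c)))"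
          if c: "c \<in> unit_disk" for c
        proof -
          define n where "n = norm (k c)"
          have n: "n > 0" using kernel_nonzero c by (simp add: n_def)
          \<comment> \<open>The rank-one part applied to \<open>k z\<close> has exactly the norm of
            the normalized kernel at \<open>z\<close>, the quantity in the boundary
            hypothesis.\<close>
          have "norm (k z - bop_apply (pt_proj c) (k z)) = inverse (n\<^sup>2) * cmod (cinner (k z) (k c)) * n"
            by (simp add: pt_proj_apply norm_scaleC norm_mult norm_inverse norm_power n_def flip: norm_eq_Re_cinner)
          also have "\<dots> = cmod (cinner (k c) (k z)) / n"
            using n by (subst cinner_commute) (simp add: field_simps power2_eq_square)
          finally show ?thesis by (simp add: ev_eq[OF z] norm_divide n_def)
        qed
        then show "\<forall>\<^sub>F n in sequentially. norm (k z - bop_apply (pt_proj (w (r n))) (k z))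
            \<le> norm (ev (k (w (r n))) z / complex_of_real (norm (k (w (r n)))))"
          using w by (intro always_eventually) blast
      qed
      from tendsto_diff[OF tendsto_const[of "k z"] this]
      have "(\<lambda>n. bop_apply (pt_proj (w (r n))) (k z)) \<longlonglongrightarrow> k z" by simp
      then show ?thesis using 1 LIMSEQ_unique by blast
    qed
    have "P = 1"
    proof (rule bop_eqI)
      fix f
      \<comment> \<open>\<open>P\<close> fixes every kernel and is self-adjoint, so
        \<open>P f\<close> and \<open>f\<close> take the same values on the disk.\<close>
      have "cinner (bop_apply P f) (k z) = cinner f (k z)" if "z \<in> unit_disk" for z
        using P Pk[OF that] by (simp add: Grassmannian_def)
      then show "bop_apply P f = bop_apply 1 f" by (intro ev_ext) auto
    qed
    then have "(\<lambda>n. pt_proj (w (r n)) - 1) \<longlonglongrightarrow> 0" using lim' by (simp add: LIM_zero)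
    then have "(\<lambda>n. norm (pt_proj (w (r n)) - 1)) \<longlonglongrightarrow> 0" by (rule tendsto_norm_zero)
    \<comment> \<open>\<open>pt_proj c\<close> annihilates the nonzero vector \<open>k c\<close>, so
      its difference from the identity has norm at least one.\<close>
    moreover have "1 \<le> norm (pt_proj c - 1)" if c: "c \<in> unit_disk" for c
    proof -
      have "norm (k c) = norm (bop_apply (pt_proj c - 1) (k c))" by (simp add: pt_proj_kernel[OF c])
      also have "\<dots> \<le> norm (pt_proj c - 1) * norm (k c)" by (rule norm_bop_apply_le)
      finally show ?thesis using kernel_nonzero c by simp
    qed
    ultimately have "1 \<le> (0 :: real)" using w by (intro LIMSEQ_le_const[of _ 0 1]) auto
    then show ?thesis by simp
  qed
qed

section \<open>Closedness and embeddedness\<close>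

lemma closedin_point_Grassmannian: "closedin (top_of_set Grassmannian) (point_Grassmannian ev)"
proof -
  have "point_Grassmannian ev \<subseteq> Grassmannian"
    using pt_proj_Grassmannian by (auto simp: point_Grassmannian_eq)
  moreover have "P \<in> point_Grassmannian ev"
    if x: "\<forall>n. X n \<in> point_Grassmannian ev" "X \<longlonglongrightarrow> P" "P \<in> Grassmannian" for X P
  proof -
    have "\<forall>n. \<exists>a\<in>unit_disk. X n = pt_proj a" using x(1) by (auto simp: point_Grassmannian_eq)
    then obtain w where w: "\<And>n. w n \<in> unit_disk" "\<And>n. X n = pt_proj (w n)" by metis
    then have "(\<lambda>n. pt_proj (w n)) \<longlonglongrightarrow> P" using x(2) by (simp add: LIMSEQ_def)
    then show ?thesis using pt_proj_limit[of w P, OF w(1) _ x(3)] by (auto simp: point_Grassmannian_eq)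
  qed
  ultimately show ?thesis
    unfolding closedin_limpt islimpt_sequential by (metis Diff_iff)
qed

text \<open>Continuity of the inverse of \<open>pt_proj\<close>. A sequence violating it would, by
  \<open>pt_proj_limit\<close> and injectivity, have a subsequence converging to \<open>a\<close>
  while avoiding the neighbourhood \<open>A\<close>.\<close>

lemma pt_proj_nbhd:
  assumes a: "a \<in> A" "open A" "A \<subseteq> unit_disk"
  shows "\<exists>N. open N \<and> pt_proj a \<in> N \<and> (\<forall>b\<in>unit_disk. pt_proj b \<in> N \<longrightarrow> b \<in> A)"
proof (rule ccontr)
  assume neg: "\<not> ?thesis"
  have "\<exists>b\<in>unit_disk. pt_proj b \<in> ball (pt_proj a) (1 / real (Suc n)) \<and> b \<notin> A" for n
  proof (rule ccontr)
    assume "\<not> ?thesis"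
    then show False using neg by (metis open_ball centre_in_ball zero_less_divide_1_iff of_nat_0_less_iff zero_less_Suc)
  qed
  then obtain w where w: "\<And>n. w n \<in> unit_disk" "\<And>n. w n \<notin> A"
    "\<And>n. pt_proj (w n) \<in> ball (pt_proj a) (1 / real (Suc n))" by metis
  have "(\<lambda>n. pt_proj (w n)) \<longlonglongrightarrow> pt_proj a"
  proof (rule metric_tendsto_imp_tendsto[of "\<lambda>n. 1 / real (Suc n)" 0])
    show "(\<lambda>n. 1 / real (Suc n)) \<longlonglongrightarrow> 0" by (rule LIMSEQ_inverse_real_of_nat[unfolded inverse_eq_divide])
    show "\<forall>\<^sub>F n in sequentially. dist (pt_proj (w n)) (pt_proj a) \<le> dist (1 / real (Suc n)) 0"
      using w(3) by (intro always_eventually) (auto simp: dist_commute less_imp_le)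
  qed
  moreover have "a \<in> unit_disk" using a by blast
  ultimately obtain b r where b: "b \<in> unit_disk" "(w \<circ> r) \<longlonglongrightarrow> b" "pt_proj a = pt_proj b"
    using pt_proj_limit[of w "pt_proj a", OF w(1)] pt_proj_Grassmannian by blast
  then have "b = a" using inj_pt_proj \<open>a \<in> unit_disk\<close> by (metis inj_onD)
  then have "\<forall>\<^sub>F n in sequentially. (w \<circ> r) n \<in> A" using b(2) a by (auto dest: topological_tendstoD)
  then show False using w(2) by (auto simp: eventually_sequentially)
qed

section \<open>Nondegeneracy of the derivative\<close>

lemma ev_has_field_derivative:
  "z \<in> unit_disk \<Longrightarrow> (ev f has_field_derivative deriv (ev f) z) (at z)"
  by (rule holomorphic_derivI[OF ev_holomorphic open_ball])

lemma ev_diff_scale: "z \<in> unit_disk \<Longrightarrow> ev (f - c *\<^sub>C g) z = ev f z - c * ev g z"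
  by (simp add: ev_eq cinner_simps)

lemma ev_kernel_nonzero: "a \<in> unit_disk \<Longrightarrow> ev (k a) a \<noteq> 0"
  using kernel_nonzero by (simp add: ev_eq cinner_eq_zero_iff)

text \<open>\<open>mob a\<close> is its own inverse, so the inverse in the invariance hypothesis
  gives composition with \<open>mob a\<close> itself.\<close>

lemma composition_mob:
  assumes a: "a \<in> unit_disk"
  shows "\<exists>g. \<forall>z\<in>unit_disk. ev g z = ev f (mob a z)"
proof -
  have p: "(a, 1) \<in> moebius_params" using a by (simp add: moebius_params_def)
  have "inv_into unit_disk (disk_moebius (a, 1)) z = mob a z" if "z \<in> unit_disk" for z
    using inv_into_disk_moebius[OF p that] by (simp add: moebius_inv_def disk_moebius_apply[OF that])
  then show ?thesis
    using composition p by (metis carrier_moebius_group imageI)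
qed

text \<open>If every function vanishing at \<open>a\<close> had vanishing derivative there, then evaluation of derivatives at \<open>a\<close>, hence by
  invariance at every point, would be a multiple of evaluation, and \<open>f / g\<close> would be constant for all \<open>f, g\<close>.\<close>

lemma derivative_nondegenerate:
  assumes a: "a \<in> unit_disk"
  shows "\<exists>y. ev y a = 0 \<and> deriv (ev y) a \<noteq> 0"
proof (rule ccontr)
  assume neg: "\<not> ?thesis"
  define g where "g = k a"
  have ga: "ev g a \<noteq> 0" using ev_kernel_nonzero[OF a] by (simp add: g_def)
  \<comment> \<open>The logarithmic derivative of \<open>k a\<close> at \<open>a\<close>.
    Subtracting a multiple of \<open>k a\<close> makes any \<open>f\<close> vanish at
    \<open>a\<close>, which shows that the ratio is the same for all \<open>f\<close>.\<close>
  define c where "c = deriv (ev g) a / ev g a"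
  have c: "deriv (ev f) a = c * ev f a" for f
  proof -
    define m where "m = ev f a / ev g a"
    have "ev (f - m *\<^sub>C g) a = 0" using ga by (simp add: ev_diff_scale[OF a] m_def)
    then have "deriv (ev (f - m *\<^sub>C g)) a = 0" using neg by blast
    moreover have "((\<lambda>z. ev f z - m * ev g z) has_field_derivative deriv (ev f) a - m * deriv (ev g) a) (at a)"
      by (intro DERIV_diff DERIV_cmult ev_has_field_derivative a)
    then have "(ev (f - m *\<^sub>C g) has_field_derivative deriv (ev f) a - m * deriv (ev g) a) (at a)"
      by (rule has_field_derivative_transform_within_open[OF _ open_ball a]) (simp add: ev_diff_scale)
    then have "deriv (ev (f - m *\<^sub>C g)) a = deriv (ev f) a - m * deriv (ev g) a" by (rule DERIV_imp_deriv)
    ultimately show ?thesis using ga by (simp add: m_def c_def)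
  qed
  \<comment> \<open>\<open>mob b \<circ> mob a\<close> carries \<open>a\<close> through 0 to
    \<open>b\<close> with nonzero derivative, so the chain rule transports the ratio to
    \<open>b\<close>.\<close>
  have all: "\<exists>cb. \<forall>f. deriv (ev f) b = cb * ev f b" if b: "b \<in> unit_disk" for b
  proof -
    obtain d1 where d1: "d1 \<noteq> 0" "(mob a has_field_derivative d1) (at a)"
      using mob_has_field_derivative[OF a a] by blast
    obtain d2 where d2: "d2 \<noteq> 0" "(mob b has_field_derivative d2) (at 0)"
      using mob_has_field_derivative[OF b, of 0] by auto
    have d: "((\<lambda>z. mob b (mob a z)) has_field_derivative d2 * d1) (at a)"
      using DERIV_chain2[of "mob b" d2 "mob a" a d1] d1 d2 by simp
    have "deriv (ev f) b = (c / (d2 * d1)) * ev f b" for f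
    proof -
      obtain g1 where g1: "\<And>z. z \<in> unit_disk \<Longrightarrow> ev g1 z = ev f (mob b z)"
        using composition_mob[OF b] by blast
      obtain g2 where g2: "\<And>z. z \<in> unit_disk \<Longrightarrow> ev g2 z = ev g1 (mob a z)"
        using composition_mob[OF a] by blast
      have g2f: "ev g2 z = ev f (mob b (mob a z))" if "z \<in> unit_disk" for z
        using g1[OF mob_disk[OF a that]] g2[OF that] by simp
      have "((\<lambda>z. ev f (mob b (mob a z))) has_field_derivative deriv (ev f) b * (d2 * d1)) (at a)"
        using DERIV_chain2[of "ev f" "deriv (ev f) b" "\<lambda>z. mob b (mob a z)", OF _ d]
          ev_has_field_derivative[OF b] by simp
      then have "(ev g2 has_field_derivative deriv (ev f) b * (d2 * d1)) (at a)"
        by (rule has_field_derivative_transform_within_open[OF _ open_ball a]) (simp add: g2f)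
      then have "deriv (ev g2) a = deriv (ev f) b * (d2 * d1)" by (rule DERIV_imp_deriv)
      moreover have "ev g2 a = ev f b" using g2f[OF a] by simp
      ultimately show ?thesis using c[of g2] d1(1) d2(1) by (simp add: field_simps)
    qed
    then show ?thesis by blast
  qed
  \<comment> \<open>Near \<open>a\<close> the quotient \<open>f / g\<close> has derivative 0 and the
    value 0 at \<open>a\<close>; the identity theorem extends the vanishing of \<open>f\<close> to
    the disk.\<close>
  have zero: "f = 0" if f: "ev f a = 0" for f
  proof -
    have "open {z \<in> unit_disk. ev g z \<in> - {0}}"
      using continuous_open_preimage[OF holomorphic_on_imp_continuous_on[OF ev_holomorphic[of g]] open_ball, of "- {0}"]
      by (simp add: Int_def vimage_def open_Compl)
    moreover have "a \<in> {z \<in> unit_disk. ev g z \<in> - {0}}" using a ga by simp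
    ultimately obtain r where r: "r > 0" "ball a r \<subseteq> {z \<in> unit_disk. ev g z \<in> - {0}}"
      using open_contains_ball by blast
    have D0: "((\<lambda>z. ev f z / ev g z) has_field_derivative 0) (at z within ball a r)" if "z \<in> ball a r" for z
    proof -
      have z: "z \<in> unit_disk" "ev g z \<noteq> 0" using r that by auto
      obtain cz where cz: "\<And>f. deriv (ev f) z = cz * ev f z" using all[OF z(1)] by blast
      have "((\<lambda>z. ev f z / ev g z) has_field_derivative
          (deriv (ev f) z * ev g z - ev f z * deriv (ev g) z) / (ev g z * ev g z)) (at z)"
        by (intro DERIV_divide ev_has_field_derivative z)
      then show ?thesis by (simp add: cz has_field_derivative_at_within)
    qed
    have "\<exists>q. \<forall>z\<in>ball a r. ev f z / ev g z = q"
      by (rule has_field_derivative_zero_constant[OF convex_ball D0])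
    then obtain q where q: "\<And>z. z \<in> ball a r \<Longrightarrow> ev f z / ev g z = q" by blast
    have "q = 0" using q[of a] r(1) f by simp
    then have fz: "ev f z = 0" if "z \<in> ball a r" for z using q[OF that] r that by auto
    have "ev f z = 0" if z: "z \<in> unit_disk" for z
    proof (rule analytic_continuation[OF ev_holomorphic open_ball _ _ a _ fz z])
      show "ball a r \<subseteq> unit_disk" using r by blast
      show "a islimpt ball a r" using r(1) by (simp add: islimpt_ball)
    qed auto
    then show "f = 0" by (intro ev_ext) (simp add: ev_eq)
  qed
  have "f \<in> complex_hilbert.span {g}" for f
  proof -
    have "f - (ev f a / ev g a) *\<^sub>C g = 0" using ga by (intro zero) (simp add: ev_diff_scale[OF a])
    then have "f = (ev f a / ev g a) *\<^sub>C g" by simp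
    then show ?thesis by (metis complex_hilbert.span_base complex_hilbert.span_scale singletonI)
  qed
  then have "complex_hilbert.span {g} = UNIV" by blast
  then show False using infinite_dim by blast
qed

text \<open>Dividing by the value of \<open>k a\<close> makes the coordinate independent of the
  scaling of \<open>k b\<close>, hence a function of the subspace alone. It vanishes at
  \<open>a\<close>, and its derivative there is that of \<open>y\<close> divided by the nonzero
  value of \<open>k a\<close>, so it is injective nearby with holomorphic inverse \<theta>.\<close>

lemma local_coordinate:
  assumes a: "a \<in> W" and W: "open W" "W \<subseteq> unit_disk"
  shows "\<exists>y A T \<theta>. cinner y (k a) = 0 \<and> y \<noteq> 0 \<and> open A \<and> a \<in> A \<and> A \<subseteq> W \<and>
    (\<forall>b\<in>A. cinner (k a) (k b) \<noteq> 0) \<and> open T \<and> \<theta> holomorphic_on T \<and> (\<forall>t\<in>T. \<theta> t \<in> A) \<and>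
    (\<forall>t\<in>T. cinner y (k (\<theta> t)) / cinner (k a) (k (\<theta> t)) = t) \<and>
    (\<forall>b\<in>A. cinner y (k b) / cinner (k a) (k b) \<in> T \<and> \<theta> (cinner y (k b) / cinner (k a) (k b)) = b)"
proof -
  have ad: "a \<in> unit_disk" using a W by blast
  obtain y where y: "ev y a = 0" "deriv (ev y) a \<noteq> 0" using derivative_nondegenerate[OF ad] by blast
  define s where "s = (\<lambda>b. ev y b / ev (k a) b)"
  define W' where "W' = {b \<in> W. ev (k a) b \<in> - {0}}"
  have hol: "ev f holomorphic_on W" for f using ev_holomorphic W(2) by (rule holomorphic_on_subset)
  have oW': "open W'"
    using continuous_open_preimage[OF holomorphic_on_imp_continuous_on[OF hol[of "k a"]] W(1), of "- {0}"]
    by (simp add: Int_def vimage_def W'_def open_Compl)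
  have aW': "a \<in> W'" using a ev_kernel_nonzero[OF ad] by (simp add: W'_def)
  have holW': "ev f holomorphic_on W'" for f by (rule holomorphic_on_subset[OF hol]) (auto simp: W'_def)
  have s: "s holomorphic_on W'" unfolding s_def
    by (intro holomorphic_on_divide holW') (auto simp: W'_def)
  have "(s has_field_derivative (deriv (ev y) a * ev (k a) a - ev y a * deriv (ev (k a)) a) / (ev (k a) a * ev (k a) a)) (at a)"
    unfolding s_def by (intro DERIV_divide ev_has_field_derivative ad ev_kernel_nonzero)
  then have "deriv s a \<noteq> 0" using y ev_kernel_nonzero[OF ad] by (simp add: DERIV_imp_deriv)
  from has_complex_derivative_locally_injective[OF s aW' oW' this]
  obtain r where r: "r > 0" "ball a r \<subseteq> W'" "inj_on s (ball a r)" .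
  define A where "A = ball a r"
  have sA: "s holomorphic_on A" unfolding A_def by (rule holomorphic_on_subset[OF s r(2)])
  have oA: "open A" by (simp add: A_def)
  have injA: "inj_on s A" using r(3) by (simp add: A_def)
  have "\<exists>\<theta>. \<theta> holomorphic_on s ` A \<and> (\<forall>b\<in>A. \<theta> (s b) = b)"
    by (rule holomorphic_has_inverse[OF sA oA injA]) blast
  then obtain \<theta> where \<theta>: "\<theta> holomorphic_on s ` A" "\<And>b. b \<in> A \<Longrightarrow> \<theta> (s b) = b" by blast
  have oT: "open (s ` A)" by (rule open_mapping_thm3[OF sA oA injA])
  have AW: "A \<subseteq> W'" using r by (simp add: A_def)
  then have seq: "s b = cinner y (k b) / cinner (k a) (k b)" if "b \<in> A" for b
    using that W(2) by (auto simp: s_def W'_def ev_eq subset_iff)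
  have nz: "cinner (k a) (k b) \<noteq> 0" if "b \<in> A" for b
    using AW that W(2) by (auto simp: W'_def ev_eq subset_iff)
  have "y \<noteq> 0"
  proof
    assume "y = 0"
    then have "(ev y has_field_derivative 0) (at a)"
      by (intro has_field_derivative_transform_within_open[OF DERIV_const open_ball ad]) (simp add: ev_eq)
    then show False using y(2) by (simp add: DERIV_imp_deriv)
  qed
  moreover have "cinner y (k a) = 0" using y(1) by (simp add: ev_eq[OF ad])
  moreover have "a \<in> A" "A \<subseteq> W" using r AW by (auto simp: A_def W'_def)
  moreover have "\<forall>t\<in>s ` A. \<theta> t \<in> A" using \<theta>(2) by auto
  moreover have "\<forall>t\<in>s ` A. cinner y (k (\<theta> t)) / cinner (k a) (k (\<theta> t)) = t" using \<theta>(2) seq by auto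
  moreover have "\<forall>b\<in>A. cinner y (k b) / cinner (k a) (k b) \<in> s ` A \<and> \<theta> (cinner y (k b) / cinner (k a) (k b)) = b"
    using \<theta>(2) seq by (metis imageI)
  ultimately show ?thesis using oA oT \<theta>(1) nz by blast
qed

text \<open>In the chart of the Grassmannian at \<open>pt_proj a\<close> the points become a holomorphic curve \<open>r\<close>, parametrized by the value of a
  linear functional \<open>\<tau>\<close> on it. A shear along the fibres of \<open>\<tau>\<close> straightens the curve to the line \<open>range \<iota>\<close>.\<close>

lemma adapted_chart:
  assumes a: "a \<in> unit_disk"
  shows "\<exists>U V \<Phi> \<Psi> F G. pt_proj a \<in> U \<and> smooth_diffeomorphism U V \<Phi> \<Psi> \<and>
      complemented_subspace (F :: 'h bop set) \<and> \<Phi> ` (U \<inter> Grassmannian) = V \<inter> F \<and>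
      complemented_subspace G \<and> G \<subseteq> F \<and> \<Phi> ` (U \<inter> point_Grassmannian ev) = V \<inter> G \<and>
      (\<exists>\<alpha>. fsmooth U \<alpha> \<and> (\<forall>X\<in>U. \<alpha> X \<in> unit_disk) \<and> (\<forall>b\<in>unit_disk. pt_proj b \<in> U \<longrightarrow> \<alpha> (pt_proj b) = b))"
proof -
  interpret projection "pt_proj a" by (rule projection_Grassmannian[OF pt_proj_Grassmannian[OF a]])
  define W where "W = {b \<in> unit_disk. pt_proj b \<in> chart_dom}"
  have W: "open W" unfolding W_def
    by (rule fsmooth_preimage[OF fsmooth_pt_proj[OF fsmooth_ident[OF open_ball]] open_chart_dom])
  have W': "W \<subseteq> unit_disk" by (auto simp: W_def)
  have aW: "a \<in> W" using a P_in_chart_dom by (simp add: W_def)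
  obtain y A T \<theta> where y: "cinner y (k a) = 0" "y \<noteq> 0" and A: "open A" "a \<in> A" "A \<subseteq> W"
    and nz: "\<And>b. b \<in> A \<Longrightarrow> cinner (k a) (k b) \<noteq> 0" and T: "open T" "\<theta> holomorphic_on T" "\<And>t. t \<in> T \<Longrightarrow> \<theta> t \<in> A"
    and s\<theta>: "\<And>t. t \<in> T \<Longrightarrow> cinner y (k (\<theta> t)) / cinner (k a) (k (\<theta> t)) = t"
    and \<theta>s: "\<And>b. b \<in> A \<Longrightarrow> cinner y (k b) / cinner (k a) (k b) \<in> T \<and> \<theta> (cinner y (k b) / cinner (k a) (k b)) = b"
    using local_coordinate[OF aW W W'] by metis
  have Ad: "A \<subseteq> unit_disk" using A W' by blast
  \<comment> \<open>Restricting the chart to \<open>N\<close> keeps out the projections of points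
    outside \<open>A\<close>, over which the curve in the chart is not controlled.\<close>
  obtain N where N: "open N" "pt_proj a \<in> N" "\<And>b. b \<in> unit_disk \<Longrightarrow> pt_proj b \<in> N \<Longrightarrow> b \<in> A"
    using pt_proj_nbhd[OF A(2,1) Ad] by blast
  have kk: "cinner (k a) (k a) \<noteq> 0" using kernel_nonzero a by (simp add: cinner_eq_zero_iff)
  have yy: "cinner y y \<noteq> 0" using y by (simp add: cinner_eq_zero_iff)
  have Py: "bop_apply (pt_proj a) y = y" using y by (simp add: pt_proj_fix)
  have Pk: "bop_apply (pt_proj a) (k a) = 0" by (rule pt_proj_kernel[OF a])
  \<comment> \<open>The slope at \<open>pt_proj b\<close> sends \<open>y\<close> to
    \<open>- (s b *\<^sub>C k a)\<close>; the normalization makes \<tau> read off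
    \<open>s b\<close>. Below, \<iota> sends t to an operator that maps \<open>y\<close> to
    \<open>- (t *\<^sub>C k a)\<close>, so it is a right inverse of \<tau>.\<close>
  define \<tau> where "\<tau> = (\<lambda>Y. cinner (bop_apply Y y) (k a) * (- 1 / cinner (k a) (k a)))"
  define \<iota> where "\<iota> = (\<lambda>t. rank_one ((t * (- 1 / cinner y y)) *\<^sub>C k a) y)"
  have bl_apply: "bounded_linear (\<lambda>Y. bop_apply Y y)"
    by (rule bounded_linear_intro[of _ "norm y"]) (auto simp: norm_bop_apply_le)
  have \<tau>: "bounded_linear \<tau>" unfolding \<tau>_def
    by (rule bounded_linear_compose[OF bounded_linear_mult_left
          bounded_linear_compose[OF bounded_bilinear.bounded_linear_left[OF bounded_bilinear_cinner] bl_apply]])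
  have \<iota>: "bounded_linear \<iota>" unfolding \<iota>_def
    by (rule bounded_linear_compose[OF bounded_bilinear.bounded_linear_left[OF bounded_bilinear_rank_one]
          bounded_linear_compose[OF bounded_bilinear.bounded_linear_left[OF bounded_bilinear_scaleC]
            bounded_linear_mult_left]])
  interpret \<tau>: bounded_linear \<tau> by (rule \<tau>)
  have \<tau>\<iota>: "\<tau> (\<iota> t) = t" for t using yy kk by (simp add: \<tau>_def \<iota>_def cinner_simps)
  have \<iota>_model: "\<iota> t \<in> model" for t
    unfolding model_iff
  proof (rule bop_eqI)
    fix x
    have "cinner (bop_apply (pt_proj a) x) y = cinner x y"
      using pt_proj_Grassmannian[OF a] Py by (simp add: Grassmannian_def)
    then show "bop_apply (lower (\<iota> t)) x = bop_apply (\<iota> t) x"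
      by (simp add: lower_def Q_def \<iota>_def bop_apply_scaleC_right bop_apply_minus_right Pk)
  qed
  have pt: "pt_proj b \<in> chart_dom" "pt_proj b \<in> Grassmannian" if "b \<in> A" for b
    using that A Ad pt_proj_Grassmannian by (auto simp: W_def)
  have \<theta>d: "\<theta> t \<in> unit_disk" if "t \<in> T" for t using T(3)[OF that] Ad by blast
  define s where "s = (\<lambda>b. cinner y (k b) / cinner (k a) (k b))"
  have \<tau>_chart: "\<tau> (chart (pt_proj b)) = s b" if b: "b \<in> A" for b
  proof -
    \<comment> \<open>This vector is orthogonal to \<open>k b\<close>, hence a point of the graph;
      its component in the range of \<open>pt_proj a\<close> is \<open>y\<close>, so the other
      component is the slope applied to \<open>y\<close>.\<close>
    define x where "x = y - s b *\<^sub>C k a"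
    have "bop_apply (pt_proj b) x = x"
      using nz[OF b] by (intro pt_proj_fix) (simp add: x_def s_def cinner_simps)
    moreover have "bop_apply (Q * pt_proj b) x = bop_apply (slope (pt_proj b) * (pt_proj a * pt_proj b)) x"
      using chart_Grassmannian(2)[OF pt[OF b]] by simp
    ultimately have "bop_apply Q x = bop_apply (slope (pt_proj b)) (bop_apply (pt_proj a) x)" by simp
    moreover have "bop_apply (pt_proj a) x = y"
      by (simp add: x_def bop_apply_diff_right bop_apply_scaleC_right Py Pk)
    moreover have "bop_apply Q x = - (s b *\<^sub>C k a)"
      using calculation(2) by (simp add: Q_def) (simp add: x_def)
    ultimately have "bop_apply (slope (pt_proj b)) y = - (s b *\<^sub>C k a)" by simp
    then show ?thesis
      using kk by (simp add: \<tau>_def chart_eq_slope[OF pt(1)[OF b] pt(2)[OF b]] cinner_simps)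
  qed
  define r where "r = (\<lambda>t. chart (pt_proj (\<theta> t)))"
  have \<tau>r: "\<tau> (r t) = t" if "t \<in> T" for t
    using \<tau>_chart[OF T(3)[OF that]] s\<theta>[OF that] by (simp add: r_def s_def)
  have r_model: "r t \<in> model" if "t \<in> T" for t
    unfolding r_def by (rule chart_Grassmannian(1)[OF pt[OF T(3)[OF that]]])
  have fsmooth_r: "fsmooth B (\<lambda>x. r (u x))" if u: "fsmooth B u" "\<And>x. x \<in> B \<Longrightarrow> u x \<in> T" for B and u :: "'h bop \<Rightarrow> complex"
    unfolding r_def
    by (intro fsmooth_chart fsmooth_pt_proj fsmooth_holomorphic[OF T(2,1)] u) (use u(2) \<theta>d T(3) pt(1) in blast)+
  \<comment> \<open>Both \<open>r t\<close> and \<open>\<iota> t\<close> have \<tau>-value t, so the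
    shear preserves \<tau>, and undoing it only exchanges the two signs.\<close>
  define \<Phi>2 where "\<Phi>2 Y = Y - r (\<tau> Y) + \<iota> (\<tau> Y)" for Y
  define \<Psi>2 where "\<Psi>2 Y = Y + r (\<tau> Y) - \<iota> (\<tau> Y)" for Y
  have \<tau>\<Phi>2: "\<tau> (\<Phi>2 Y) = \<tau> Y" and \<tau>\<Psi>2: "\<tau> (\<Psi>2 Y) = \<tau> Y" if "\<tau> Y \<in> T" for Y
    using that by (simp_all add: \<Phi>2_def \<Psi>2_def \<tau>.add \<tau>.diff \<tau>r \<tau>\<iota>)
  have \<Psi>2\<Phi>2: "\<Psi>2 (\<Phi>2 Y) = Y" and \<Phi>2\<Psi>2: "\<Phi>2 (\<Psi>2 Y) = Y" if "\<tau> Y \<in> T" for Y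
    using \<tau>\<Phi>2[OF that] \<tau>\<Psi>2[OF that] by (simp_all add: \<Phi>2_def[of "\<Psi>2 Y"] \<Psi>2_def[of "\<Phi>2 Y"]) (simp_all add: \<Phi>2_def \<Psi>2_def)
  have model2: "\<Phi>2 Y \<in> model" "\<Psi>2 Y \<in> model" if "\<tau> Y \<in> T" "Y \<in> model" for Y
    using that r_model \<iota>_model by (auto simp: \<Phi>2_def \<Psi>2_def intro!: model_add model_diff)
  have fsmooth2: "fsmooth B (\<lambda>X. \<Phi>2 (u X))" "fsmooth B (\<lambda>X. \<Psi>2 (u X))"
    if u: "fsmooth B u" "\<And>x. x \<in> B \<Longrightarrow> \<tau> (u x) \<in> T" for B and u :: "'h bop \<Rightarrow> 'h bop"
    unfolding \<Phi>2_def \<Psi>2_def using u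
    by (intro fsmooth_add fsmooth_diff fsmooth_r fsmooth_linear_comp[OF \<iota>] fsmooth_linear_comp[OF \<tau>]; simp)+
  define U1 where "U1 = chart_dom \<inter> N"
  define U where "U = {X \<in> U1. \<tau> (chart X) \<in> T}"
  define V1 where "V1 = {Y \<in> UNIV. \<tau> Y \<in> T}"
  \<comment> \<open>The image is described by conditions on the inverse map, so that each stage is
    open as a preimage under a map already known to be smooth.\<close>
  define V2 where "V2 = {Y \<in> V1. \<Psi>2 Y \<in> chart_ran}"
  define V where "V = {Y \<in> V2. unchart (\<Psi>2 Y) \<in> N}"
  have U1: "open U1" using open_chart_dom N by (simp add: U1_def open_Int)
  have ch: "fsmooth U1 chart" by (rule fsmooth_chart[OF fsmooth_ident[OF U1]]) (simp add: U1_def)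
  have oU: "open U" unfolding U_def by (rule fsmooth_preimage[OF fsmooth_linear_comp[OF \<tau> ch] T(1)])
  have oV1: "open V1" unfolding V1_def by (rule fsmooth_preimage[OF fsmooth_bounded_linear[OF open_UNIV \<tau>] T(1)])
  have s1: "fsmooth V1 \<Psi>2" using fsmooth2(2)[OF fsmooth_ident[OF oV1]] by (simp add: V1_def)
  have oV2: "open V2" unfolding V2_def by (rule fsmooth_preimage[OF s1 open_chart_ran])
  have s2: "fsmooth V2 (\<lambda>Y. unchart (\<Psi>2 Y))"
    by (rule fsmooth_unchart[OF fsmooth_subset[OF s1 oV2]]) (auto simp: V2_def)
  have oV: "open V" unfolding V_def by (rule fsmooth_preimage[OF s2 N(1)])
  define \<Phi> where "\<Phi> = (\<lambda>X. \<Phi>2 (chart X))"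
  define \<Psi> where "\<Psi> = (\<lambda>Y. unchart (\<Psi>2 Y))"
  have chU: "fsmooth U chart" by (rule fsmooth_subset[OF ch oU]) (auto simp: U_def)
  have s\<Phi>: "fsmooth U \<Phi>" unfolding \<Phi>_def by (rule fsmooth2(1)[OF chU]) (simp add: U_def)
  have s\<Psi>: "fsmooth V \<Psi>" unfolding \<Psi>_def by (rule fsmooth_subset[OF s2 oV]) (auto simp: V_def)
  have UV: "\<Phi> X \<in> V" "\<Psi> (\<Phi> X) = X" if X: "X \<in> U" for X
  proof -
    have x: "X \<in> chart_dom" "X \<in> N" "\<tau> (chart X) \<in> T" using X by (auto simp: U_def U1_def)
    then have 1: "\<Psi>2 (\<Phi> X) = chart X" by (simp add: \<Phi>_def \<Psi>2\<Phi>2)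
    then show "\<Psi> (\<Phi> X) = X" using x by (simp add: \<Psi>_def unchart_chart)
    then show "\<Phi> X \<in> V" using x 1 chart_mem \<tau>\<Phi>2[OF x(3)] by (simp add: V_def V2_def V1_def \<Psi>_def \<Phi>_def)
  qed
  have VU: "\<Psi> Y \<in> U" "\<Phi> (\<Psi> Y) = Y" if Y: "Y \<in> V" for Y
  proof -
    have y: "\<tau> Y \<in> T" "\<Psi>2 Y \<in> chart_ran" "\<Psi> Y \<in> N" using Y by (auto simp: V_def V2_def V1_def \<Psi>_def)
    then have 1: "chart (\<Psi> Y) = \<Psi>2 Y" by (simp add: \<Psi>_def chart_unchart)
    then show "\<Phi> (\<Psi> Y) = Y" using y by (simp add: \<Phi>_def \<Phi>2\<Psi>2)
    show "\<Psi> Y \<in> U" using y 1 unchart_mem[OF y(2)] by (simp add: U_def U1_def \<tau>\<Psi>2) (simp add: \<Psi>_def)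
  qed
  have image: "\<Phi> ` (U \<inter> S) = V \<inter> H" if "\<And>X. X \<in> U \<Longrightarrow> X \<in> S \<Longrightarrow> \<Phi> X \<in> H" "\<And>Y. Y \<in> V \<Longrightarrow> Y \<in> H \<Longrightarrow> \<Psi> Y \<in> S" for S H
  proof (intro equalityI subsetI)
    fix Y assume "Y \<in> V \<inter> H"
    then show "Y \<in> \<Phi> ` (U \<inter> S)" using VU that(2) by (metis IntD1 IntD2 IntI image_eqI)
  qed (use that(1) UV in auto)
  have on_curve: "b \<in> A \<and> \<tau> (chart (pt_proj b)) = s b \<and> \<theta> (s b) = b \<and> s b \<in> T"
    if b: "b \<in> unit_disk" "pt_proj b \<in> U" for b
  proof -
    have "b \<in> A" using b N(3) by (auto simp: U_def U1_def)
    then show ?thesis using \<tau>_chart \<theta>s by (simp add: s_def)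
  qed
  define G where "G = range \<iota>"
  have "pt_proj a \<in> U" using \<tau>_chart[OF A(2)] \<theta>s[OF A(2)] P_in_chart_dom N(2) by (simp add: U_def U1_def s_def)
  moreover have "smooth_diffeomorphism U V \<Phi> \<Psi>"
    unfolding smooth_diffeomorphism_def
    using s\<Phi> s\<Psi> UV VU by (auto intro!: homeomorphismI fsmooth_imp_smooth_on fsmooth_continuous_on)
  moreover have "\<Phi> ` (U \<inter> Grassmannian) = V \<inter> model"
  proof (rule image)
    show "\<Phi> X \<in> model" if "X \<in> U" "X \<in> Grassmannian" for X
      using that chart_Grassmannian(1) by (auto simp: \<Phi>_def U_def U1_def intro!: model2)
    show "\<Psi> Y \<in> Grassmannian" if "Y \<in> V" "Y \<in> model" for Y
      using that model2(2) by (auto simp: \<Psi>_def V_def V2_def V1_def intro!: unchart_Grassmannian)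
  qed
  moreover have "complemented_subspace G"
    unfolding complemented_subspace_def
  proof (intro exI[of _ "\<lambda>Y. \<iota> (\<tau> Y)"] conjI)
    show "bounded_linear (\<lambda>Y. \<iota> (\<tau> Y))" by (rule bounded_linear_compose[OF \<iota> \<tau>])
    show "(\<lambda>Y. \<iota> (\<tau> Y)) \<circ> (\<lambda>Y. \<iota> (\<tau> Y)) = (\<lambda>Y. \<iota> (\<tau> Y))" by (simp add: fun_eq_iff \<tau>\<iota>)
    show "range (\<lambda>Y. \<iota> (\<tau> Y)) = G"
    proof (intro equalityI subsetI)
      fix Z assume "Z \<in> G"
      then obtain t where "Z = \<iota> t" by (auto simp: G_def)
      then have "Z = \<iota> (\<tau> (\<iota> t))" by (simp add: \<tau>\<iota>)
      then show "Z \<in> range (\<lambda>Y. \<iota> (\<tau> Y))" by (rule range_eqI)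
    qed (auto simp: G_def)
  qed
  moreover have "G \<subseteq> model" using \<iota>_model by (auto simp: G_def)
  moreover have "\<Phi> ` (U \<inter> point_Grassmannian ev) = V \<inter> G"
  proof (rule image)
    show "\<Phi> X \<in> G" if X: "X \<in> U" "X \<in> point_Grassmannian ev" for X
    proof -
      obtain b where b: "b \<in> unit_disk" "X = pt_proj b" using X(2) by (auto simp: point_Grassmannian_eq)
      then have "\<Phi> X = \<iota> (s b)" using on_curve[of b] X(1) by (simp add: \<Phi>_def \<Phi>2_def r_def)
      then show ?thesis by (simp add: G_def)
    qed
    show "\<Psi> Y \<in> point_Grassmannian ev" if Y: "Y \<in> V" "Y \<in> G" for Y
    proof -
      obtain t where t: "Y = \<iota> t" using Y(2) by (auto simp: G_def)
      then have tT: "t \<in> T" using Y(1) \<tau>\<iota> by (simp add: V_def V2_def V1_def)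
      have "\<Psi> Y = pt_proj (\<theta> t)"
        using unchart_chart[OF pt(1)[OF T(3)[OF tT]]] by (simp add: \<Psi>_def \<Psi>2_def t \<tau>\<iota> r_def)
      then show ?thesis using T(3)[OF tT] Ad by (auto simp: point_Grassmannian_eq)
    qed
  qed
  \<comment> \<open>A smooth local left inverse of \<open>pt_proj\<close>, from which the action
    inherits its smoothness.\<close>
  moreover have "fsmooth U (\<lambda>X. \<theta> (\<tau> (chart X)))"
    by (rule fsmooth_holomorphic[OF T(2,1) fsmooth_linear_comp[OF \<tau> chU]]) (simp add: U_def)
  moreover have "\<forall>X\<in>U. \<theta> (\<tau> (chart X)) \<in> unit_disk" using \<theta>d by (simp add: U_def del: mem_ball)
  moreover have "\<forall>b\<in>unit_disk. pt_proj b \<in> U \<longrightarrow> \<theta> (\<tau> (chart (pt_proj b))) = b" using on_curve by auto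
  ultimately show ?thesis
    using complemented_model
    by - (rule exI[of _ U], rule exI[of _ V], rule exI[of _ \<Phi>], rule exI[of _ \<Psi>], rule exI[of _ model], rule exI[of _ G],
        intro conjI exI[of _ "\<lambda>X. \<theta> (\<tau> (chart X))"], assumption+)
qed

section \<open>The submanifold property\<close>

lemma closed_submanifold: "closed_submanifold_of (point_Grassmannian ev) Grassmannian"
  unfolding closed_submanifold_of_def submanifold_of_def
proof (intro conjI ballI submanifold_Grassmannian closedin_point_Grassmannian)
  show "point_Grassmannian ev \<subseteq> Grassmannian"
    using pt_proj_Grassmannian by (auto simp: point_Grassmannian_eq)
  fix p assume "p \<in> point_Grassmannian ev"
  then obtain a where a: "a \<in> unit_disk" "p = pt_proj a" by (auto simp: point_Grassmannian_eq)
  show "\<exists>U V \<Phi> \<Psi> F G. p \<in> U \<and> smooth_diffeomorphism U V \<Phi> \<Psi> \<and>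
      complemented_subspace (F :: 'h bop set) \<and> \<Phi> ` (U \<inter> Grassmannian) = V \<inter> F \<and>
      complemented_subspace G \<and> G \<subseteq> F \<and> \<Phi> ` (U \<inter> point_Grassmannian ev) = V \<inter> G"
    using adapted_chart[OF a(1)] unfolding a(2) by (elim ex_forward) (elim conjE, intro conjI; assumption)
qed

lemma submanifold_point_Grassmannian: "submanifold (point_Grassmannian ev)"
  unfolding submanifold_def
proof
  fix p assume "p \<in> point_Grassmannian ev"
  then obtain a where a: "a \<in> unit_disk" "p = pt_proj a" by (auto simp: point_Grassmannian_eq)
  obtain U V \<Phi> \<Psi> G where "pt_proj a \<in> U" "smooth_diffeomorphism U V \<Phi> \<Psi>"
    "\<Phi> ` (U \<inter> point_Grassmannian ev) = V \<inter> G" "complemented_subspace (G :: 'h bop set)"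
    using adapted_chart[OF a(1)] by (elim exE conjE) (rule that, assumption+)
  then show "\<exists>U V \<Phi> \<Psi> F. p \<in> U \<and> smooth_diffeomorphism U V \<Phi> \<Psi> \<and>
      complemented_subspace (F :: 'h bop set) \<and> \<Phi> ` (U \<inter> point_Grassmannian ev) = V \<inter> F"
    unfolding a(2)
    by - (rule exI[of _ U], rule exI[of _ V], rule exI[of _ \<Phi>], rule exI[of _ \<Psi>], rule exI[of _ G],
        intro conjI, assumption+)
qed

section \<open>The action of the Moebius group\<close>

definition act :: "(complex \<Rightarrow> complex) \<Rightarrow> 'h bop \<Rightarrow> 'h bop"
  where "act \<phi> = (\<lambda>X\<in>point_Grassmannian ev. pt_proj (\<phi> (inv_into unit_disk pt_proj X)))"

lemma act_pt_proj: "a \<in> unit_disk \<Longrightarrow> act \<phi> (pt_proj a) = pt_proj (\<phi> a)"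
  by (simp add: act_def point_Grassmannian_eq inv_into_f_f[OF inj_pt_proj])

lemma act_mult:
  assumes "\<phi> \<in> carrier moebius_group" "\<psi> \<in> carrier moebius_group" "a \<in> unit_disk"
  shows "act (\<phi> \<otimes>\<^bsub>moebius_group\<^esub> \<psi>) (pt_proj a) = act \<phi> (act \<psi> (pt_proj a))"
proof -
  have "\<psi> a \<in> unit_disk" using assms disk_moebius_disk by (auto simp: carrier_moebius_group simp del: mem_ball)
  then show ?thesis using assms(3) by (simp add: act_pt_proj moebius_group_def compose_eq)
qed

lemma act_Bij:
  assumes "\<phi> \<in> carrier moebius_group"
  shows "act \<phi> \<in> Bij (point_Grassmannian ev)"
proof -
  obtain s where s: "s \<in> moebius_params" "\<phi> = disk_moebius s" using assms by (auto simp: carrier_moebius_group)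
  have bb: "bij_betw pt_proj unit_disk (point_Grassmannian ev)"
    using inj_pt_proj by (simp add: bij_betw_def point_Grassmannian_eq)
  have "bij_betw (pt_proj \<circ> (disk_moebius s \<circ> inv_into unit_disk pt_proj)) (point_Grassmannian ev) (point_Grassmannian ev)"
    by (rule bij_betw_trans[OF bij_betw_trans[OF bij_betw_inv_into[OF bb] bij_betw_disk_moebius[OF s(1)]] bb])
  then have "bij_betw (act \<phi>) (point_Grassmannian ev) (point_Grassmannian ev)"
    by (rule bij_betw_cong[THEN iffD1, rotated]) (simp add: act_def s(2))
  \<comment> \<open>\<open>Bij\<close> also demands extensionality, which the restriction in
    \<open>act\<close> supplies.\<close>
  then show ?thesis by (simp add: Bij_def act_def)
qed

lemma transitive_action_act: "transitive_action moebius_group (point_Grassmannian ev) act"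
proof -
  have "act \<in> hom moebius_group (BijGroup (point_Grassmannian ev))"
  proof (rule homI)
    show "act \<phi> \<in> carrier (BijGroup (point_Grassmannian ev))" if "\<phi> \<in> carrier moebius_group" for \<phi>
      using act_Bij[OF that] by (simp add: BijGroup_def)
    fix \<phi> \<psi> assume pq: "\<phi> \<in> carrier moebius_group" "\<psi> \<in> carrier moebius_group"
    have "act (\<phi> \<otimes>\<^bsub>moebius_group\<^esub> \<psi>) = compose (point_Grassmannian ev) (act \<phi>) (act \<psi>)"
    proof (rule extensionalityI[OF _ compose_extensional])
      show "act (\<phi> \<otimes>\<^bsub>moebius_group\<^esub> \<psi>) \<in> extensional (point_Grassmannian ev)" by (simp add: act_def)
      show "act (\<phi> \<otimes>\<^bsub>moebius_group\<^esub> \<psi>) X = compose (point_Grassmannian ev) (act \<phi>) (act \<psi>) X"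
        if "X \<in> point_Grassmannian ev" for X
        using that act_mult[OF pq] by (auto simp: point_Grassmannian_eq compose_eq simp del: mem_ball)
    qed
    then show "act (\<phi> \<otimes>\<^bsub>moebius_group\<^esub> \<psi>) = act \<phi> \<otimes>\<^bsub>BijGroup (point_Grassmannian ev)\<^esub> act \<psi>"
      using act_Bij pq by (simp add: BijGroup_def)
  qed
  then have "group_action moebius_group (point_Grassmannian ev) act"
    unfolding group_action_def group_hom_def group_hom_axioms_def
    using group_moebius_group group_BijGroup by blast
  moreover have "\<exists>\<phi>\<in>carrier moebius_group. act \<phi> X = Y"
    if X: "X \<in> point_Grassmannian ev" and Y: "Y \<in> point_Grassmannian ev" for X Y
  proof -
    obtain a b where a: "a \<in> unit_disk" "X = pt_proj a" and b: "b \<in> unit_disk" "Y = pt_proj b"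
      using X Y by (auto simp: point_Grassmannian_eq)
    have p: "(a, 1) \<in> moebius_params" "(b, 1) \<in> moebius_params" using a b by (auto simp: moebius_params_def)
    \<comment> \<open>The composite moves \<open>a\<close> to 0 and then 0 to
      \<open>b\<close>.\<close>
    have "disk_moebius (moebius_mult ((b, 1), (a, 1))) a = b"
      using moebius_mult_apply[OF p(2,1) a(1)] by (simp add: disk_moebius_apply[OF a(1)] disk_moebius_apply[of 0])
    moreover have "disk_moebius (moebius_mult ((b, 1), (a, 1))) \<in> carrier moebius_group"
      using moebius_mult_params[OF p(2,1)] by (simp add: carrier_moebius_group)
    ultimately show ?thesis using act_pt_proj[OF a(1)] a(2) b(2) by metis
  qed
  ultimately show ?thesis
    by (simp add: transitive_action_def transitive_action_axioms_def)
qed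

text \<open>Near a given point the action is \<open>pt_proj\<close> of the explicit fraction
  evaluated at the recovered point \<open>\<alpha> X\<close>. This formula extends to an open set of
  parameters and operators, as smoothness on a submanifold requires.\<close>

lemma smooth_act: "smooth_map_on (moebius_params \<times> point_Grassmannian ev) (\<lambda>(s, X). act (disk_moebius s) X)"
  unfolding smooth_map_on_def
proof
  fix p assume "p \<in> moebius_params \<times> point_Grassmannian ev"
  then obtain s0 c where p: "p = (s0, pt_proj c)" "s0 \<in> moebius_params" "c \<in> unit_disk"
    by (auto simp: point_Grassmannian_eq)
  obtain U \<alpha> where U': "pt_proj c \<in> U" "fsmooth U \<alpha>" "\<forall>X\<in>U. \<alpha> X \<in> unit_disk"
    "\<forall>b\<in>unit_disk. pt_proj b \<in> U \<longrightarrow> \<alpha> (pt_proj b) = b"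
    using adapted_chart[OF p(3)] by (elim exE conjE) (rule that, assumption+)
  note U = U'(1,2) U'(3)[rule_format] U'(4)[rule_format]
  define A where "A = (unit_disk \<times> (UNIV :: complex set)) \<times> U"
  have oA: "open A" using fsmooth_open[OF U(2)] by (simp add: A_def open_Times)
  have id: "fsmooth A (\<lambda>x. x)" by (rule fsmooth_ident[OF oA])
  have \<alpha>: "fsmooth A (\<lambda>x. \<alpha> (snd x))"
    by (rule fsmooth_compose_linear[OF U(2) bounded_linear_snd oA]) (auto simp: A_def)
  define h where "h = (\<lambda>x. snd (fst x) * mob (fst (fst x)) (\<alpha> (snd x)))"
  have h: "fsmooth A h" unfolding h_def
    by (intro fsmooth_mult fsmooth_mob fsmooth_fst fsmooth_snd id \<alpha>) (use U(3) mob_denom_nz in \<open>auto simp: A_def simp del: mem_ball\<close>)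
  \<comment> \<open>For factors off the unit circle the value of \<open>h\<close> may leave the
    disk, so the domain is cut back to where \<open>pt_proj\<close> is known to be smooth.\<close>
  define B where "B = {x \<in> A. h x \<in> unit_disk}"
  have oB: "open B" unfolding B_def by (rule fsmooth_preimage[OF h open_ball])
  have g: "fsmooth B (\<lambda>x. pt_proj (h x))"
    by (rule fsmooth_pt_proj[OF fsmooth_subset[OF h oB]]) (auto simp: B_def)
  have eq: "h (s, X) = disk_moebius s (\<alpha> X) \<and> (s, X) \<in> A \<and> h (s, X) \<in> unit_disk" if "s \<in> moebius_params" "X \<in> U" for s X
  proof -
    have "h (s, X) = disk_moebius s (\<alpha> X)"
      using disk_moebius_apply[OF U(3)[OF that(2)], of "fst s" "snd s"] by (simp add: h_def)
    then show ?thesis using disk_moebius_disk[OF that(1) U(3)[OF that(2)]] that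
      by (cases s) (simp add: A_def moebius_params_def)
  qed
  have "\<forall>x\<in>B \<inter> (moebius_params \<times> point_Grassmannian ev).
      pt_proj (h x) = (case x of (s, X) \<Rightarrow> act (disk_moebius s) X)"
  proof
    fix x assume "x \<in> B \<inter> (moebius_params \<times> point_Grassmannian ev)"
    then obtain s b where x: "x = (s, pt_proj b)" "s \<in> moebius_params" "b \<in> unit_disk" "pt_proj b \<in> U"
      by (auto simp: point_Grassmannian_eq B_def A_def)
    then show "pt_proj (h x) = (case x of (s, X) \<Rightarrow> act (disk_moebius s) X)"
      using eq[OF x(2,4)] U(4)[OF x(3,4)] act_pt_proj[OF x(3)] by simp
  qed
  moreover have "p \<in> B" using eq[OF p(2) U(1)] unfolding B_def p(1) by blast
  ultimately show "\<exists>U g. p \<in> U \<and> smooth_on U g \<and>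
      (\<forall>x\<in>U \<inter> (moebius_params \<times> point_Grassmannian ev). g x = (case x of (s, X) \<Rightarrow> act (disk_moebius s) X))"
    using fsmooth_imp_smooth_on[OF g] by blast
qed

end

theorem corollary3p11:
  fixes ev :: "'h::complex_hilbert_space \<Rightarrow> complex \<Rightarrow> complex"
    and k :: "complex \<Rightarrow> 'h"
  assumes rkhs: "analytic_rkhs_on_disk ev k"
    and infinite_dim: "\<not> (\<exists>B :: 'h set. finite B \<and> complex_hilbert.span B = UNIV)"
    and kernel_nonzero: "\<forall>a\<in>unit_disk. k a \<noteq> 0"
    and kernels_independent: "\<forall>a\<in>unit_disk. \<forall>b\<in>unit_disk. a \<noteq> b \<longrightarrow>
      k a \<noteq> k b \<and> complex_hilbert.independent {k a, k b}"
    and composition: "\<forall>\<phi>\<in>carrier moebius_group. \<forall>f :: 'h. \<exists>g :: 'h. \<forall>z\<in>unit_disk.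
      ev g z = ev f (inv_into unit_disk \<phi> z)"
    and boundary: "\<forall>(w :: nat \<Rightarrow> complex) \<zeta>. (\<forall>n. w n \<in> unit_disk) \<and> \<zeta> \<in> sphere 0 1 \<and> w \<longlonglongrightarrow> \<zeta> \<longrightarrow>
      (\<forall>z\<in>unit_disk. (\<lambda>n. ev (k (w n)) z / complex_of_real (norm (k (w n)))) \<longlonglongrightarrow> 0)"
  shows "closed_submanifold_of (point_Grassmannian ev) Grassmannian \<and>
    (\<exists>act. (\<forall>\<phi>\<in>carrier moebius_group. \<forall>a\<in>unit_disk.
        act \<phi> (proj_onto (vanishing_space ev a)) = proj_onto (vanishing_space ev (\<phi> a))) \<and>
      homogeneous_space moebius_group moebius_params disk_moebius (point_Grassmannian ev) act)"
proof -
  interpret moebius_rkhs ev k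
    using assms by unfold_locales
  have "act \<phi> (proj_onto (vanishing_space ev a)) = proj_onto (vanishing_space ev (\<phi> a))"
    if \<phi>: "\<phi> \<in> carrier moebius_group" and a: "a \<in> unit_disk" for \<phi> a
  proof -
    have "\<phi> a \<in> unit_disk" using \<phi> a disk_moebius_disk by (auto simp: carrier_moebius_group simp del: mem_ball)
    then show ?thesis using a by (simp add: proj_onto_vanishing_space act_pt_proj)
  qed
  moreover have "homogeneous_space moebius_group moebius_params disk_moebius (point_Grassmannian ev) act"
    by (simp add: homogeneous_space_def lie_group_moebius_group submanifold_point_Grassmannian
        transitive_action_act smooth_act)
  ultimately show ?thesis using closed_submanifold by blast
qed

end
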